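(* For every positive integer $n$ and every $\mathbf b\in\mathbb Z_{>0}^n$ with $\mathbf b\ne(1)$ (i.e. excluding the case $n=1$, $b_1=1$), $$\mathrm{vol}\,\mathfrak X_n(\mathbf b)=\sum_{\substack{\alpha\in\mathcal D(n)\\ \sum_A\alpha_A=n}}\ \prod_{\emptyset\ne A\subseteq[n]}\frac{w_{|A|}(\mathbf b)^{\alpha_A}}{\alpha_A!}.$$
   Context: For $\mathbf b=(b_1,\dots,b_n)\in\mathbb Z_{>0}^n$, a $\mathbf b$-parking function is a list $(\beta_1,\dots,\beta_n)$ of positive integers whose nondecreasing rearrangement $\beta_1'\le\cdots\le\beta_n'$ satisfies $\beta_i'\le b_1+\cdots+b_i$ for all $i$. The $\mathbf b$-parking-function polytope $\mathfrak X_n(\mathbf b)\subset\mathbb R^n$ is the convex hull of all $\mathbf b$-parking functions of length $n$. $\mathrm{vol}$ is Euclidean volume in $\mathbb R^n$. $[n]=\{1,\dots,n\}$. Define $w_1(\mathbf b):=b_1-1$ and, for $2\le k\le n$, $w_k(\mathbf b):=\sum_{j=0}^{k-2}(-1)^j\binom{k-2}{j}b_{k-j}$. The convention $0^0=1$ is used. $\mathcal D(n)$ is the (finite) set of all sequences $\alpha=(\alpha_A)$ of nonnegative integers, indexed by the nonempty subsets $A\subseteq[n]$, such that $\sum_{A\in E}\alpha_A\le\bigl|\bigcup_{A\in E}A\bigr|$ for every nonempty collection $E$ of nonempty subsets of $[n]$. *)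

theory Defs
  imports "HOL-Analysis.Analysis" "HOL-Library.Multiset"
begin

text \<open>
  A vector b = (b_1, ..., b_n) of positive integers is a function on nat of which only the
  values at 1, ..., n are used. The ambient space R^n is real ^ 'n with n = CARD('n);
  accordingly, the n entries of a parking function are indexed by the n-element type 'n.
\<close>

definition nondecreasing_rearrangement :: "nat ^ 'n \<Rightarrow> nat list" where
  "nondecreasing_rearrangement \<beta> =
     sorted_list_of_multiset (image_mset (\<lambda>k. \<beta> $ k) (mset_set UNIV))"

lemma length_nondecreasing_rearrangement:
  "length (nondecreasing_rearrangement (\<beta> :: nat ^ 'n)) = CARD('n)"
  unfolding nondecreasing_rearrangement_def
  by (metis mset_sorted_list_of_multiset size_image_mset size_mset size_mset_set)

text \<open>List positions start at 0, so the i-th smallest entry is found at position i - 1.\<close>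

definition parking_function :: "(nat \<Rightarrow> nat) \<Rightarrow> nat ^ 'n \<Rightarrow> bool" where
  "parking_function b \<beta> \<longleftrightarrow>
     (\<forall>k. 0 < \<beta> $ k) \<and>
     (\<forall>i\<in>{1..CARD('n)}. nondecreasing_rearrangement \<beta> ! (i - 1) \<le> (\<Sum>j=1..i. b j))"

definition parking_polytope :: "(nat \<Rightarrow> nat) \<Rightarrow> (real ^ 'n) set" where
  "parking_polytope b =
     convex hull ((\<lambda>\<beta>. \<chi> k. real (\<beta> $ k)) ` {\<beta> :: nat ^ 'n. parking_function b \<beta>})"

text \<open>Only the values at k \<open>\<ge>\<close> 1 are meaningful.\<close>

definition w :: "(nat \<Rightarrow> nat) \<Rightarrow> nat \<Rightarrow> int" where
  "w b k =
     (if k = 1 then int (b 1) - 1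
      else (\<Sum>j=0..k-2. (- 1) ^ j * int ((k - 2) choose j) * int (b (k - j))))"

definition nonempty_subsets :: "nat \<Rightarrow> nat set set" where
  "nonempty_subsets n = {A. A \<noteq> {} \<and> A \<subseteq> {1..n}}"

text \<open>Extensionality makes the functions below correspond one-to-one to families indexed by
  the nonempty subsets of {1, ..., n}.\<close>

definition draconian :: "nat \<Rightarrow> (nat set \<Rightarrow> nat) set" where
  "draconian n =
     {\<alpha> \<in> extensional (nonempty_subsets n).
        \<forall>E. E \<noteq> {} \<and> E \<subseteq> nonempty_subsets n \<longrightarrow> (\<Sum>A\<in>E. \<alpha> A) \<le> card (\<Union>E)}"

lemma finite_nonempty_subsets: "finite (nonempty_subsets n)"
  by (rule finite_subset[of _ "Pow {1..n}"]) (auto simp: nonempty_subsets_def)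

lemma finite_draconian: "finite (draconian n)"
proof -
  have "\<alpha> A \<le> card A" if "\<alpha> \<in> draconian n" "A \<in> nonempty_subsets n" for \<alpha> A
  proof -
    have "{A} \<noteq> {} \<and> {A} \<subseteq> nonempty_subsets n"
      using that by simp
    then have "(\<Sum>A\<in>{A}. \<alpha> A) \<le> card (\<Union>{A})"
      using that(1) unfolding draconian_def by blast
    then show ?thesis by simp
  qed
  then have "draconian n \<subseteq> (\<Pi>\<^sub>E A\<in>nonempty_subsets n. {..card A})"
    by (auto simp: draconian_def PiE_def)
  then show ?thesis
    by (rule finite_subset) (auto intro: finite_PiE finite_nonempty_subsets)
qed

end

theory Submission
  imports Defs
begin

text \<open>
  Translating by (1, ..., 1) turns the parking polytope into the independence polytope
  \<open>P(g) = {y \<ge> 0. \<forall>U. y(U) \<le> g(U)}\<close> of a polymatroid: \<open>y(U)\<close> is the sum of the coordinates in U, and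
  \<open>g(U)\<close> is the sum of the \<open>|U|\<close> largest of the numbers \<open>b\<^sub>1 + \<dots> + b\<^sub>i - 1\<close>. Binomial inversion
  identifies the coefficients in \<open>g(U) = (\<Sum>A. A \<inter> U \<noteq> {}. c(A))\<close> as \<open>c(A) = w\<^bsub>|A|\<^esub>\<close>. The statement is then
  an instance of \<open>polymatroid_volume\<close>: for every polymatroid of this form, with real coefficients of
  arbitrary sign, the volume of \<open>P(g)\<close> is \<open>1/n!\<close> times the sum of the products
  \<open>c(A\<^sub>1) \<cdots> c(A\<^sub>n)\<close> over all sequences of nonempty sets that satisfy Hall's condition. Collecting the
  sequences according to the multiplicity of each set gives the sum over draconian \<open>\<alpha>\<close>.

  As the coefficients may be negative, the volume formula does not follow from a subdivision of a
  Minkowski sum. It is proved by induction on the number n of coordinates, by deforming g. Two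
  recursions of the same shape are compared.

  \<^item> Geometry. The supermodular function \<open>y(U) - g(U)\<close> of U has a least maximizer S. Sorting the
    nonnegative vectors y by S cuts the orthant into cells that are products: the coordinates in S
    lie above the facet \<open>y(S) = g(S)\<close>, and those outside S lie in the polytope of the contraction
    of g by S. This computes the volume of \<open>P(g + t)\<close> exactly and bounds the volume of \<open>P(g')\<close> for
    any \<open>g'\<close> in terms of \<open>P(g)\<close>, the heights \<open>g'(S) - g(S)\<close> and smaller polytopes.

  \<^item> Combinatorics. A sequence of \<open>n - 1\<close> sets that satisfies Hall's condition together with one more
    set A has a largest tight subfamily. Let S be the complement of its union; then S meets A, the
    sets of the subfamily form a Hall sequence on the complement of S, and the traces of the other
    sets on S satisfy the strict (dragon) form of the condition. Hence the derivative of the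
    polynomial on the right-hand side is a sum over S of a dragon polynomial times a smaller
    Hall polynomial (\<open>marriage_poly_derivative\<close>).

  By induction the two recursions show that the dragon polynomial of a proper subset S is the rate
  at which the cell of S grows (\<open>excess_volume_derivative\<close>). Therefore, along a segment of
  polymatroids that increases pointwise and keeps \<open>g(I)\<close> fixed, so that only proper subsets S
  matter, the volume grows at most as fast as the polynomial (\<open>volume_difference_le\<close>). Such segments
  lead from a box, given by a point of the base polytope of g, to g, and from g to a simplex. For the
  box and for the simplex the formula is evident; the first segment gives \<open>\<le>\<close>, the second \<open>\<ge>\<close>.
\<close>


section \<open>Hall and dragon sequences\<close>

definition families :: "'k set \<Rightarrow> 'a set \<Rightarrow> ('k \<Rightarrow> 'a set) set" where
  "families K I = K \<rightarrow>\<^sub>E (Pow I - {{}})"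

text \<open>
  For \<open>e = 0\<close> this is Hall's marriage condition; for \<open>e = 1\<close> it is the condition of the dragon
  marriage problem, under which distinct representatives still exist after any one element has been
  removed from all sets.
\<close>
definition hall :: "nat \<Rightarrow> 'k set \<Rightarrow> ('k \<Rightarrow> 'a set) \<Rightarrow> bool" where
  "hall e K f \<longleftrightarrow> (\<forall>J\<subseteq>K. J \<noteq> {} \<longrightarrow> card J + e \<le> card (\<Union>(f ` J)))"

definition hall_sum :: "nat \<Rightarrow> 'k set \<Rightarrow> 'a set \<Rightarrow> ('a set \<Rightarrow> real) \<Rightarrow> real" where
  "hall_sum e K I c = (\<Sum>f | f \<in> families K I \<and> hall e K f. \<Prod>k\<in>K. c (f k))"

text \<open>
  The index set of the sequences is fixed to an initial segment of the natural numbers; the value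
  depends on its size only. Dragon sequences on I are one shorter than Hall sequences.
\<close>
definition marriage_poly :: "'a set \<Rightarrow> ('a set \<Rightarrow> real) \<Rightarrow> real" where
  "marriage_poly I c = hall_sum 0 {..<card I} I c / fact (card I)"

definition dragon_poly :: "'a set \<Rightarrow> ('a set \<Rightarrow> real) \<Rightarrow> real" where
  "dragon_poly I c = hall_sum 1 {..<card I - 1} I c / fact (card I - 1)"

text \<open>
  The rank function of the signed Minkowski sum of the simplices \<open>conv({0} \<union> {e\<^sub>i. i \<in> A})\<close> with
  coefficients \<open>c(A)\<close>.
\<close>
definition rank_of :: "'a set \<Rightarrow> ('a set \<Rightarrow> real) \<Rightarrow> 'a set \<Rightarrow> real" where
  "rank_of I c U = (\<Sum>A | A \<subseteq> I \<and> A \<inter> U \<noteq> {}. c A)"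

text \<open>
  The coefficients on S that describe the restriction to subsets of S of the rank function given by
  c on I. The contraction by S needs no such operation: its coefficients are those of c on the subsets
  of \<open>I - S\<close>.
\<close>
definition trace_coeffs :: "'a set \<Rightarrow> 'a set \<Rightarrow> ('a set \<Rightarrow> real) \<Rightarrow> 'a set \<Rightarrow> real" where
  "trace_coeffs I S c C = (\<Sum>B | B \<subseteq> I \<and> B \<inter> S = C. c B)"

lemma finite_families [simp]: "finite K \<Longrightarrow> finite I \<Longrightarrow> finite (families K I)"
  unfolding families_def by (intro finite_PiE) auto

lemma hall_cong:
  assumes "\<And>k. k \<in> K \<Longrightarrow> f k = g k"
  shows "hall e K f \<longleftrightarrow> hall e K g"
proof -
  have "\<Union>(f ` J) = \<Union>(g ` J)" if "J \<subseteq> K" for J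
    using assms that by (intro arg_cong[of _ _ Union] image_cong) auto
  then show ?thesis unfolding hall_def by metis
qed

lemma hall_reindex:
  assumes "bij_betw p K K'" "hall e K' f"
  shows "hall e K (\<lambda>k. f (p k))"
  unfolding hall_def
proof (intro allI impI)
  fix J assume J: "J \<subseteq> K" "J \<noteq> {}"
  then have "card (p ` J) = card J"
    using assms(1) by (meson bij_betw_def card_image inj_on_subset)
  moreover have "p ` J \<subseteq> K'" "p ` J \<noteq> {}"
    using J assms(1) by (auto simp: bij_betw_def)
  ultimately have "card J + e \<le> card (\<Union>(f ` (p ` J)))"
    using assms(2) unfolding hall_def by metis
  then show "card J + e \<le> card (\<Union>((\<lambda>k. f (p k)) ` J))"
    by (simp add: image_image)
qed

lemma hall_sum_reindex:
  assumes p: "bij_betw p K K'"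
  shows "hall_sum e K I c = hall_sum e K' I c"
proof -
  define q where "q = inv_into K p"
  have q: "bij_betw q K' K"
    unfolding q_def by (rule bij_betw_inv_into[OF p])
  have pq: "p (q k) = k" if "k \<in> K'" for k
    using that p unfolding q_def by (meson bij_betw_inv_into_right)
  have qp: "q (p k) = k" if "k \<in> K" for k
    using that p unfolding q_def by (meson bij_betw_inv_into_left)
  have pK: "p k \<in> K'" if "k \<in> K" for k using p that by (meson bij_betwE)
  have qK: "q k \<in> K" if "k \<in> K'" for k using q that by (meson bij_betwE)
  show ?thesis
    unfolding hall_sum_def
  proof (rule sum.reindex_bij_witness[where i = "\<lambda>f. \<lambda>k\<in>K. f (p k)" and j = "\<lambda>f. \<lambda>k\<in>K'. f (q k)"], goal_cases)
    case (1 f)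
    then show ?case
      by (auto simp: families_def fun_eq_iff qp pK PiE_def extensional_def)
  next
    case (2 f)
    then have "hall e K' (\<lambda>k. f (q k))"
      by (intro hall_reindex[OF q]) auto
    then have "hall e K' (\<lambda>k\<in>K'. f (q k))"
      by (subst hall_cong[where g = "\<lambda>k. f (q k)"]) auto
    then show ?case using 2 qK by (auto simp: families_def PiE_iff)
  next
    case (3 f)
    then show ?case
      by (auto simp: families_def fun_eq_iff pq qK PiE_def extensional_def)
  next
    case (4 f)
    then have "hall e K (\<lambda>k. f (p k))"
      by (intro hall_reindex[OF p]) auto
    then have "hall e K (\<lambda>k\<in>K. f (p k))"
      by (subst hall_cong[where g = "\<lambda>k. f (p k)"]) auto
    then show ?case using 4 pK by (auto simp: families_def PiE_iff)
  next
    case (5 f)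
    have "(\<Prod>k\<in>K'. c ((\<lambda>k\<in>K'. f (q k)) k)) = (\<Prod>k\<in>K'. c (f (q k)))"
      by simp
    also have "\<dots> = (\<Prod>k\<in>K. c (f k))"
      by (rule prod.reindex_bij_betw[OF q])
    finally show ?case .
  qed
qed

lemma hall_sum_marriage:
  assumes "finite K" "card K = card I"
  shows "hall_sum 0 K I c = fact (card I) * marriage_poly I c"
proof -
  obtain p where "bij_betw p K {..<card I}"
    using assms by (metis card_lessThan finite_lessThan finite_same_card_bij)
  then show ?thesis
    unfolding marriage_poly_def by (simp add: hall_sum_reindex)
qed

lemma hall_sum_dragon:
  assumes "finite K" "Suc (card K) = card I"
  shows "hall_sum 1 K I c = fact (card K) * dragon_poly I c"
proof -
  have "card K = card {..<card I - 1}" using assms by simp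
  then obtain p where "bij_betw p K {..<card I - 1}"
    using assms by (metis finite_lessThan finite_same_card_bij)
  moreover have "card I - 1 = card K" using assms by simp
  ultimately show ?thesis
    unfolding dragon_poly_def by (simp add: hall_sum_reindex)
qed

text \<open>
  Each factor \<open>trace_coeffs I S c C\<close> is a sum over the sets with trace C; expanding the product
  chooses such a set for every index. This is why sequences are used here rather than
  multiplicity vectors: no multinomial coefficients arise.
\<close>
lemma hall_sum_trace:
  assumes "finite L" "finite I" "S \<subseteq> I"
  shows "hall_sum e L S (trace_coeffs I S c) =
    (\<Sum>h | h \<in> L \<rightarrow>\<^sub>E {B. B \<subseteq> I \<and> B \<inter> S \<noteq> {}} \<and> hall e L (\<lambda>k. h k \<inter> S). \<Prod>k\<in>L. c (h k))"
    (is "_ = sum ?P ?H")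
proof -
  let ?g = "\<lambda>h. \<lambda>k\<in>L. h k \<inter> S"
  let ?Y = "{y \<in> families L S. hall e L y}"
  have finS: "finite S" using assms finite_subset by blast
  have finH: "finite ?H"
    by (rule finite_subset[of _ "L \<rightarrow>\<^sub>E Pow I"]) (use assms in \<open>auto simp: PiE_iff extensional_def intro!: finite_PiE\<close>)
  have gH: "?g ` ?H \<subseteq> ?Y"
  proof safe
    fix h assume h: "h \<in> L \<rightarrow>\<^sub>E {B. B \<subseteq> I \<and> B \<inter> S \<noteq> {}}" "hall e L (\<lambda>k. h k \<inter> S)"
    show "?g h \<in> families L S"
      using h(1) unfolding families_def by (auto simp: PiE_iff)
    show "hall e L (?g h)"
      using h(2) by (subst hall_cong[where g = "\<lambda>k. h k \<inter> S"]) auto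
  qed
  have fib: "{h \<in> ?H. ?g h = y} = (\<Pi>\<^sub>E k\<in>L. {B. B \<subseteq> I \<and> B \<inter> S = y k})" if y: "y \<in> ?Y" for y
  proof -
    have ne: "y k \<noteq> {}" if "k \<in> L" for k using y that by (auto simp: families_def PiE_iff)
    have ye: "y \<in> extensional L" using y by (auto simp: families_def PiE_iff)
    have "?g h = y \<longleftrightarrow> (\<forall>k\<in>L. h k \<inter> S = y k)" for h
      using ye by (auto simp: fun_eq_iff extensional_def)
    moreover have "hall e L (\<lambda>k. h k \<inter> S)" if "\<forall>k\<in>L. h k \<inter> S = y k" for h
      using y that by (subst hall_cong[where g = y]) auto
    ultimately show ?thesis
      using ne by (auto simp: PiE_iff extensional_def)
  qed
  have "sum ?P ?H = (\<Sum>y\<in>?Y. sum ?P {h \<in> ?H. ?g h = y})"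
    by (rule sum.group[symmetric]) (use finH gH assms finS in auto)
  also have "\<dots> = (\<Sum>y\<in>?Y. \<Prod>k\<in>L. trace_coeffs I S c (y k))"
  proof (rule sum.cong)
    fix y assume y: "y \<in> ?Y"
    show "sum ?P {h \<in> ?H. ?g h = y} = (\<Prod>k\<in>L. trace_coeffs I S c (y k))"
      unfolding fib[OF y] trace_coeffs_def
      by (rule prod_sum_PiE[symmetric]) (use assms in auto)
  qed simp
  finally show ?thesis unfolding hall_sum_def by simp
qed

section \<open>Splitting a sequence at its largest tight subfamily\<close>

context
  fixes K :: "'k set" and I :: "'a set"
  assumes finK: "finite K" and finI: "finite I" and cardI: "card I = Suc (card K)"
begin

text \<open>
  The sequences whose largest tight subfamily is indexed by J and has union \<open>I - S\<close>; that these
  conditions describe them is the content of the lemmas below.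
\<close>
definition split_families :: "'a set \<Rightarrow> 'k set \<Rightarrow> ('k \<Rightarrow> 'a set) set" where
  "split_families S J = {f \<in> families K I. (\<forall>k\<in>J. f k \<subseteq> I - S) \<and> hall 0 J f \<and> hall 1 (K - J) (\<lambda>k. f k \<inter> S)}"

definition splits :: "('a set \<times> 'k set) set" where
  "splits = {(S, J). S \<subseteq> I \<and> J \<subseteq> K \<and> card J = card (I - S)}"

lemma families_Union_subset: "f \<in> families K I \<Longrightarrow> L \<subseteq> K \<Longrightarrow> \<Union>(f ` L) \<subseteq> I"
  by (auto simp: families_def PiE_iff)

lemma finite_families_Union: "f \<in> families K I \<Longrightarrow> L \<subseteq> K \<Longrightarrow> finite (\<Union>(f ` L))"
  using families_Union_subset finI finite_subset by metis

text \<open>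
  The part of L inside J covers enough of \<open>I - S\<close>, and the part outside J covers more than enough
  of S. So no subset of K that is not contained in J is tight.
\<close>
lemma split_families_card:
  assumes "(S, J) \<in> splits" "f \<in> split_families S J" "L \<subseteq> K"
  shows "card L + (if L \<subseteq> J then 0 else 1) \<le> card (\<Union>(f ` L))"
proof -
  have finL: "finite L" using assms finK finite_subset by blast
  let ?L1 = "L \<inter> J" and ?L2 = "L - J"
  have f: "f \<in> families K I" "hall 0 J f" "hall 1 (K - J) (\<lambda>k. f k \<inter> S)" "\<And>k. k \<in> J \<Longrightarrow> f k \<subseteq> I - S"
    using assms(2) by (auto simp: split_families_def)
  have 1: "card ?L1 \<le> card (\<Union>(f ` ?L1))"
    using f(2) unfolding hall_def by (cases "?L1 = {}") auto
  have 2: "card ?L2 + (if L \<subseteq> J then 0 else 1) \<le> card (\<Union>((\<lambda>k. f k \<inter> S) ` ?L2))"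
  proof (cases "L \<subseteq> J")
    case True
    then have "?L2 = {}" by auto
    then show ?thesis using True by (simp only: card.empty) simp
  next
    case False
    then have "?L2 \<subseteq> K - J" "?L2 \<noteq> {}" using assms by auto
    then show ?thesis using f(3) False unfolding hall_def by auto
  qed
  have "card (\<Union>(f ` ?L1)) + card (\<Union>((\<lambda>k. f k \<inter> S) ` ?L2)) =
      card (\<Union>(f ` ?L1) \<union> \<Union>((\<lambda>k. f k \<inter> S) ` ?L2))"
  proof (rule card_Un_disjoint[symmetric])
    show "finite (\<Union>(f ` ?L1))" using assms by (intro finite_families_Union f) auto
    have "\<Union>((\<lambda>k. f k \<inter> S) ` ?L2) \<subseteq> \<Union>(f ` ?L2)" by auto
    moreover have "finite (\<Union>(f ` ?L2))" using assms by (intro finite_families_Union f) auto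
    ultimately show "finite (\<Union>((\<lambda>k. f k \<inter> S) ` ?L2))" by (rule finite_subset)
    show "\<Union>(f ` ?L1) \<inter> \<Union>((\<lambda>k. f k \<inter> S) ` ?L2) = {}" using f(4) by blast
  qed
  also have "\<dots> \<le> card (\<Union>(f ` L))"
    by (rule card_mono) (use finite_families_Union[OF f(1) assms(3)] in auto)
  finally have "card ?L1 + card ?L2 + (if L \<subseteq> J then 0 else 1) \<le> card (\<Union>(f ` L))"
    using 1 2 by linarith
  moreover have "card ?L1 + card ?L2 = card L"
    using finL by (metis card_Int_Diff)
  ultimately show ?thesis by simp
qed

lemma split_families_Union:
  assumes "(S, J) \<in> splits" "f \<in> split_families S J"
  shows "\<Union>(f ` J) = I - S"
proof (rule card_subset_eq)
  show "finite (I - S)" using finI by simp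
  show sub: "\<Union>(f ` J) \<subseteq> I - S" using assms by (auto simp: split_families_def)
  have "card J \<le> card (\<Union>(f ` J))"
    using split_families_card[OF assms, of J] assms by (auto simp: splits_def)
  moreover have "card (\<Union>(f ` J)) \<le> card (I - S)"
    using sub finI by (intro card_mono) auto
  ultimately show "card (\<Union>(f ` J)) = card (I - S)" using assms by (auto simp: splits_def)
qed

lemma split_families_unique:
  assumes "(S, J) \<in> splits" "f \<in> split_families S J" "(S', J') \<in> splits" "f \<in> split_families S' J'"
  shows "S = S' \<and> J = J'"
proof -
  have "J' \<subseteq> J" if "(S, J) \<in> splits" "f \<in> split_families S J" "(S', J') \<in> splits" "f \<in> split_families S' J'"
    for S J S' J'
  proof (rule ccontr)
    assume "\<not> J' \<subseteq> J"
    then have "card J' + 1 \<le> card (\<Union>(f ` J'))"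
      using split_families_card[OF that(1,2), of J'] that(3) by (auto simp: splits_def)
    moreover have "card (\<Union>(f ` J')) = card J'"
      using split_families_Union[OF that(3,4)] that(3) by (auto simp: splits_def)
    ultimately show False by simp
  qed
  from this[OF assms] this[OF assms(3,4,1,2)] have "J = J'" by auto
  moreover from this have "I - S = I - S'"
    using split_families_Union[OF assms(1,2)] split_families_Union[OF assms(3,4)] by simp
  ultimately show ?thesis using assms by (auto simp: splits_def)
qed

text \<open>
  Adding A violates Hall's condition exactly if A is contained in the union of a tight subfamily.
  For the forward direction, J is chosen as a tight index set of maximal size; tightness of a
  larger set would contradict the choice, which yields the strict condition on S.
\<close>
lemma extendable_iff_split:
  assumes A: "A \<subseteq> I"
  shows "f \<in> families K I \<and> (\<forall>L\<subseteq>K. card L < card (A \<union> \<Union>(f ` L))) \<and> hall 0 K f \<longleftrightarrow>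
     (\<exists>(S, J)\<in>splits. S \<inter> A \<noteq> {} \<and> f \<in> split_families S J)" (is "?lhs \<longleftrightarrow> ?rhs")
proof
  assume ?rhs
  then obtain S J where SJ: "(S, J) \<in> splits" and f: "f \<in> split_families S J" and ne: "S \<inter> A \<noteq> {}"
    by auto
  have fam: "f \<in> families K I" using f by (simp add: split_families_def)
  have hall: "hall 0 K f"
    unfolding hall_def using add_leD1[OF split_families_card[OF SJ f]] by simp
  have "card L < card (A \<union> \<Union>(f ` L))" if L: "L \<subseteq> K" for L
  proof -
  have fin: "finite (A \<union> \<Union>(f ` L))"
    using finite_families_Union[OF fam L] A finI finite_subset by blast
  show ?thesis
  proof (cases "L \<subseteq> J")
    case True
    then have "\<Union>(f ` L) \<subseteq> I - S" using f by (auto simp: split_families_def)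
    moreover obtain x where "x \<in> S" "x \<in> A" using ne by blast
    ultimately have "x \<notin> \<Union>(f ` L)" "x \<in> A" by blast+
    then have "\<Union>(f ` L) \<subset> A \<union> \<Union>(f ` L)" by blast
    then have "card (\<Union>(f ` L)) < card (A \<union> \<Union>(f ` L))"
      by (rule psubset_card_mono[OF fin])
    then show ?thesis using split_families_card[OF SJ f L] by simp
  next
    case False
    then have "card L < card (\<Union>(f ` L))" using split_families_card[OF SJ f L] by simp
    also have "\<dots> \<le> card (A \<union> \<Union>(f ` L))" by (rule card_mono[OF fin]) auto
    finally show ?thesis .
  qed
  qed
  with fam hall show ?lhs by blast
next
  assume ?lhs
  then have f: "f \<in> families K I" and ext: "\<And>L. L \<subseteq> K \<Longrightarrow> card L < card (A \<union> \<Union>(f ` L))"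
    and h: "hall 0 K f"
    by auto
  let ?tight = "\<lambda>J. J \<subseteq> K \<and> card (\<Union>(f ` J)) = card J"
  have "?tight {}" by simp
  moreover have "\<forall>J. ?tight J \<longrightarrow> card J < Suc (card K)"
    using finK by (auto simp: less_Suc_eq_le intro: card_mono)
  ultimately obtain J where J: "?tight J" and Jmax: "\<And>J'. ?tight J' \<Longrightarrow> card J' \<le> card J"
    using ex_has_greatest_nat[of ?tight "{}" card "Suc (card K)"] by auto
  define S where "S = I - \<Union>(f ` J)"
  have IS: "I - S = \<Union>(f ` J)"
    unfolding S_def using families_Union_subset[OF f, of J] J by auto
  have SJ: "(S, J) \<in> splits" using J IS unfolding splits_def by (auto simp: S_def)
  have "S \<inter> A \<noteq> {}"
  proof
    assume "S \<inter> A = {}"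
    then have "A \<union> \<Union>(f ` J) = \<Union>(f ` J)" using A unfolding S_def by auto
    then show False using ext[of J] J by simp
  qed
  moreover have "hall 1 (K - J) (\<lambda>k. f k \<inter> S)"
    unfolding hall_def
  proof (intro allI impI)
    fix L assume L: "L \<subseteq> K - J" "L \<noteq> {}"
    have fin: "finite L" "finite J" using L J finK by (auto intro: finite_subset)
    have cJL: "card (J \<union> L) = card J + card L" using L fin by (intro card_Un_disjoint) auto
    have "card L > 0" using L fin by (simp add: card_gt_0_iff)
    then have "\<not> ?tight (J \<union> L)" using Jmax[of "J \<union> L"] cJL by auto
    moreover have "card (J \<union> L) \<le> card (\<Union>(f ` (J \<union> L)))"
      using h L J unfolding hall_def by (metis Diff_subset Un_empty add_0_right le_sup_iff order_trans)
    ultimately have "card (J \<union> L) < card (\<Union>(f ` (J \<union> L)))" using L J by auto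
    moreover have "\<Union>(f ` (J \<union> L)) = \<Union>(f ` J) \<union> \<Union>((\<lambda>k. f k \<inter> S) ` L)"
      using families_Union_subset[OF f, of "J \<union> L"] L J unfolding S_def by blast
    moreover have "card (\<Union>(f ` J) \<union> \<Union>((\<lambda>k. f k \<inter> S) ` L)) \<le> card (\<Union>(f ` J)) + card (\<Union>((\<lambda>k. f k \<inter> S) ` L))"
      by (rule card_Un_le)
    ultimately show "card L + 1 \<le> card (\<Union>((\<lambda>k. f k \<inter> S) ` L))" using J cJL by simp
  qed
  moreover have "hall 0 J f" using h J unfolding hall_def by auto
  ultimately show ?rhs
    using SJ f IS unfolding split_families_def by (intro bexI[of _ "(S, J)"]) auto
qed

lemma sum_split_families:
  assumes SJ: "(S, J) \<in> splits"
  shows "(\<Sum>f\<in>split_families S J. \<Prod>k\<in>K. c (f k)) =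
    hall_sum 0 J (I - S) c * hall_sum 1 (K - J) S (trace_coeffs I S c)"
proof -
  have J: "J \<subseteq> K" and S: "S \<subseteq> I" using SJ by (auto simp: splits_def)
  have finJ: "finite J" using J finK finite_subset by blast
  let ?F = "{f \<in> families J (I - S). hall 0 J f}"
  let ?H = "{h. h \<in> (K - J) \<rightarrow>\<^sub>E {B. B \<subseteq> I \<and> B \<inter> S \<noteq> {}} \<and> hall 1 (K - J) (\<lambda>k. h k \<inter> S)}"
  have "hall_sum 0 J (I - S) c * hall_sum 1 (K - J) S (trace_coeffs I S c) =
     (\<Sum>f\<in>?F. \<Prod>k\<in>J. c (f k)) * (\<Sum>h\<in>?H. \<Prod>k\<in>K - J. c (h k))"
    using finK finI S by (subst hall_sum_trace) (auto simp: hall_sum_def)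
  also have "\<dots> = (\<Sum>(f, h)\<in>?F \<times> ?H. (\<Prod>k\<in>J. c (f k)) * (\<Prod>k\<in>K - J. c (h k)))"
    by (simp add: sum_product sum.cartesian_product)
  also have "\<dots> = (\<Sum>f\<in>split_families S J. \<Prod>k\<in>K. c (f k))"
  proof (rule sum.reindex_bij_witness[where j = "merge J (K - J)" and i = "\<lambda>f. (restrict f J, restrict f (K - J))"], goal_cases)
    case (1 a)
    then show ?case by (auto simp: families_def PiE_iff merge_def fun_eq_iff extensional_def)
  next
    case (2 a)
    obtain f h where a: "a = (f, h)" by (cases a)
    let ?m = "merge J (K - J) (f, h)"
    have f: "f \<in> families J (I - S)" "hall 0 J f" and h: "h \<in> (K - J) \<rightarrow>\<^sub>E {B. B \<subseteq> I \<and> B \<inter> S \<noteq> {}}" "hall 1 (K - J) (\<lambda>k. h k \<inter> S)"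
      using 2 a by auto
    have "?m \<in> families K I"
      using f(1) h(1) J unfolding families_def merge_def
      by (auto simp: PiE_iff extensional_def Pi_iff)
    moreover have "hall 0 J ?m"
      using f(2) by (subst hall_cong[where g = f]) (auto simp: merge_def)
    moreover have "hall 1 (K - J) (\<lambda>k. ?m k \<inter> S)"
      using h(2) by (subst hall_cong[where g = "\<lambda>k. h k \<inter> S"]) (auto simp: merge_def)
    moreover have "\<forall>k\<in>J. ?m k \<subseteq> I - S" using f(1) by (auto simp: merge_def families_def PiE_iff)
    ultimately show ?case by (simp add: split_families_def a)
  next
    case (3 f)
    then show ?case using J by (auto simp: split_families_def families_def PiE_iff merge_def fun_eq_iff extensional_def)
  next
    case (4 f)
    then have f: "f \<in> families K I" "\<forall>k\<in>J. f k \<subseteq> I - S" "hall 0 J f" "hall 1 (K - J) (\<lambda>k. f k \<inter> S)"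
      by (auto simp: split_families_def)
    have "f k \<inter> S \<noteq> {}" if k: "k \<in> K - J" for k
    proof
      assume "f k \<inter> S = {}"
      moreover have "card {k} + 1 \<le> card (\<Union>((\<lambda>k. f k \<inter> S) ` {k}))"
        using f(4) k unfolding hall_def by blast
      ultimately show False by simp
    qed
    then have "restrict f (K - J) \<in> (K - J) \<rightarrow>\<^sub>E {B. B \<subseteq> I \<and> B \<inter> S \<noteq> {}}"
      using f(1) by (auto simp: families_def PiE_iff)
    moreover have "hall 1 (K - J) (\<lambda>k. restrict f (K - J) k \<inter> S)"
      using f(4) by (subst hall_cong[where g = "\<lambda>k. f k \<inter> S"]) auto
    moreover have "hall 0 J (restrict f J)"
      using f(3) by (subst hall_cong[where g = f]) auto
    moreover have "restrict f J \<in> families J (I - S)"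
      using f(1,2) J by (auto simp: families_def PiE_iff)
    ultimately show ?case by simp
  next
    case (5 a)
    obtain f h where a: "a = (f, h)" by (cases a)
    have "(\<Prod>k\<in>K. c (merge J (K - J) (f, h) k)) =
      (\<Prod>k\<in>J. c (merge J (K - J) (f, h) k)) * (\<Prod>k\<in>K - J. c (merge J (K - J) (f, h) k))"
      using J finK by (subst prod.subset_diff[OF J]) (auto simp: mult.commute)
    also have "\<dots> = (\<Prod>k\<in>J. c (f k)) * (\<Prod>k\<in>K - J. c (h k))"
      by (intro arg_cong2[of _ _ _ _ "(*)"] prod.cong) (auto simp: merge_def)
    finally show ?case by (simp add: a)
  qed
  finally show ?thesis by simp
qed


text \<open>
  Summing over J contributes the binomial coefficient that turns the product of the factorials for
  \<open>I - S\<close> and for S into the factorial of \<open>card K\<close>, so the normalised polynomials multiply without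
  further constants.
\<close>
lemma sum_extendable_families:
  assumes A: "A \<subseteq> I"
  shows "(\<Sum>f | f \<in> families K I \<and> (\<forall>L\<subseteq>K. card L < card (A \<union> \<Union>(f ` L))) \<and> hall 0 K f. \<Prod>k\<in>K. c (f k)) =
    fact (card K) * (\<Sum>S | S \<subseteq> I \<and> S \<inter> A \<noteq> {}. dragon_poly S (trace_coeffs I S c) * marriage_poly (I - S) c)"
proof -
  let ?T = "{S. S \<subseteq> I \<and> S \<inter> A \<noteq> {}}"
  let ?J = "\<lambda>S. {J. J \<subseteq> K \<and> card J = card (I - S)}"
  let ?Z = "Sigma ?T ?J"
  have finT: "finite ?T" using finI by auto
  have finJ: "finite (?J S)" for S using finK by auto
  have Z: "(S, J) \<in> splits" if "(S, J) \<in> ?Z" for S J using that by (auto simp: splits_def)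
  have fins: "finite (split_families S J)" for S J
    unfolding split_families_def using finK finI by simp
  have ext: "{f. f \<in> families K I \<and> (\<forall>L\<subseteq>K. card L < card (A \<union> \<Union>(f ` L))) \<and> hall 0 K f} =
      (\<Union>z\<in>?Z. case z of (S, J) \<Rightarrow> split_families S J)"
  proof (intro set_eqI)
    fix f
    have "(\<exists>(S, J)\<in>splits. S \<inter> A \<noteq> {} \<and> f \<in> split_families S J) \<longleftrightarrow>
        (\<exists>z\<in>?Z. f \<in> (case z of (S, J) \<Rightarrow> split_families S J))"
      unfolding splits_def by (simp only: Bex_def split_paired_Ex) blast
    then show "f \<in> {f. f \<in> families K I \<and> (\<forall>L\<subseteq>K. card L < card (A \<union> \<Union>(f ` L))) \<and> hall 0 K f} \<longleftrightarrow>
        f \<in> (\<Union>z\<in>?Z. case z of (S, J) \<Rightarrow> split_families S J)"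
      using extendable_iff_split[OF A, of f] by (simp only: mem_Collect_eq UN_iff)
  qed
  have "(\<Sum>f | f \<in> families K I \<and> (\<forall>L\<subseteq>K. card L < card (A \<union> \<Union>(f ` L))) \<and> hall 0 K f. \<Prod>k\<in>K. c (f k)) =
      (\<Sum>z\<in>?Z. \<Sum>f\<in>(case z of (S, J) \<Rightarrow> split_families S J). \<Prod>k\<in>K. c (f k))"
    unfolding ext
  proof (rule sum.UNION_disjoint)
    show "finite ?Z" using finT finJ by simp
    show "\<forall>z\<in>?Z. finite (case z of (S, J) \<Rightarrow> split_families S J)" using fins by auto
    show "\<forall>z\<in>?Z. \<forall>z'\<in>?Z. z \<noteq> z' \<longrightarrow>
        (case z of (S, J) \<Rightarrow> split_families S J) \<inter> (case z' of (S, J) \<Rightarrow> split_families S J) = {}"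
    proof (intro ballI impI)
      fix z z' assume zz: "z \<in> ?Z" "z' \<in> ?Z" "z \<noteq> z'"
      obtain S J S' J' where z: "z = (S, J)" "z' = (S', J')" by (cases z, cases z')
      have "(S, J) \<in> splits" "(S', J') \<in> splits" using Z zz unfolding z by blast+
      then show "(case z of (S, J) \<Rightarrow> split_families S J) \<inter> (case z' of (S, J) \<Rightarrow> split_families S J) = {}"
        using split_families_unique[of S J _ S' J'] zz(3) unfolding z by auto
    qed
  qed
  also have "\<dots> = (\<Sum>(S, J)\<in>?Z. hall_sum 0 J (I - S) c * hall_sum 1 (K - J) S (trace_coeffs I S c))"
  proof (intro sum.cong refl)
    fix z assume z: "z \<in> ?Z"
    obtain S J where SJ: "z = (S, J)" by (cases z)
    have "(S, J) \<in> splits" using Z z unfolding SJ by blast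
    then show "(\<Sum>f\<in>(case z of (S, J) \<Rightarrow> split_families S J). \<Prod>k\<in>K. c (f k)) =
        (case z of (S, J) \<Rightarrow> hall_sum 0 J (I - S) c * hall_sum 1 (K - J) S (trace_coeffs I S c))"
      unfolding SJ by (simp only: prod.case sum_split_families)
  qed
  also have "\<dots> = (\<Sum>S\<in>?T. \<Sum>J\<in>?J S. hall_sum 0 J (I - S) c * hall_sum 1 (K - J) S (trace_coeffs I S c))"
    by (intro sum.Sigma[symmetric] finT) (use finJ in auto)
  also have "\<dots> = (\<Sum>S\<in>?T. fact (card K) * (dragon_poly S (trace_coeffs I S c) * marriage_poly (I - S) c))"
  proof (rule sum.cong)
    fix S assume S: "S \<in> ?T"
    then have cS: "card (I - S) + card S = Suc (card K)" "card S > 0"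
      using cardI finI card_mono[OF finI, of S] finite_subset[of S I]
      by (auto simp: card_Diff_subset card_gt_0_iff)
    then have le: "card (I - S) \<le> card K" by linarith
    have "(\<Sum>J\<in>?J S. hall_sum 0 J (I - S) c * hall_sum 1 (K - J) S (trace_coeffs I S c)) =
       (\<Sum>J\<in>?J S. (fact (card (I - S)) * fact (card K - card (I - S))) *
          (dragon_poly S (trace_coeffs I S c) * marriage_poly (I - S) c))"
    proof (rule sum.cong)
      fix J assume J: "J \<in> ?J S"
      then have finJ: "finite J" using finK finite_subset by auto
      have cKJ: "card (K - J) = card K - card (I - S)"
        using J finJ by (simp add: card_Diff_subset)
      have "Suc (card (K - J)) = card S" using cKJ cS le by linarith
      then have "hall_sum 1 (K - J) S (trace_coeffs I S c) = fact (card (K - J)) * dragon_poly S (trace_coeffs I S c)"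
        using finK by (intro hall_sum_dragon) auto
      moreover have "hall_sum 0 J (I - S) c = fact (card (I - S)) * marriage_poly (I - S) c"
        using J finJ by (intro hall_sum_marriage) auto
      ultimately show "hall_sum 0 J (I - S) c * hall_sum 1 (K - J) S (trace_coeffs I S c) =
         (fact (card (I - S)) * fact (card K - card (I - S))) *
          (dragon_poly S (trace_coeffs I S c) * marriage_poly (I - S) c)"
        by (simp add: cKJ)
    qed simp
    also have "\<dots> = real (card K choose card (I - S)) * (fact (card (I - S)) * fact (card K - card (I - S))) *
          (dragon_poly S (trace_coeffs I S c) * marriage_poly (I - S) c)"
      using n_subsets[OF finK] by simp
    also have "real (card K choose card (I - S)) * (fact (card (I - S)) * fact (card K - card (I - S))) = fact (card K)"
      using arg_cong[OF binomial_fact_lemma[OF le], of real] by (simp add: mult_ac)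
    finally show "(\<Sum>J\<in>?J S. hall_sum 0 J (I - S) c * hall_sum 1 (K - J) S (trace_coeffs I S c)) =
      fact (card K) * (dragon_poly S (trace_coeffs I S c) * marriage_poly (I - S) c)" .
  qed simp
  also have "\<dots> = fact (card K) * (\<Sum>S\<in>?T. dragon_poly S (trace_coeffs I S c) * marriage_poly (I - S) c)"
    by (rule sum_distrib_left[symmetric])
  finally show ?thesis .
qed

end

lemma hall_fun_upd:
  assumes "finite K" "k \<notin> K" "A \<noteq> {}" "finite A"
  shows "hall 0 (insert k K) (f(k := A)) \<longleftrightarrow> (\<forall>L\<subseteq>K. card L < card (A \<union> \<Union>(f ` L))) \<and> hall 0 K f"
proof -
  have im: "\<Union>(f(k := A) ` L) = \<Union>(f ` L)" "\<Union>(f(k := A) ` insert k L) = A \<union> \<Union>(f ` L)" if "L \<subseteq> K" for L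
    using that assms(2) by (auto split: if_splits)
  have cI: "card (insert k L) = Suc (card L)" if "L \<subseteq> K" for L
    using that assms finite_subset by (metis card_insert_disjoint subsetD)
  show ?thesis
  proof safe
    assume h: "hall 0 (insert k K) (f(k := A))"
    show "card L < card (A \<union> \<Union>(f ` L))" if L: "L \<subseteq> K" for L
    proof -
      have "card (insert k L) + 0 \<le> card (\<Union>(f(k := A) ` insert k L))"
        using h L unfolding hall_def by (metis insert_mono insert_not_empty)
      then show ?thesis unfolding im(2)[OF L] cI[OF L] by simp
    qed
    show "hall 0 K f"
      unfolding hall_def
    proof (intro allI impI)
      fix J assume J: "J \<subseteq> K" "J \<noteq> {}"
      then have "card J + 0 \<le> card (\<Union>(f(k := A) ` J))"
        using h unfolding hall_def by (metis subset_insertI2)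
      then show "card J + 0 \<le> card (\<Union>(f ` J))" unfolding im(1)[OF J(1)] .
    qed
  next
    assume e: "\<forall>L\<subseteq>K. card L < card (A \<union> \<Union>(f ` L))" and h: "hall 0 K f"
    show "hall 0 (insert k K) (f(k := A))"
      unfolding hall_def
    proof (intro allI impI)
      fix J assume J: "J \<subseteq> insert k K" "J \<noteq> {}"
      show "card J + 0 \<le> card (\<Union>(f(k := A) ` J))"
      proof (cases "k \<in> J")
        case True
        define L where "L = J - {k}"
        have L: "L \<subseteq> K" "J = insert k L" using J True unfolding L_def by auto
        show ?thesis unfolding L(2) im(2)[OF L(1)] cI[OF L(1)] using e L(1) by (simp add: Suc_leI)
      next
        case False
        then have "J \<subseteq> K" using J by auto
        then show ?thesis unfolding im(1)[OF \<open>J \<subseteq> K\<close>] using h J unfolding hall_def by auto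
      qed
    qed
  qed
qed

text \<open>
  Singles out the set at position k, which is the set hit by the product rule.
\<close>
lemma families_split_at:
  fixes c c' :: "'a set \<Rightarrow> real"
  assumes K: "finite K" "k \<in> K" and I: "finite I"
  shows "(\<Sum>f | f \<in> families K I \<and> hall 0 K f. c' (f k) * (\<Prod>j\<in>K - {k}. c (f j))) =
    (\<Sum>A\<in>Pow I - {{}}. c' A * (\<Sum>f | f \<in> families (K - {k}) I \<and>
        (\<forall>L\<subseteq>K - {k}. card L < card (A \<union> \<Union>(f ` L))) \<and> hall 0 (K - {k}) f. \<Prod>j\<in>K - {k}. c (f j)))"
proof -
  let ?X = "\<lambda>A. {f. f \<in> families (K - {k}) I \<and>
        (\<forall>L\<subseteq>K - {k}. card L < card (A \<union> \<Union>(f ` L))) \<and> hall 0 (K - {k}) f}"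
  have ins: "insert k (K - {k}) = K" using K by auto
  have hall: "hall 0 K (f(k := A)) \<longleftrightarrow> (\<forall>L\<subseteq>K - {k}. card L < card (A \<union> \<Union>(f ` L))) \<and> hall 0 (K - {k}) f"
    if "A \<in> Pow I - {{}}" for A f
  proof -
    have "finite A" "A \<noteq> {}" using that I finite_subset by auto
    then show ?thesis using hall_fun_upd[of "K - {k}" k A f] K unfolding ins by blast
  qed
  have "(\<Sum>f | f \<in> families K I \<and> hall 0 K f. c' (f k) * (\<Prod>j\<in>K - {k}. c (f j))) =
      (\<Sum>(A, f)\<in>Sigma (Pow I - {{}}) ?X. c' A * (\<Prod>j\<in>K - {k}. c (f j)))"
  proof (rule sum.reindex_bij_witness[where i = "\<lambda>(A, f). f(k := A)" and j = "\<lambda>f. (f k, restrict f (K - {k}))"], goal_cases)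
    case (1 f)
    then show ?case using K by (auto simp: families_def PiE_iff fun_eq_iff extensional_def)
  next
    case (2 f)
    then have fk: "f k \<in> Pow I - {{}}" using K by (auto simp: families_def PiE_iff)
    have f: "f \<in> families K I" using 2 by auto
    have "(restrict f (K - {k}))(k := f k) = f"
      using f K by (auto simp: families_def PiE_iff fun_eq_iff extensional_def)
    then have "hall 0 K ((restrict f (K - {k}))(k := f k))" using 2 by simp
    then have "(\<forall>L\<subseteq>K - {k}. card L < card (f k \<union> \<Union>(restrict f (K - {k}) ` L))) \<and> hall 0 (K - {k}) (restrict f (K - {k}))"
      using hall[OF fk] by blast
    moreover have "restrict f (K - {k}) \<in> families (K - {k}) I"
      using f by (auto simp: families_def PiE_iff)
    ultimately show ?case using fk by blast
  next
    case (3 a)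
    then show ?case using K by (auto simp: families_def PiE_iff fun_eq_iff extensional_def)
  next
    case (4 a)
    obtain A f where a: "a = (A, f)" by (cases a)
    have A: "A \<in> Pow I - {{}}" and f: "f \<in> ?X A" using 4 a by auto
    have "hall 0 K (f(k := A))" using hall[OF A, of f] f by blast
    moreover have "f(k := A) \<in> families K I"
      using f A K by (auto simp: families_def PiE_iff extensional_def)
    ultimately show ?case by (simp add: a)
  next
    case (5 f)
    then show ?case by simp
  qed
  also have "\<dots> = (\<Sum>A\<in>Pow I - {{}}. \<Sum>f\<in>?X A. c' A * (\<Prod>j\<in>K - {k}. c (f j)))"
    by (rule sum.Sigma[symmetric]) (use K I in auto)
  finally show ?thesis by (simp only: sum_distrib_left)
qed

text \<open>
  By the product rule and symmetry, differentiating with respect to \<open>c(A)\<close> leaves the sequences of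
  length \<open>n - 1\<close> that stay Hall when A is added. By \<open>sum_extendable_families\<close> these are counted by
  the sets S that meet A, and summing \<open>c'(A)\<close> over the sets A that meet S gives the rank of S.
\<close>
lemma marriage_poly_derivative:
  assumes I: "finite I" "I \<noteq> {}"
    and c: "\<And>A. A \<subseteq> I \<Longrightarrow> ((\<lambda>s. c s A) has_real_derivative c' A) (at x)"
  shows "((\<lambda>s. marriage_poly I (c s)) has_real_derivative
      (\<Sum>S\<in>Pow I - {{}}. rank_of I c' S * dragon_poly S (trace_coeffs I S (c x)) * marriage_poly (I - S) (c x))) (at x)"
proof -
  let ?K = "{..<card I}"
  let ?F = "{f. f \<in> families ?K I \<and> hall 0 ?K f}"
  let ?DM = "\<lambda>S. dragon_poly S (trace_coeffs I S (c x)) * marriage_poly (I - S) (c x)"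
  have n: "card I > 0" using I by (simp add: card_gt_0_iff)
  have inner: "(\<Sum>f\<in>?F. c' (f k) * (\<Prod>j\<in>?K - {k}. c x (f j))) =
      fact (card I - 1) * (\<Sum>S\<in>Pow I - {{}}. rank_of I c' S * ?DM S)" if k: "k \<in> ?K" for k
  proof -
    have cK: "card (?K - {k}) = card I - 1" using k by simp
    have "(\<Sum>f\<in>?F. c' (f k) * (\<Prod>j\<in>?K - {k}. c x (f j))) =
      (\<Sum>A\<in>Pow I - {{}}. c' A * (\<Sum>f | f \<in> families (?K - {k}) I \<and>
        (\<forall>L\<subseteq>?K - {k}. card L < card (A \<union> \<Union>(f ` L))) \<and> hall 0 (?K - {k}) f. \<Prod>j\<in>?K - {k}. c x (f j)))"
      by (rule families_split_at) (use k I in auto)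
    also have "\<dots> = (\<Sum>A\<in>Pow I - {{}}. c' A * (fact (card I - 1) * (\<Sum>S | S \<subseteq> I \<and> S \<inter> A \<noteq> {}. ?DM S)))"
    proof (rule sum.cong)
      fix A assume A: "A \<in> Pow I - {{}}"
      show "c' A * (\<Sum>f | f \<in> families (?K - {k}) I \<and>
        (\<forall>L\<subseteq>?K - {k}. card L < card (A \<union> \<Union>(f ` L))) \<and> hall 0 (?K - {k}) f. \<Prod>j\<in>?K - {k}. c x (f j)) =
        c' A * (fact (card I - 1) * (\<Sum>S | S \<subseteq> I \<and> S \<inter> A \<noteq> {}. ?DM S))"
        by (subst sum_extendable_families) (use I A n cK in auto)
    qed simp
    also have "\<dots> = fact (card I - 1) * (\<Sum>A\<in>Pow I - {{}}. \<Sum>S\<in>Pow I - {{}}. if S \<inter> A \<noteq> {} then c' A * ?DM S else 0)"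
      unfolding sum_distrib_left
    proof (rule sum.cong)
      fix A assume "A \<in> Pow I - {{}}"
      have "{S. S \<subseteq> I \<and> S \<inter> A \<noteq> {}} = {S \<in> Pow I - {{}}. S \<inter> A \<noteq> {}}" by auto
      then have "(\<Sum>S | S \<subseteq> I \<and> S \<inter> A \<noteq> {}. c' A * (fact (card I - 1) * ?DM S)) =
        (\<Sum>S\<in>{S \<in> Pow I - {{}}. S \<inter> A \<noteq> {}}. c' A * (fact (card I - 1) * ?DM S))"
        by (simp only:)
      also have "\<dots> = (\<Sum>S\<in>Pow I - {{}}. if S \<inter> A \<noteq> {} then c' A * (fact (card I - 1) * ?DM S) else 0)"
        by (rule sum.inter_filter) (use I in simp)
      also have "\<dots> = (\<Sum>S\<in>Pow I - {{}}. fact (card I - 1) * (if S \<inter> A \<noteq> {} then c' A * ?DM S else 0))"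
        by (rule sum.cong) auto
      finally show "(\<Sum>S | S \<subseteq> I \<and> S \<inter> A \<noteq> {}. c' A * (fact (card I - 1) * ?DM S)) =
        (\<Sum>S\<in>Pow I - {{}}. fact (card I - 1) * (if S \<inter> A \<noteq> {} then c' A * ?DM S else 0))" .
    qed simp
    also have "\<dots> = fact (card I - 1) * (\<Sum>S\<in>Pow I - {{}}. \<Sum>A\<in>Pow I - {{}}. if S \<inter> A \<noteq> {} then c' A * ?DM S else 0)"
      by (subst sum.swap) simp
    also have "\<dots> = fact (card I - 1) * (\<Sum>S\<in>Pow I - {{}}. rank_of I c' S * ?DM S)"
    proof -
      have "(\<Sum>A\<in>Pow I - {{}}. if S \<inter> A \<noteq> {} then c' A * ?DM S else 0) = rank_of I c' S * ?DM S" for S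
      proof -
        have "{A. A \<subseteq> I \<and> A \<inter> S \<noteq> {}} = {A \<in> Pow I - {{}}. S \<inter> A \<noteq> {}}" by auto
        then have "rank_of I c' S * ?DM S = (\<Sum>A\<in>{A \<in> Pow I - {{}}. S \<inter> A \<noteq> {}}. c' A * ?DM S)"
          unfolding rank_of_def by (simp add: sum_distrib_right)
        also have "\<dots> = (\<Sum>A\<in>Pow I - {{}}. if S \<inter> A \<noteq> {} then c' A * ?DM S else 0)"
          by (rule sum.inter_filter) (use I in simp)
        finally show ?thesis by simp
      qed
      then show ?thesis by simp
    qed
    finally show ?thesis .
  qed
  have "((\<lambda>s. (\<Sum>f\<in>?F. \<Prod>k\<in>?K. c s (f k)) / fact (card I)) has_real_derivative
      (\<Sum>f\<in>?F. \<Sum>k\<in>?K. c' (f k) * (\<Prod>j\<in>?K - {k}. c x (f j))) / fact (card I)) (at x)"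
  proof (intro DERIV_cdivide DERIV_sum has_field_derivative_prod)
    fix f k assume "f \<in> ?F" "k \<in> ?K"
    then have "f k \<subseteq> I" by (auto simp: families_def PiE_iff)
    then show "((\<lambda>s. c s (f k)) has_real_derivative c' (f k)) (at x)" by (rule c)
  qed
  also have "(\<Sum>f\<in>?F. \<Sum>k\<in>?K. c' (f k) * (\<Prod>j\<in>?K - {k}. c x (f j))) =
      (\<Sum>k\<in>?K. fact (card I - 1) * (\<Sum>S\<in>Pow I - {{}}. rank_of I c' S * ?DM S))"
    by (subst sum.swap) (use inner in \<open>intro sum.cong, auto\<close>)
  also have "\<dots> = fact (card I) * (\<Sum>S\<in>Pow I - {{}}. rank_of I c' S * ?DM S)"
    using n by (simp add: fact_reduce)
  finally show ?thesis
    unfolding marriage_poly_def[of I] hall_sum_def by (simp add: mult.assoc)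
qed

section \<open>Polymatroids and the cell decomposition of the orthant\<close>

definition polymatroid :: "'a set \<Rightarrow> ('a set \<Rightarrow> real) \<Rightarrow> bool" where
  "polymatroid I g \<longleftrightarrow> g {} = 0 \<and> (\<forall>U V. U \<subseteq> V \<longrightarrow> V \<subseteq> I \<longrightarrow> g U \<le> g V) \<and>
     (\<forall>U V. U \<subseteq> I \<longrightarrow> V \<subseteq> I \<longrightarrow> g (U \<union> V) + g (U \<inter> V) \<le> g U + g V)"

definition contraction :: "'a set \<Rightarrow> ('a set \<Rightarrow> real) \<Rightarrow> 'a set \<Rightarrow> real" where
  "contraction S g U = g (S \<union> U) - g S"

definition indep_polytope :: "'a set \<Rightarrow> ('a set \<Rightarrow> real) \<Rightarrow> ('a \<Rightarrow> real) set" where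
  "indep_polytope I g = {y \<in> extensional I. (\<forall>i\<in>I. 0 \<le> y i) \<and> (\<forall>U\<subseteq>I. sum y U \<le> g U)}"

text \<open>
  The vectors on S for which S is the only maximizer of \<open>y(U) - g(U)\<close> among the subsets of S, with
  maximum at most t. Strictness makes the cells below disjoint and not merely disjoint up to null
  sets.
\<close>
definition excess_region :: "'a set \<Rightarrow> ('a set \<Rightarrow> real) \<Rightarrow> real \<Rightarrow> ('a \<Rightarrow> real) set" where
  "excess_region S g t = {y \<in> extensional S. (\<forall>U. U \<subset> S \<longrightarrow> sum y U - g U < sum y S - g S) \<and> sum y S \<le> g S + t}"

definition cell :: "'a set \<Rightarrow> ('a set \<Rightarrow> real) \<Rightarrow> 'a set \<Rightarrow> real \<Rightarrow> ('a \<Rightarrow> real) set" where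
  "cell I g S t = {y \<in> extensional I. restrict y S \<in> excess_region S g t \<and>
     restrict y (I - S) \<in> indep_polytope (I - S) (contraction S g)}"

text \<open>
  Lebesgue measure on the functions from I to the reals. Finite products of measures, rather than
  a Euclidean space, allow induction on the set of coordinates and splitting it into S and
  \<open>I - S\<close>.
\<close>
abbreviation leb :: "'a set \<Rightarrow> ('a \<Rightarrow> real) measure" where
  "leb I \<equiv> Pi\<^sub>M I (\<lambda>_. lborel)"

lemma polymatroid_empty: "polymatroid I g \<Longrightarrow> g {} = 0"
  and polymatroid_mono: "polymatroid I g \<Longrightarrow> U \<subseteq> V \<Longrightarrow> V \<subseteq> I \<Longrightarrow> g U \<le> g V"
  and polymatroid_submod: "polymatroid I g \<Longrightarrow> U \<subseteq> I \<Longrightarrow> V \<subseteq> I \<Longrightarrow> g (U \<union> V) + g (U \<inter> V) \<le> g U + g V"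
  unfolding polymatroid_def by blast+

lemma polymatroid_restrict: "polymatroid I g \<Longrightarrow> S \<subseteq> I \<Longrightarrow> polymatroid S g"
  unfolding polymatroid_def by (meson order_trans)

lemma polymatroid_contraction:
  assumes "polymatroid I g" "S \<subseteq> I"
  shows "polymatroid (I - S) (contraction S g)"
  unfolding polymatroid_def contraction_def
proof (intro conjI allI impI)
  fix U V assume "U \<subseteq> V" "V \<subseteq> I - S"
  then show "g (S \<union> U) - g S \<le> g (S \<union> V) - g S"
    using polymatroid_mono[OF assms(1), of "S \<union> U" "S \<union> V"] assms(2) by auto
next
  fix U V assume "U \<subseteq> I - S" "V \<subseteq> I - S"
  then have "g ((S \<union> U) \<union> (S \<union> V)) + g ((S \<union> U) \<inter> (S \<union> V)) \<le> g (S \<union> U) + g (S \<union> V)"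
    by (intro polymatroid_submod[OF assms(1)]) (use assms(2) in auto)
  moreover have "(S \<union> U) \<union> (S \<union> V) = S \<union> (U \<union> V)" "(S \<union> U) \<inter> (S \<union> V) = S \<union> (U \<inter> V)"
    by auto
  ultimately show "g (S \<union> (U \<union> V)) - g S + (g (S \<union> (U \<inter> V)) - g S) \<le> g (S \<union> U) - g S + (g (S \<union> V) - g S)"
    by simp
qed simp

lemma sum_restrict: "U \<subseteq> S \<Longrightarrow> sum (restrict y S) U = sum y U"
  by (intro sum.cong) auto

lemma cell_iff:
  assumes "S \<subseteq> I"
  shows "y \<in> cell I g S t \<longleftrightarrow> y \<in> extensional I \<and>
    (\<forall>U. U \<subset> S \<longrightarrow> sum y U - g U < sum y S - g S) \<and> sum y S \<le> g S + t \<and>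
    (\<forall>i\<in>I - S. 0 \<le> y i) \<and> (\<forall>U\<subseteq>I - S. sum y U \<le> g (S \<union> U) - g S)"
  unfolding cell_def excess_region_def indep_polytope_def contraction_def
  using sum_restrict[of _ S y] sum_restrict[of _ "I - S" y] by (auto simp: psubset_eq)

text \<open>
  Supermodularity compares \<open>y(U) - g(U)\<close> with its value at \<open>U \<inter> S\<close>: passing from S to \<open>U \<union> S\<close> gains
  nothing because the rest of y is independent in the contraction, and \<open>U \<inter> S\<close> is strictly worse
  than S unless it equals S.
\<close>
lemma cell_least_maximizer:
  assumes I: "finite I" and g: "polymatroid I g" and S: "S \<subseteq> I" and y: "y \<in> cell I g S t" and U: "U \<subseteq> I"
  shows "sum y U - g U \<le> sum y S - g S" and "sum y U - g U = sum y S - g S \<Longrightarrow> S \<subseteq> U"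
proof -
  have fin: "finite U" "finite S" using U S I finite_subset by auto
  have "\<forall>U\<subseteq>I - S. sum y U \<le> g (S \<union> U) - g S"
    using y by (simp add: cell_iff[OF S])
  moreover have "U - S \<subseteq> I - S" using U by auto
  ultimately have "sum y (U - S) \<le> g (S \<union> (U - S)) - g S"
    by (simp del: Un_Diff_cancel)
  moreover have "S \<union> (U - S) = U \<union> S" by auto
  moreover have "sum y U = sum y (U - S) + sum y (U \<inter> S)"
    using fin by (metis sum.Int_Diff add.commute)
  moreover have "g (U \<union> S) + g (U \<inter> S) \<le> g U + g S"
    by (rule polymatroid_submod[OF g U S])
  ultimately have 1: "sum y U - g U \<le> sum y (U \<inter> S) - g (U \<inter> S)" by simp
  have 2: "sum y (U \<inter> S) - g (U \<inter> S) < sum y S - g S" if "\<not> S \<subseteq> U"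
  proof -
    have "U \<inter> S \<subset> S" using that by auto
    then show ?thesis using y by (simp add: cell_iff[OF S])
  qed
  show "sum y U - g U \<le> sum y S - g S"
  proof (cases "S \<subseteq> U")
    case True
    then have "U \<inter> S = S" by auto
    then show ?thesis using 1 by simp
  next
    case False
    then show ?thesis using 1 2 by linarith
  qed
  show "sum y U - g U = sum y S - g S \<Longrightarrow> S \<subseteq> U"
    using 1 2 by linarith
qed

lemma cells_disjoint:
  assumes I: "finite I" and g: "polymatroid I g" and "S \<subseteq> I" "S' \<subseteq> I" "y \<in> cell I g S t" "y \<in> cell I g S' t'"
  shows "S = S'"
proof -
  have "sum y S - g S = sum y S' - g S'"
    using cell_least_maximizer(1)[OF I g assms(3,5,4)] cell_least_maximizer(1)[OF I g assms(4,6,3)] by simp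
  then show ?thesis
    using cell_least_maximizer(2)[OF I g assms(3,5,4)] cell_least_maximizer(2)[OF I g assms(4,6,3)] by simp
qed

text \<open>
  S is a maximizer of \<open>y(U) - g(U)\<close> of minimal size. The bound on the height is kept as a premise
  because S is to be used with different values of t.
\<close>
lemma cell_exists:
  assumes I: "finite I" and g: "polymatroid I g" and y: "y \<in> extensional I" "\<And>i. i \<in> I \<Longrightarrow> 0 \<le> y i"
  shows "\<exists>S\<subseteq>I. \<forall>t. sum y S \<le> g S + t \<longrightarrow> y \<in> cell I g S t"
proof -
  let ?\<phi> = "\<lambda>U. sum y U - g U"
  define M where "M = Max (?\<phi> ` Pow I)"
  have finP: "finite (?\<phi> ` Pow I)" using I by simp
  have le: "?\<phi> U \<le> M" if "U \<subseteq> I" for U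
    unfolding M_def using that finP by (intro Max_ge) auto
  have "M \<in> ?\<phi> ` Pow I" unfolding M_def using finP by (intro Max_in) auto
  then obtain S0 where "S0 \<subseteq> I" "?\<phi> S0 = M" by auto
  then obtain S where S: "S \<subseteq> I" "?\<phi> S = M" and min: "\<And>U. U \<subseteq> I \<Longrightarrow> ?\<phi> U = M \<Longrightarrow> card S \<le> card U"
    using ex_has_least_nat[of "\<lambda>S. S \<subseteq> I \<and> ?\<phi> S = M" S0 card] by auto
  have "?\<phi> U < ?\<phi> S" if U: "U \<subset> S" for U
  proof -
    have "card U < card S" using U S I by (meson finite_subset psubset_card_mono)
    then have "?\<phi> U \<noteq> M" using min[of U] U S by auto
    moreover have "?\<phi> U \<le> M" using U S by (intro le) auto
    ultimately show ?thesis using S by simp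
  qed
  moreover have "sum y U \<le> g (S \<union> U) - g S" if U: "U \<subseteq> I - S" for U
  proof -
    have "sum y (S \<union> U) = sum y S + sum y U"
      using U S I by (intro sum.union_disjoint) (auto intro: finite_subset)
    moreover have "?\<phi> (S \<union> U) \<le> ?\<phi> S" using le[of "S \<union> U"] S U by auto
    ultimately show ?thesis by simp
  qed
  ultimately have "y \<in> cell I g S t" if "sum y S \<le> g S + t" for t
    unfolding cell_iff[OF S(1)] using y that by auto
  with S(1) show ?thesis by blast
qed

lemma excess_region_nonneg:
  assumes "finite S" "polymatroid S g" "y \<in> excess_region S g t" "i \<in> S"
  shows "0 \<le> y i"
proof -
  have "sum y (S - {i}) - g (S - {i}) < sum y S - g S"
    using assms unfolding excess_region_def by blast
  moreover have "sum y S = y i + sum y (S - {i})" using assms by (simp add: sum.remove)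
  moreover have "g (S - {i}) \<le> g S" by (rule polymatroid_mono[OF assms(2)]) auto
  ultimately show ?thesis by simp
qed

text \<open>
  Raising g by t on all nonempty sets means that the maximum of \<open>y(U) - g(U)\<close> is at most t. The case
  \<open>S = {}\<close> is the old polytope.
\<close>
lemma indep_polytope_bumped:
  assumes I: "finite I" and g: "polymatroid I g" and t: "0 \<le> t"
    and g': "g' {} = 0" "\<And>U. U \<subseteq> I \<Longrightarrow> U \<noteq> {} \<Longrightarrow> g' U = g U + t"
  shows "indep_polytope I g' = (\<Union>S\<in>Pow I. cell I g S t)"
proof (intro equalityI subsetI)
  fix y assume y: "y \<in> indep_polytope I g'"
  then have "y \<in> extensional I" "\<And>i. i \<in> I \<Longrightarrow> 0 \<le> y i" by (auto simp: indep_polytope_def)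
  from cell_exists[OF I g this]
  obtain S where S: "S \<subseteq> I" "\<forall>t. sum y S \<le> g S + t \<longrightarrow> y \<in> cell I g S t"
    by blast
  have "sum y S \<le> g' S" using y S(1) unfolding indep_polytope_def by blast
  also have "g' S \<le> g S + t" using g' S(1) t polymatroid_empty[OF g] by (cases "S = {}") auto
  finally show "y \<in> (\<Union>S\<in>Pow I. cell I g S t)" using S by auto
next
  fix y assume "y \<in> (\<Union>S\<in>Pow I. cell I g S t)"
  then obtain S where S: "S \<subseteq> I" and y: "y \<in> cell I g S t" by auto
  have finS: "finite S" using S I finite_subset by auto
  have "0 \<le> y i" if i: "i \<in> I" for i
  proof (cases "i \<in> S")
    case True
    have "0 \<le> restrict y S i"
      using excess_region_nonneg[OF finS polymatroid_restrict[OF g S]] y True unfolding cell_def by blast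
    then show ?thesis using True by simp
  next
    case False
    then show ?thesis using y i unfolding cell_iff[OF S] by auto
  qed
  moreover have "sum y U \<le> g' U" if U: "U \<subseteq> I" for U
  proof (cases "U = {}")
    case False
    have "sum y U - g U \<le> sum y S - g S" by (rule cell_least_maximizer(1)[OF I g S y U])
    also have "\<dots> \<le> t" using y unfolding cell_iff[OF S] by auto
    finally show ?thesis using g'(2)[OF U False] by simp
  qed (use g' in simp)
  moreover have "y \<in> extensional I" using y by (simp add: cell_def)
  ultimately show "y \<in> indep_polytope I g'" unfolding indep_polytope_def by blast
qed

lemma indep_polytope_subset_cells:
  assumes I: "finite I" and g: "polymatroid I g"
  shows "indep_polytope I g' \<subseteq> (\<Union>S\<in>Pow I. cell I g S (g' S - g S))"
proof (rule subsetI)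
  fix y assume y: "y \<in> indep_polytope I g'"
  then have "y \<in> extensional I" "\<And>i. i \<in> I \<Longrightarrow> 0 \<le> y i" by (auto simp: indep_polytope_def)
  from cell_exists[OF I g this]
  obtain S where S: "S \<subseteq> I" "\<forall>t. sum y S \<le> g S + t \<longrightarrow> y \<in> cell I g S t"
    by blast
  have "sum y S \<le> g' S" using y S(1) unfolding indep_polytope_def by blast
  then have "sum y S \<le> g S + (g' S - g S)" by simp
  then have "y \<in> cell I g S (g' S - g S)" using S(2) by blast
  then show "y \<in> (\<Union>S\<in>Pow I. cell I g S (g' S - g S))" using S(1) by blast
qed

section \<open>Volumes of the cells\<close>

lemma borel_measurable_sum_coords [measurable]:
  assumes "U \<subseteq> I" shows "(\<lambda>y. sum y U) \<in> borel_measurable (leb I)"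
proof -
  have "(\<lambda>y. y i) \<in> borel_measurable (leb I)" if "i \<in> U" for i
    using measurable_component_singleton[of i I "\<lambda>_. lborel"] that assms by auto
  then show ?thesis by (rule borel_measurable_sum)
qed

lemma sets_indep_polytope [measurable]:
  assumes "finite I" shows "indep_polytope I g \<in> sets (leb I)"
proof -
  have 1: "(\<lambda>y. y i) \<in> borel_measurable (leb I)" if "i \<in> I" for i
    using measurable_component_singleton[of i I "\<lambda>_. lborel"] that by auto
  have "indep_polytope I g = {y \<in> space (leb I). (\<forall>i\<in>I. 0 \<le> y i) \<and> (\<forall>U\<in>Pow I. sum y U \<le> g U)}"
    by (auto simp: indep_polytope_def space_PiM PiE_def)
  also have "\<dots> \<in> sets (leb I)"
    using assms 1 borel_measurable_sum_coords[of _ I]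
    by (intro sets.sets_Collect_conj sets.sets_Collect_finite_All borel_measurable_le) auto
  finally show ?thesis .
qed

lemma sets_excess_region [measurable]:
  assumes "finite S" shows "excess_region S g t \<in> sets (leb S)"
proof -
  have "excess_region S g t = {y \<in> space (leb S). (\<forall>U\<in>Pow S - {S}. sum y U - g U < sum y S - g S) \<and> sum y S \<le> g S + t}"
    by (auto simp: excess_region_def space_PiM PiE_def)
  also have "\<dots> \<in> sets (leb S)"
    using assms borel_measurable_sum_coords[of _ S]
    by (intro sets.sets_Collect_conj sets.sets_Collect_finite_All borel_measurable_le borel_measurable_less
       borel_measurable_diff) auto
  finally show ?thesis .
qed

lemma emeasure_bounded_finite:
  assumes "finite I" "X \<in> sets (leb I)" "X \<subseteq> (\<Pi>\<^sub>E i\<in>I. {0..M})"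
  shows "emeasure (leb I) X < \<infinity>"
proof -
  interpret product_sigma_finite "\<lambda>_. lborel :: real measure" by standard
  have "emeasure (leb I) X \<le> emeasure (leb I) (\<Pi>\<^sub>E i\<in>I. {0..M})"
    by (rule emeasure_mono) (use assms in \<open>auto intro!: sets_PiM_I_finite\<close>)
  also have "\<dots> = (\<Prod>i\<in>I. emeasure lborel {0..M})"
    by (rule emeasure_PiM) (use assms in auto)
  also have "\<dots> < \<infinity>"
    by (simp add: ennreal_prod_eq_top less_top[symmetric] emeasure_lborel_Icc_eq power_eq_top_ennreal)
  finally show ?thesis .
qed

lemma indep_polytope_bounded:
  assumes "finite I"
  shows "indep_polytope I g \<subseteq> (\<Pi>\<^sub>E i\<in>I. {0..Max (g ` Pow I)})"
proof -
  have "y i \<le> Max (g ` Pow I)" if "y \<in> indep_polytope I g" "i \<in> I" for y i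
  proof -
    have "sum y {i} \<le> g {i}" using that unfolding indep_polytope_def by blast
    also have "\<dots> \<le> Max (g ` Pow I)" using assms that by (intro Max_ge) auto
    finally show ?thesis by simp
  qed
  moreover have "y \<in> extensional I" "\<forall>i\<in>I. 0 \<le> y i" if "y \<in> indep_polytope I g" for y
    using that unfolding indep_polytope_def by blast+
  ultimately show ?thesis by (simp add: PiE_iff subset_iff)
qed

lemma excess_region_bounded:
  assumes "finite S" "polymatroid S g"
  shows "excess_region S g t \<subseteq> (\<Pi>\<^sub>E i\<in>S. {0..g S + t})"
proof -
  have "y i \<le> g S + t" if y: "y \<in> excess_region S g t" and i: "i \<in> S" for y i
  proof -
    have "y i \<le> sum y S" using excess_region_nonneg[OF assms y] i assms by (intro member_le_sum) auto
    also have "\<dots> \<le> g S + t" using y unfolding excess_region_def by blast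
    finally show ?thesis .
  qed
  moreover have "y \<in> extensional S" if "y \<in> excess_region S g t" for y
    using that unfolding excess_region_def by blast
  ultimately show ?thesis using excess_region_nonneg[OF assms] by (simp add: PiE_iff subset_iff)
qed

lemma measure_leb_product:
  assumes I: "finite I" and S: "S \<subseteq> I" and A: "A \<in> sets (leb S)" and B: "B \<in> sets (leb (I - S))"
  defines "X \<equiv> {y \<in> extensional I. restrict y S \<in> A \<and> restrict y (I - S) \<in> B}"
  shows "X \<in> sets (leb I)" "emeasure (leb I) X = emeasure (leb S) A * emeasure (leb (I - S)) B"
proof -
  interpret product_sigma_finite "\<lambda>_. lborel :: real measure" by standard
  have fin: "finite S" "finite (I - S)" using I S finite_subset by auto
  interpret T: finite_product_sigma_finite "\<lambda>_. lborel :: real measure" "I - S" by standard fact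
  have SI: "S \<union> (I - S) = I" using S by auto
  have Xeq: "X = ((\<lambda>y. restrict y S) -` A \<inter> space (leb I)) \<inter> ((\<lambda>y. restrict y (I - S)) -` B \<inter> space (leb I))"
    by (auto simp: X_def space_PiM PiE_def)
  have "(\<lambda>y. restrict y S) -` A \<inter> space (leb I) \<in> sets (leb I)"
    by (rule measurable_sets[OF measurable_restrict_subset[OF S] A])
  moreover have "(\<lambda>y. restrict y (I - S)) -` B \<inter> space (leb I) \<in> sets (leb I)"
    by (rule measurable_sets[OF measurable_restrict_subset B]) auto
  ultimately show X: "X \<in> sets (leb I)"
    unfolding Xeq by (rule sets.Int)
  have AB: "x \<in> extensional S" if "x \<in> A" for x using sets.sets_into_space[OF A] that by (auto simp: space_PiM PiE_def)
  have BB: "x \<in> extensional (I - S)" if "x \<in> B" for x using sets.sets_into_space[OF B] that by (auto simp: space_PiM PiE_def)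
  have vim: "merge S (I - S) -` X \<inter> space (leb S \<Otimes>\<^sub>M leb (I - S)) = A \<times> B"
  proof -
    have "merge S (I - S) (x, z) \<in> extensional I" for x z
      using S by (auto simp: merge_def extensional_def)
    then show ?thesis
      using AB BB
      by (auto simp: X_def space_pair_measure space_PiM PiE_def extensional_restrict)
  qed
  have "emeasure (leb I) X = emeasure (distr (leb S \<Otimes>\<^sub>M leb (I - S)) (leb I) (merge S (I - S))) X"
    using distr_merge[of S "I - S"] fin unfolding SI by simp
  also have "\<dots> = emeasure (leb S \<Otimes>\<^sub>M leb (I - S)) (A \<times> B)"
    using measurable_merge[of S "I - S" "\<lambda>_. lborel"] X unfolding SI vim[symmetric]
    by (rule emeasure_distr)
  also have "\<dots> = emeasure (leb S) A * emeasure (leb (I - S)) B"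
    by (rule T.emeasure_pair_measure_Times[OF A B])
  finally show "emeasure (leb I) X = emeasure (leb S) A * emeasure (leb (I - S)) B" .
qed

lemma measure_cell:
  assumes I: "finite I" and g: "polymatroid I g" and S: "S \<subseteq> I"
  shows "cell I g S t \<in> sets (leb I)" "emeasure (leb I) (cell I g S t) < \<infinity>"
    "measure (leb I) (cell I g S t) =
      measure (leb S) (excess_region S g t) * measure (leb (I - S)) (indep_polytope (I - S) (contraction S g))"
proof -
  have fin: "finite S" "finite (I - S)" using I S finite_subset by auto
  note * = measure_leb_product[OF I S sets_excess_region[OF fin(1), of g t] sets_indep_polytope[OF fin(2), of "contraction S g"], folded cell_def]
  show "cell I g S t \<in> sets (leb I)" by (rule *(1))
  show "emeasure (leb I) (cell I g S t) < \<infinity>"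
    unfolding *(2)
    using emeasure_bounded_finite[OF fin(1) sets_excess_region[OF fin(1)] excess_region_bounded[OF fin(1) polymatroid_restrict[OF g S]]]
     emeasure_bounded_finite[OF fin(2) sets_indep_polytope[OF fin(2)] indep_polytope_bounded[OF fin(2)]]
    by (simp add: ennreal_mult_less_top)
  show "measure (leb I) (cell I g S t) =
      measure (leb S) (excess_region S g t) * measure (leb (I - S)) (indep_polytope (I - S) (contraction S g))"
    using *(2) by (simp add: measure_def enn2real_mult)
qed

text \<open>
  The exact volume recursion. It determines the volume of the excess region of I from smaller ones
  once the volumes of all independence polytopes on subsets of I are known.
\<close>
lemma volume_bumped:
  assumes I: "finite I" and g: "polymatroid I g" and t: "0 \<le> t"
    and g': "g' {} = 0" "\<And>U. U \<subseteq> I \<Longrightarrow> U \<noteq> {} \<Longrightarrow> g' U = g U + t"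
  shows "measure (leb I) (indep_polytope I g') =
    (\<Sum>S\<in>Pow I. measure (leb S) (excess_region S g t) * measure (leb (I - S)) (indep_polytope (I - S) (contraction S g)))"
proof -
  have "measure (leb I) (\<Union>S\<in>Pow I. cell I g S t) = (\<Sum>S\<in>Pow I. measure (leb I) (cell I g S t))"
  proof (rule measure_finite_Union)
    show "disjoint_family_on (\<lambda>S. cell I g S t) (Pow I)"
      using cells_disjoint[OF I g] unfolding disjoint_family_on_def by blast
  qed (use I measure_cell[OF I g] in \<open>auto simp: less_top\<close>)
  moreover have "indep_polytope I g' = (\<Union>S\<in>Pow I. cell I g S t)"
    using indep_polytope_bumped[of I g t g'] assms by blast
  ultimately show ?thesis by (simp add: measure_cell(3)[OF I g])
qed

text \<open>
  For a general \<open>g'\<close> the cells overshoot the polytope, so only an inequality survives. It suffices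
  because it is applied both to a segment that ends at the polymatroid of interest and to one that
  starts there.
\<close>
lemma volume_upper_bound:
  assumes I: "finite I" and g: "polymatroid I g"
  shows "measure (leb I) (indep_polytope I g') \<le>
    (\<Sum>S\<in>Pow I. measure (leb S) (excess_region S g (g' S - g S)) * measure (leb (I - S)) (indep_polytope (I - S) (contraction S g)))"
proof -
  let ?C = "\<lambda>S. cell I g S (g' S - g S)"
  have fm: "?C S \<in> fmeasurable (leb I)" if "S \<in> Pow I" for S
    using that measure_cell[OF I g] by (intro fmeasurableI) auto
  have "measure (leb I) (indep_polytope I g') \<le> measure (leb I) (\<Union>S\<in>Pow I. ?C S)"
    using fm I by (intro measure_mono_fmeasurable indep_polytope_subset_cells[OF I g] sets_indep_polytope fmeasurable.finite_UN) auto
  also have "\<dots> \<le> (\<Sum>S\<in>Pow I. measure (leb I) (?C S))"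
    using fm I by (intro measure_UNION_le) (auto intro: fmeasurableD)
  also have "\<dots> = (\<Sum>S\<in>Pow I. measure (leb S) (excess_region S g (g' S - g S)) * measure (leb (I - S)) (indep_polytope (I - S) (contraction S g)))"
    by (simp add: measure_cell(3)[OF I g])
  finally show ?thesis .
qed

section \<open>Growth of the excess regions\<close>

lemma indep_polytope_cong: "(\<And>U. U \<subseteq> I \<Longrightarrow> g U = h U) \<Longrightarrow> indep_polytope I g = indep_polytope I h"
  unfolding indep_polytope_def by auto

lemma excess_region_cong: "(\<And>U. U \<subseteq> S \<Longrightarrow> g U = h U) \<Longrightarrow> excess_region S g t = excess_region S h t"
  unfolding excess_region_def by (auto simp: psubset_eq)

lemma polymatroid_cong: "(\<And>U. U \<subseteq> I \<Longrightarrow> g U = h U) \<Longrightarrow> polymatroid I g = polymatroid I h"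
  unfolding polymatroid_def by (simp add: subset_trans[of _ _ I] le_infI1 cong: conj_cong imp_cong)

lemma hall_sum_cong:
  assumes "\<And>A. A \<subseteq> I \<Longrightarrow> A \<noteq> {} \<Longrightarrow> c A = c' A"
  shows "hall_sum e K I c = hall_sum e K I c'"
  unfolding hall_sum_def
proof (intro sum.cong prod.cong refl)
  fix f k assume "f \<in> {f. f \<in> families K I \<and> hall e K f}" "k \<in> K"
  then have "f k \<subseteq> I" "f k \<noteq> {}" by (auto simp: families_def PiE_iff)
  then show "c (f k) = c' (f k)" by (rule assms)
qed

lemma marriage_poly_cong:
  assumes "\<And>A. A \<subseteq> I \<Longrightarrow> A \<noteq> {} \<Longrightarrow> c A = c' A"
  shows "marriage_poly I c = marriage_poly I c'"
  unfolding marriage_poly_def using hall_sum_cong[of I c c'] assms by metis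

lemma dragon_poly_cong:
  assumes "\<And>A. A \<subseteq> I \<Longrightarrow> A \<noteq> {} \<Longrightarrow> c A = c' A"
  shows "dragon_poly I c = dragon_poly I c'"
  unfolding dragon_poly_def using hall_sum_cong[of I c c'] assms by metis

lemma marriage_poly_empty [simp]: "marriage_poly {} c = 1"
proof -
  have "{f :: nat \<Rightarrow> 'a set. f \<in> families {} {} \<and> hall 0 {} f} = {\<lambda>_. undefined}"
    by (auto simp: families_def hall_def)
  then show ?thesis by (simp add: marriage_poly_def hall_sum_def)
qed

lemma continuous_on_hall_sum:
  assumes "\<And>A. A \<subseteq> I \<Longrightarrow> continuous_on X (\<lambda>x. c x A)"
  shows "continuous_on X (\<lambda>x. hall_sum e K I (c x))"
  unfolding hall_sum_def
proof (intro continuous_on_sum continuous_on_prod)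
  fix f k assume "f \<in> {f. f \<in> families K I \<and> hall e K f}" "k \<in> K"
  then have "f k \<subseteq> I" by (auto simp: families_def PiE_iff)
  then show "continuous_on X (\<lambda>x. c x (f k))" by (rule assms)
qed

lemma rank_of_empty [simp]: "rank_of I c {} = 0"
  by (simp add: rank_of_def)

lemma rank_of_trace:
  assumes "finite I" "S \<subseteq> I" "U \<subseteq> S"
  shows "rank_of S (trace_coeffs I S c) U = rank_of I c U"
proof -
  let ?T = "{C. C \<subseteq> S \<and> C \<inter> U \<noteq> {}}" and ?B = "{B. B \<subseteq> I \<and> B \<inter> U \<noteq> {}}"
  have fin: "finite ?T" "finite ?B" using assms finite_subset[of S I] by auto
  have "rank_of I c U = (\<Sum>C\<in>?T. sum c {B \<in> ?B. B \<inter> S = C})"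
    unfolding rank_of_def by (rule sum.group[symmetric]) (use fin assms in auto)
  also have "\<dots> = (\<Sum>C\<in>?T. trace_coeffs I S c C)"
    unfolding trace_coeffs_def by (intro sum.cong arg_cong[of _ _ "sum c"]) (use assms in auto)
  finally show ?thesis by (simp add: rank_of_def)
qed

lemma contraction_rank_of:
  assumes "finite I" "S \<subseteq> I" "U \<subseteq> I - S"
  shows "contraction S (rank_of I c) U = rank_of (I - S) c U"
proof -
  let ?X = "{A. A \<subseteq> I \<and> A \<inter> S \<noteq> {}}" and ?Y = "{A. A \<subseteq> I - S \<and> A \<inter> U \<noteq> {}}"
  have "{A. A \<subseteq> I \<and> A \<inter> (S \<union> U) \<noteq> {}} = ?X \<union> ?Y" using assms by auto
  moreover have "sum c (?X \<union> ?Y) = sum c ?X + sum c ?Y"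
    using assms by (intro sum.union_disjoint) auto
  ultimately show ?thesis by (simp add: contraction_def rank_of_def)
qed

lemma sum_fun_upd:
  fixes c :: "'b \<Rightarrow> real"
  assumes "finite X" "a \<in> X"
  shows "sum (c(a := c a + t)) X = sum c X + t"
proof -
  have "sum (c(a := c a + t)) (X - {a}) = sum c (X - {a})" by (intro sum.cong) auto
  then show ?thesis using assms by (simp add: sum.remove[of X a] del: fun_upd_apply) simp
qed

lemma rank_of_fun_upd:
  assumes "finite I" "U \<subseteq> I" "U \<noteq> {}"
  shows "rank_of I (c(I := c I + t)) U = rank_of I c U + t"
proof -
  let ?X = "{A. A \<subseteq> I \<and> A \<inter> U \<noteq> {}}"
  have "finite ?X" "I \<in> ?X" using assms by auto
  then show ?thesis
    unfolding rank_of_def by (rule sum_fun_upd)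
qed

lemma trace_coeffs_fun_upd:
  assumes "finite S" "U \<subseteq> S"
  shows "trace_coeffs S U (c(S := c S + t)) = (trace_coeffs S U c)(U := trace_coeffs S U c U + t)"
proof
  fix C
  let ?X = "{B. B \<subseteq> S \<and> B \<inter> U = C}"
  show "trace_coeffs S U (c(S := c S + t)) C = ((trace_coeffs S U c)(U := trace_coeffs S U c U + t)) C"
  proof (cases "C = U")
    case True
    then have "finite ?X" "S \<in> ?X" using assms by auto
    then show ?thesis using True sum_fun_upd[of ?X S c t] unfolding trace_coeffs_def by simp
  next
    case False
    then have "S \<notin> ?X" using assms by auto
    then have "sum (c(S := c S + t)) ?X = sum c ?X" by (intro sum.cong) auto
    then show ?thesis using False unfolding trace_coeffs_def by simp
  qed
qed

lemma trace_coeffs_self: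
  assumes "C \<subseteq> S" shows "trace_coeffs S S c C = c C"
proof -
  have "{B. B \<subseteq> S \<and> B \<inter> S = C} = {C}" using assms by auto
  then show ?thesis by (simp add: trace_coeffs_def)
qed

lemma polymatroid_bumped:
  assumes g: "polymatroid I g" and t: "0 \<le> t"
    and g': "g' {} = 0" "\<And>U. U \<subseteq> I \<Longrightarrow> U \<noteq> {} \<Longrightarrow> g' U = g U + t"
  shows "polymatroid I g'"
  unfolding polymatroid_def
proof (intro conjI allI impI)
  have nonneg: "0 \<le> g U" if "U \<subseteq> I" for U
    using polymatroid_mono[OF g, of "{}" U] polymatroid_empty[OF g] that by simp
  fix U V assume UV: "U \<subseteq> V" "V \<subseteq> I"
  show "g' U \<le> g' V"
  proof (cases "U = {}")
    case True
    then show ?thesis using g'(1) g'(2)[of V] nonneg[of V] t UV by (cases "V = {}") auto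
  next
    case False
    then have "g' U = g U + t" "g' V = g V + t" using g'(2)[of U] g'(2)[of V] UV by auto
    then show ?thesis using polymatroid_mono[OF g UV] by simp
  qed
next
  fix U V assume UV: "U \<subseteq> I" "V \<subseteq> I"
  show "g' (U \<union> V) + g' (U \<inter> V) \<le> g' U + g' V"
  proof (cases "U = {} \<or> V = {}")
    case False
    have "U \<inter> V \<subseteq> I" using UV by auto
    then have "g' (U \<inter> V) \<le> g (U \<inter> V) + t"
      using g'(1) g'(2)[of "U \<inter> V"] t polymatroid_empty[OF g] by (cases "U \<inter> V = {}") simp_all
    moreover have "g' (U \<union> V) = g (U \<union> V) + t" "g' U = g U + t" "g' V = g V + t"
      using g'(2)[of "U \<union> V"] g'(2)[of U] g'(2)[of V] False UV by auto
    ultimately show ?thesis using polymatroid_submod[OF g UV] by simp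
  qed auto
qed (rule g'(1))

lemma measure_excess_region_empty:
  assumes "g {} = 0" "0 \<le> t" shows "measure (leb {}) (excess_region {} g t) = 1"
proof -
  have "excess_region {} g t = {\<lambda>_. undefined}" using assms by (auto simp: excess_region_def)
  then show ?thesis by (simp add: PiM_empty)
qed

lemma excess_region_zero:
  assumes "g {} = 0" "S \<noteq> {}" shows "excess_region S g 0 = {}"
proof -
  have False if "y \<in> excess_region S g 0" for y
  proof -
    have "sum y {} - g {} < sum y S - g S" using that assms(2) unfolding excess_region_def by blast
    then show False using that assms unfolding excess_region_def by simp
  qed
  then show ?thesis by blast
qed

text \<open>
  The induction hypothesis of the main induction, quantified over all coefficients at once.
\<close>
definition volume_formula :: "'a set \<Rightarrow> bool" where
  "volume_formula I \<longleftrightarrow> (\<forall>c. polymatroid I (rank_of I c) \<longrightarrow>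
     measure (leb I) (indep_polytope I (rank_of I c)) = marriage_poly I c)"

lemma polymatroid_trace:
  assumes "finite I" "S \<subseteq> I" "polymatroid I (rank_of I c)"
  shows "polymatroid S (rank_of S (trace_coeffs I S c))"
  using polymatroid_restrict[OF assms(3,2)] polymatroid_cong[of S "rank_of S (trace_coeffs I S c)" "rank_of I c"]
    rank_of_trace[OF assms(1,2)] by blast

lemma volume_contraction:
  assumes "finite I" "S \<subseteq> I" "polymatroid I (rank_of I c)" "volume_formula (I - S)"
  shows "measure (leb (I - S)) (indep_polytope (I - S) (contraction S (rank_of I c))) = marriage_poly (I - S) c"
proof -
  have "polymatroid (I - S) (rank_of (I - S) c)"
    using polymatroid_contraction[OF assms(3,2)] contraction_rank_of[OF assms(1,2)]
      polymatroid_cong[of "I - S" "contraction S (rank_of I c)" "rank_of (I - S) c"] by blast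
  moreover have "indep_polytope (I - S) (contraction S (rank_of I c)) = indep_polytope (I - S) (rank_of (I - S) c)"
    by (rule indep_polytope_cong) (rule contraction_rank_of[OF assms(1,2)])
  ultimately show ?thesis using assms(4) unfolding volume_formula_def by simp
qed

text \<open>
  The bumped polytopes on S have the volume given by the polynomial. Differentiating
  \<open>volume_bumped\<close> in t and comparing with \<open>marriage_poly_derivative\<close>, the summands of the proper
  nonempty subsets of S agree by induction, so those of S itself agree as well.
\<close>
lemma excess_volume_derivative:
  assumes "finite S" "S \<noteq> {}" "\<And>T. T \<subseteq> S \<Longrightarrow> volume_formula T" "polymatroid S (rank_of S c)" "0 \<le> t"
  shows "((\<lambda>t. measure (leb S) (excess_region S (rank_of S c) t)) has_real_derivative
     dragon_poly S (c(S := c S + t))) (at t within {0..})"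
  using assms
proof (induction "card S" arbitrary: S c t rule: less_induct)
  case less
  note S = \<open>finite S\<close> \<open>S \<noteq> {}\<close> and vf = less.prems(3) and pm = less.prems(4)
  let ?g = "rank_of S c"
  let ?q = "\<lambda>U t. measure (leb U) (excess_region U ?g t)"
  let ?c = "\<lambda>t. c(S := c S + t)"
  let ?P = "Pow S - {{}, S}"
  have finP: "finite ?P" using S by simp
  have expand: "(\<Sum>U\<in>Pow S. f U) = f {} + f S + (\<Sum>U\<in>?P. f U)" for f :: "_ \<Rightarrow> real"
  proof -
    have "(\<Sum>U\<in>Pow S. f U) = f {} + (\<Sum>U\<in>Pow S - {{}}. f U)"
      using S by (subst sum.remove[of _ "{}"]) auto
    also have "(\<Sum>U\<in>Pow S - {{}}. f U) = f S + (\<Sum>U\<in>Pow S - {{}} - {S}. f U)"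
      using S by (subst sum.remove[of _ S]) auto
    also have "Pow S - {{}} - {S} = ?P" by auto
    finally show ?thesis by simp
  qed
  have q_eq: "?q S t = marriage_poly S (?c t) - marriage_poly S c - (\<Sum>U\<in>?P. ?q U t * marriage_poly (S - U) c)"
    if t: "0 \<le> t" for t
  proof -
    have bump: "rank_of S (?c t) U = ?g U + t" if "U \<subseteq> S" "U \<noteq> {}" for U
      by (rule rank_of_fun_upd[OF S(1) that])
    have "polymatroid S (rank_of S (?c t))"
      by (rule polymatroid_bumped[OF pm t _ bump]) auto
    then have "marriage_poly S (?c t) = measure (leb S) (indep_polytope S (rank_of S (?c t)))"
      using vf[of S] unfolding volume_formula_def by simp
    also have "\<dots> = (\<Sum>U\<in>Pow S. ?q U t * measure (leb (S - U)) (indep_polytope (S - U) (contraction U ?g)))"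
      by (rule volume_bumped[OF S(1) pm t _ bump]) auto
    also have "\<dots> = (\<Sum>U\<in>Pow S. ?q U t * marriage_poly (S - U) c)"
      using volume_contraction[OF S(1) _ pm] vf by (intro sum.cong) auto
    also have "\<dots> = marriage_poly S c + ?q S t + (\<Sum>U\<in>?P. ?q U t * marriage_poly (S - U) c)"
      by (simp add: expand measure_excess_region_empty[OF _ t])
    finally show ?thesis by simp
  qed
  have t: "0 \<le> t" by fact
  let ?D = "\<lambda>U. dragon_poly U ((trace_coeffs S U c)(U := trace_coeffs S U c U + t))"
  have dq: "((?q U) has_real_derivative ?D U) (at t within {0..})" if U: "U \<in> ?P" for U
  proof -
    have "U \<subset> S" using U by auto
    then have "card U < card S" using S by (simp add: psubset_card_mono)
    moreover have "finite U" "U \<noteq> {}" "U \<subseteq> S" using U S finite_subset by auto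
    moreover have "polymatroid U (rank_of U (trace_coeffs S U c))"
      using S(1) \<open>U \<subseteq> S\<close> pm by (rule polymatroid_trace)
    ultimately have "((\<lambda>t. measure (leb U) (excess_region U (rank_of U (trace_coeffs S U c)) t)) has_real_derivative ?D U) (at t within {0..})"
      using less.hyps[of U "trace_coeffs S U c" t] vf t by auto
    moreover have "excess_region U (rank_of U (trace_coeffs S U c)) t = excess_region U ?g t" for t
      by (rule excess_region_cong) (rule rank_of_trace[OF S(1) \<open>U \<subseteq> S\<close>])
    ultimately show ?thesis by simp
  qed
  have rank1: "rank_of S (\<lambda>A. if A = S then 1 else 0) U = 1" if "U \<in> Pow S - {{}}" for U
  proof -
    have "finite {A. A \<subseteq> S \<and> A \<inter> U \<noteq> {}}" "S \<in> {A. A \<subseteq> S \<and> A \<inter> U \<noteq> {}}" using that S by auto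
    then show ?thesis unfolding rank_of_def by (simp only: sum.delta if_True)
  qed
  have "((\<lambda>t. marriage_poly S (?c t)) has_real_derivative
      (\<Sum>U\<in>Pow S - {{}}. rank_of S (\<lambda>A. if A = S then 1 else 0) U * dragon_poly U (trace_coeffs S U (?c t)) * marriage_poly (S - U) (?c t))) (at t)"
    by (rule marriage_poly_derivative[OF S]) (auto intro!: derivative_eq_intros)
  also have "(\<Sum>U\<in>Pow S - {{}}. rank_of S (\<lambda>A. if A = S then 1 else 0) U * dragon_poly U (trace_coeffs S U (?c t)) * marriage_poly (S - U) (?c t)) =
     (\<Sum>U\<in>Pow S - {{}}. ?D U * marriage_poly (S - U) c)"
  proof (rule sum.cong)
    fix U assume U: "U \<in> Pow S - {{}}"
    have "marriage_poly (S - U) (?c t) = marriage_poly (S - U) c"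
      using U by (intro marriage_poly_cong) auto
    then show "rank_of S (\<lambda>A. if A = S then 1 else 0) U * dragon_poly U (trace_coeffs S U (?c t)) * marriage_poly (S - U) (?c t) = ?D U * marriage_poly (S - U) c"
      using rank1[OF U] trace_coeffs_fun_upd[of S U c t] S U by simp
  qed simp
  also have "\<dots> = ?D S * marriage_poly (S - S) c + (\<Sum>U\<in>?P. ?D U * marriage_poly (S - U) c)"
  proof -
    have "Pow S - {{}} - {S} = ?P" by auto
    then show ?thesis using S by (subst sum.remove[of _ S]) auto
  qed
  also have "?D S = dragon_poly S (?c t)"
    by (rule dragon_poly_cong) (auto simp: trace_coeffs_self)
  finally have "((\<lambda>t. marriage_poly S (?c t)) has_real_derivative
     dragon_poly S (?c t) + (\<Sum>U\<in>?P. ?D U * marriage_poly (S - U) c)) (at t)"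
    unfolding Diff_cancel marriage_poly_empty mult_1_right .
  then have dM: "((\<lambda>t. marriage_poly S (?c t)) has_real_derivative
     dragon_poly S (?c t) + (\<Sum>U\<in>?P. ?D U * marriage_poly (S - U) c)) (at t within {0..})"
    by (rule has_field_derivative_at_within)
  have "((\<lambda>t. marriage_poly S (?c t) - marriage_poly S c - (\<Sum>U\<in>?P. ?q U t * marriage_poly (S - U) c)) has_real_derivative
     (dragon_poly S (?c t) + (\<Sum>U\<in>?P. ?D U * marriage_poly (S - U) c)) - 0 - (\<Sum>U\<in>?P. ?D U * marriage_poly (S - U) c)) (at t within {0..})"
    by (intro DERIV_diff dM DERIV_const DERIV_sum DERIV_cmult_right dq)
  then have "((\<lambda>t. marriage_poly S (?c t) - marriage_poly S c - (\<Sum>U\<in>?P. ?q U t * marriage_poly (S - U) c)) has_real_derivative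
     dragon_poly S (?c t)) (at t within {0..})" by simp
  then show ?case
    by (rule has_field_derivative_transform_within[of _ _ _ _ 1]) (use t q_eq in auto)
qed

section \<open>The two extreme polymatroids: boxes and simplices\<close>

text \<open>
  The greedy vertex: every new element receives its marginal rank.
\<close>
lemma polymatroid_base:
  assumes "finite I" "polymatroid I g"
  shows "\<exists>p. (\<forall>i\<in>I. 0 \<le> p i) \<and> (\<forall>U\<subseteq>I. sum p U \<le> g U) \<and> sum p I = g I"
  using assms
proof (induction I rule: finite_induct)
  case empty
  then show ?case using polymatroid_empty by force
next
  case (insert x F)
  have "polymatroid F g" using polymatroid_restrict[OF insert.prems] by blast
  then obtain p where p: "\<forall>i\<in>F. 0 \<le> p i" "\<forall>U\<subseteq>F. sum p U \<le> g U" "sum p F = g F"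
    using insert.IH by blast
  let ?q = "p(x := g (insert x F) - g F)"
  have qF: "sum ?q U = sum p U" if "U \<subseteq> F" for U
    using that insert.hyps by (intro sum.cong) auto
  have "sum ?q U \<le> g U" if U: "U \<subseteq> insert x F" for U
  proof (cases "x \<in> U")
    case True
    define V where "V = U - {x}"
    have V: "V \<subseteq> F" "U = insert x V" "x \<notin> V" using U True by (auto simp: V_def)
    have "finite V" using V insert.hyps finite_subset by blast
    then have "sum ?q U = sum p V + (g (insert x F) - g F)" using V qF[of V] by simp
    moreover have "sum p V \<le> g V" using p V by blast
    moreover have "U \<union> F = insert x F" "U \<inter> F = V" using V insert.hyps by auto
    then have "g (insert x F) + g V \<le> g U + g F"
      using polymatroid_submod[OF insert.prems, of U F] U by auto
    ultimately show ?thesis by simp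
  next
    case False
    then have "U \<subseteq> F" using U by auto
    then show ?thesis using qF[of U] p by simp
  qed
  moreover have "sum ?q (insert x F) = g (insert x F)"
    using insert.hyps qF[of F] p by simp
  moreover have "0 \<le> ?q i" if "i \<in> insert x F" for i
    using that p(1) polymatroid_mono[OF insert.prems, of F "insert x F"] by auto
  ultimately show ?case by blast
qed

definition singleton_coeffs :: "('a \<Rightarrow> real) \<Rightarrow> 'a set \<Rightarrow> real" where
  "singleton_coeffs p A = (if is_singleton A then p (the_elem A) else 0)"

lemma rank_of_singleton_coeffs:
  assumes "finite I" "U \<subseteq> I"
  shows "rank_of I (singleton_coeffs p) U = sum p U"
proof -
  let ?X = "{A. A \<subseteq> I \<and> A \<inter> U \<noteq> {}}"
  have sub: "(\<lambda>i. {i}) ` U \<subseteq> ?X" using assms by auto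
  have "sum (singleton_coeffs p) ?X = sum (singleton_coeffs p) ((\<lambda>i. {i}) ` U)"
  proof (rule sum.mono_neutral_right[OF _ sub])
    show "finite ?X" using assms by simp
    show "\<forall>A\<in>?X - (\<lambda>i. {i}) ` U. singleton_coeffs p A = 0"
      by (auto simp: singleton_coeffs_def is_singleton_def)
  qed
  also have "\<dots> = (\<Sum>i\<in>U. singleton_coeffs p {i})"
    by (subst sum.reindex) auto
  finally show ?thesis by (simp add: rank_of_def singleton_coeffs_def)
qed

lemma polymatroid_modular:
  assumes "finite I" "\<And>i. i \<in> I \<Longrightarrow> 0 \<le> p i"
  shows "polymatroid I (sum p)"
  unfolding polymatroid_def
proof (intro conjI allI impI)
  fix U V assume "U \<subseteq> V" "V \<subseteq> I"
  then show "sum p U \<le> sum p V" using assms by (intro sum_mono2) (auto intro: finite_subset)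
next
  fix U V assume "U \<subseteq> I" "V \<subseteq> I"
  then have "finite U" "finite V" using assms(1) finite_subset by blast+
  then show "sum p (U \<union> V) + sum p (U \<inter> V) \<le> sum p U + sum p V"
    by (simp add: sum.union_inter)
qed simp

lemma volume_box:
  assumes I: "finite I" and p: "\<And>i. i \<in> I \<Longrightarrow> 0 \<le> p i"
  shows "measure (leb I) (indep_polytope I (sum p)) = prod p I"
proof -
  interpret product_sigma_finite "\<lambda>_. lborel :: real measure" by standard
  have "indep_polytope I (sum p) = (\<Pi>\<^sub>E i\<in>I. {0..p i})"
  proof (intro equalityI subsetI)
    fix y assume y: "y \<in> indep_polytope I (sum p)"
    have "y i \<le> p i" if "i \<in> I" for i
    proof -
      have "sum y {i} \<le> sum p {i}" using y that unfolding indep_polytope_def by blast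
      then show ?thesis by simp
    qed
    then show "y \<in> (\<Pi>\<^sub>E i\<in>I. {0..p i})" using y by (simp add: indep_polytope_def PiE_iff)
  next
    fix y assume y: "y \<in> (\<Pi>\<^sub>E i\<in>I. {0..p i})"
    then have "sum y U \<le> sum p U" if "U \<subseteq> I" for U
      using that by (intro sum_mono) (auto simp: PiE_iff)
    then show "y \<in> indep_polytope I (sum p)" using y by (simp add: indep_polytope_def PiE_iff)
  qed
  then have "emeasure (leb I) (indep_polytope I (sum p)) = (\<Prod>i\<in>I. emeasure lborel {0..p i})"
    using I by (simp add: emeasure_PiM)
  also have "\<dots> = (\<Prod>i\<in>I. ennreal (p i))"
    using p by (intro prod.cong) auto
  also have "\<dots> = ennreal (prod p I)" using p by (intro prod_ennreal) auto
  finally show ?thesis using p by (simp add: measure_def prod_nonneg)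
qed

text \<open>
  Only sequences of singletons contribute, and for these Hall's condition says that no element is
  repeated. So the sum ranges over the n! enumerations of I.
\<close>
lemma marriage_poly_box:
  assumes I: "finite I"
  shows "marriage_poly I (singleton_coeffs p) = prod p I"
proof -
  let ?K = "{..<card I}"
  let ?F = "{f. f \<in> families ?K I \<and> hall 0 ?K f}"
  let ?J = "{s \<in> ?K \<rightarrow>\<^sub>E I. inj_on s ?K}"
  let ?g = "\<lambda>s. \<lambda>k\<in>?K. {s k}"
  have inj: "inj_on ?g ?J"
  proof (rule inj_onI)
    fix s s' assume s: "s \<in> ?J" "s' \<in> ?J" and eq: "?g s = ?g s'"
    have "s k = s' k" if "k \<in> ?K" for k using fun_cong[OF eq, of k] that by simp
    moreover have "s \<in> extensional ?K" "s' \<in> extensional ?K" using s by (auto simp: PiE_iff)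
    ultimately show "s = s'" by (intro extensionalityI) auto
  qed
  have gF: "?g ` ?J \<subseteq> ?F"
  proof safe
    fix s assume s: "s \<in> ?K \<rightarrow>\<^sub>E I" "inj_on s ?K"
    then show "?g s \<in> families ?K I" by (auto simp: families_def PiE_iff)
    show "hall 0 ?K (?g s)" unfolding hall_def
    proof (intro allI impI)
      fix J assume J: "J \<subseteq> ?K"
      have "\<Union>(?g s ` J) = s ` J" using J by auto
      moreover have "card (s ` J) = card J" using s(2) J by (meson card_image inj_on_subset)
      ultimately show "card J + 0 \<le> card (\<Union>(?g s ` J))" by simp
    qed
  qed
  have zero: "(\<Prod>k\<in>?K. singleton_coeffs p (f k)) = 0" if f: "f \<in> ?F - ?g ` ?J" for f
  proof (rule ccontr)
    assume "(\<Prod>k\<in>?K. singleton_coeffs p (f k)) \<noteq> 0"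
    then have "is_singleton (f k)" if "k \<in> ?K" for k
      using that by (auto simp: singleton_coeffs_def split: if_splits)
    then have fk: "f k = {the_elem (f k)}" if "k \<in> ?K" for k
      using that by (simp add: is_singleton_the_elem)
    define s where "s = (\<lambda>k\<in>?K. the_elem (f k))"
    have fs: "f k = {s k}" if "k \<in> ?K" for k using fk[OF that] that by (simp add: s_def)
    have fam: "f \<in> families ?K I" and hall: "hall 0 ?K f" using f by auto
    have fgs: "f = ?g s"
      using fam fs by (auto simp: families_def PiE_iff fun_eq_iff extensional_def)
    have "s k \<in> I" if "k \<in> ?K" for k using fs[OF that] fam that by (auto simp: families_def PiE_iff)
    then have "s \<in> ?K \<rightarrow>\<^sub>E I" by (auto simp: s_def)
    moreover have "inj_on s ?K"
    proof (rule inj_onI, rule ccontr)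
      fix j k assume jk: "j \<in> ?K" "k \<in> ?K" "s j = s k" "j \<noteq> k"
      have "card {j, k} + 0 \<le> card (\<Union>(f ` {j, k}))"
        using hall[unfolded hall_def, rule_format, of "{j, k}"] jk by simp
      also have "\<Union>(f ` {j, k}) = {s k}" using fs[OF jk(1)] fs[OF jk(2)] jk(3) by simp
      finally show False using jk by simp
    qed
    ultimately show False using f fgs by blast
  qed
  have finF: "finite ?F" using I by simp
  have "hall_sum 0 ?K I (singleton_coeffs p) = (\<Sum>f\<in>?g ` ?J. \<Prod>k\<in>?K. singleton_coeffs p (f k))"
    unfolding hall_sum_def by (rule sum.mono_neutral_right[OF finF gF]) (use zero in blast)
  also have "\<dots> = (\<Sum>s\<in>?J. \<Prod>k\<in>?K. p (s k))"
    by (subst sum.reindex[OF inj]) (auto simp: singleton_coeffs_def intro!: sum.cong prod.cong)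
  also have "\<dots> = (\<Sum>s\<in>?J. prod p I)"
  proof (rule sum.cong)
    fix s assume s: "s \<in> ?J"
    then have "s ` ?K = I"
      using I by (intro card_subset_eq) (auto simp: card_image PiE_iff)
    then have "bij_betw s ?K I" using s by (simp add: bij_betw_def)
    then show "(\<Prod>k\<in>?K. p (s k)) = prod p I" by (rule prod.reindex_bij_betw)
  qed simp
  also have "\<dots> = real (card ?J) * prod p I" by simp
  also have "card ?J = fact (card I)"
    using card_inj_on_subset_funcset[of ?K I ?K] I by (simp add: fact_prod_rev)
  finally show ?thesis by (simp add: marriage_poly_def)
qed

definition top_coeffs :: "'a set \<Rightarrow> real \<Rightarrow> 'a set \<Rightarrow> real" where
  "top_coeffs I M A = (if A = I then M else 0)"

lemma rank_of_top_coeffs: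
  assumes "finite I" "U \<subseteq> I"
  shows "rank_of I (top_coeffs I M) U = (if U = {} then 0 else M)"
proof (cases "U = {}")
  case False
  have fin: "finite {A. A \<subseteq> I \<and> A \<inter> U \<noteq> {}}" using assms by simp
  have "I \<in> {A. A \<subseteq> I \<and> A \<inter> U \<noteq> {}}" using assms False by auto
  then have "sum (\<lambda>A. if A = I then M else 0) {A. A \<subseteq> I \<and> A \<inter> U \<noteq> {}} = M"
    using sum.delta[OF fin, of I "\<lambda>_. M"] by (simp only: if_True)
  then show ?thesis using False by (simp add: rank_of_def top_coeffs_def[abs_def])
qed simp

lemma volume_simplex:
  assumes I: "finite I" "I \<noteq> {}" and M: "0 \<le> M" and g: "\<And>U. U \<subseteq> I \<Longrightarrow> g U = (if U = {} then 0 else M)"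
  shows "measure (leb I) (indep_polytope I g) = M ^ card I / fact (card I)"
proof -
  have "sum y U \<le> g U" if y: "\<forall>i\<in>I. 0 \<le> y i" "sum y I \<le> M" and U: "U \<subseteq> I" for y U
  proof -
    have "sum y U \<le> sum y I" using I U y by (intro sum_mono2) auto
    then show ?thesis using g[OF U] y by auto
  qed
  then have "indep_polytope I g = {x. (\<forall>i\<in>I. 0 \<le> x i) \<and> sum x I \<le> M} \<inter> space (leb I)"
    using g[of I] I by (auto simp: indep_polytope_def space_PiM PiE_def)
  then have "emeasure (leb I) (indep_polytope I g) = ennreal (M ^ card I / fact (card I))"
    using emeasure_std_simplex_aux[OF I(1) M] by simp
  then show ?thesis using M by (simp add: measure_def)
qed

lemma marriage_poly_simplex:
  assumes I: "finite I" "I \<noteq> {}"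
  shows "marriage_poly I (top_coeffs I M) = M ^ card I / fact (card I)"
proof -
  let ?K = "{..<card I}"
  let ?F = "{f. f \<in> families ?K I \<and> hall 0 ?K f}"
  let ?f = "\<lambda>k\<in>?K. I"
  have "?f \<in> ?F"
  proof -
    have "hall 0 ?K ?f" unfolding hall_def
    proof (intro allI impI)
      fix J assume J: "J \<subseteq> ?K" "J \<noteq> {}"
      have "\<Union>(?f ` J) = I" using J by auto
      moreover have "card J \<le> card I" using card_mono[of ?K J] J by simp
      ultimately show "card J + 0 \<le> card (\<Union>(?f ` J))" by simp
    qed
    then show ?thesis using I by (auto simp: families_def)
  qed
  moreover have "(\<Prod>k\<in>?K. top_coeffs I M (f k)) = 0" if f: "f \<in> ?F - {?f}" for f
  proof (rule ccontr)
    assume "(\<Prod>k\<in>?K. top_coeffs I M (f k)) \<noteq> 0"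
    then have "f k = I" if "k \<in> ?K" for k
      using that by (auto simp: top_coeffs_def split: if_splits)
    then have "f = ?f" using f by (auto simp: families_def PiE_iff fun_eq_iff extensional_def)
    then show False using f by blast
  qed
  moreover have "finite ?F" using I by simp
  ultimately have "hall_sum 0 ?K I (top_coeffs I M) = (\<Sum>f\<in>{?f}. \<Prod>k\<in>?K. top_coeffs I M (f k))"
    unfolding hall_sum_def by (intro sum.mono_neutral_right) auto
  also have "\<dots> = M ^ card I" by (simp add: top_coeffs_def)
  finally show ?thesis by (simp add: marriage_poly_def)
qed

section \<open>The volume of a polymatroid\<close>

lemma nonincreasing_if_locally:
  fixes D :: "real \<Rightarrow> real"
  assumes "\<And>e. 0 < e \<Longrightarrow> \<exists>h>0. \<forall>s s'. 0 \<le> s \<longrightarrow> s \<le> s' \<longrightarrow> s' \<le> 1 \<longrightarrow> s' - s < h \<longrightarrow> D s' \<le> D s + e * (s' - s)"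
  shows "D 1 \<le> D 0"
proof (rule field_le_epsilon)
  fix e :: real assume "0 < e"
  then obtain h where h: "h > 0" "\<And>s s'. 0 \<le> s \<Longrightarrow> s \<le> s' \<Longrightarrow> s' \<le> 1 \<Longrightarrow> s' - s < h \<Longrightarrow> D s' \<le> D s + e * (s' - s)"
    using assms by blast
  obtain N where N: "inverse (real (Suc N)) < h" using reals_Archimedean[OF h(1)] by blast
  define n where "n = Suc N"
  have n: "0 < n" "1 / real n < h" using N by (auto simp: n_def field_simps)
  have "D (real k / real n) \<le> D 0 + e * (real k / real n)" if "k \<le> n" for k
    using that
  proof (induction k)
    case (Suc k)
    have diff: "real (Suc k) / real n - real k / real n = 1 / real n"
      by (simp add: diff_divide_distrib[symmetric])
    have "D (real (Suc k) / real n) \<le> D (real k / real n) + e * (real (Suc k) / real n - real k / real n)"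
      using Suc.prems n diff by (intro h(2)) (auto simp: divide_right_mono)
    also have "\<dots> \<le> D 0 + e * (real k / real n) + e * (real (Suc k) / real n - real k / real n)"
      using Suc by simp
    finally show ?case by (simp add: algebra_simps)
  qed simp
  from this[of n] show "D 1 \<le> D 0 + e" using n by simp
qed

text \<open>
  Along the segment from \<open>c0\<close> to \<open>c1\<close>, the rank of S grows at the constant rate \<open>d(S) \<ge> 0\<close>, with
  \<open>d(I) = 0\<close>. On a short piece of it, the volume increases by at most the sum over the proper S of
  the growth of the excess region times the volume for \<open>I - S\<close>; the polynomial increases by the sum
  of its partial derivatives. By \<open>excess_volume_derivative\<close> both are the same sum, evaluated at
  nearby points, so uniform continuity finishes the proof. As \<open>d(I) = 0\<close>, nothing has to be known
  about the excess region of I.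
\<close>
lemma volume_difference_le:
  assumes I: "finite I" "I \<noteq> {}" and vf: "\<And>T. T \<subset> I \<Longrightarrow> volume_formula T"
    and pm0: "polymatroid I (rank_of I c0)" and pm1: "polymatroid I (rank_of I c1)"
    and le: "\<And>U. U \<subseteq> I \<Longrightarrow> rank_of I c0 U \<le> rank_of I c1 U"
    and top: "rank_of I c0 I = rank_of I c1 I"
  shows "measure (leb I) (indep_polytope I (rank_of I c1)) - marriage_poly I c1
    \<le> measure (leb I) (indep_polytope I (rank_of I c0)) - marriage_poly I c0"
proof -
  define cs where "cs s A = (1 - s) * c0 A + s * c1 A" for s A
  define d where "d U = rank_of I c1 U - rank_of I c0 U" for U
  define F where "F s = measure (leb I) (indep_polytope I (rank_of I (cs s)))" for s
  define R where "R s = marriage_poly I (cs s)" for s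
  define P where "P = Pow I - {{}, I}"
  \<comment> \<open>The summand of S, for \<open>x = (s, \<tau>)\<close>: s is the position on the segment, and \<open>\<tau>\<close> the height
      above the facet of S that the mean value theorem provides.\<close>
  define H where "H S x = dragon_poly S ((trace_coeffs I S (cs (fst x)))(S := trace_coeffs I S (cs (fst x)) S + snd x))
     * marriage_poly (I - S) (cs (fst x))" for S x
  have cs01: "cs 0 = c0" "cs 1 = c1" by (auto simp: cs_def fun_eq_iff)
  have finP: "finite P" using I by (simp add: P_def)
  have Pow_I: "Pow I - {{}} = insert I P" "I \<notin> P" using I by (auto simp: P_def)
  have d0: "0 \<le> d U" if "U \<subseteq> I" for U using le[OF that] by (simp add: d_def)
  have dI: "d I = 0" using top by (simp add: d_def)
  have rank_cs: "rank_of I (cs s) U = rank_of I c0 U + s * d U" for s U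
    unfolding rank_of_def cs_def d_def
    by (simp add: sum.distrib sum_distrib_left[symmetric] algebra_simps sum_subtractf)
  have pm: "polymatroid I (rank_of I (cs s))" if "0 \<le> s" "s \<le> 1" for s
  proof -
    have conv: "rank_of I (cs s) U = (1 - s) * rank_of I c0 U + s * rank_of I c1 U" for U
      by (simp add: rank_cs d_def algebra_simps)
    show ?thesis
      unfolding polymatroid_def
    proof (intro conjI allI impI)
      fix U V assume "U \<subseteq> V" "V \<subseteq> I"
      then show "rank_of I (cs s) U \<le> rank_of I (cs s) V"
        unfolding conv using that polymatroid_mono[OF pm0] polymatroid_mono[OF pm1]
        by (intro add_mono mult_left_mono) auto
    next
      fix U V assume UV: "U \<subseteq> I" "V \<subseteq> I"
      have "(1 - s) * (rank_of I c0 (U \<union> V) + rank_of I c0 (U \<inter> V)) + s * (rank_of I c1 (U \<union> V) + rank_of I c1 (U \<inter> V))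
        \<le> (1 - s) * (rank_of I c0 U + rank_of I c0 V) + s * (rank_of I c1 U + rank_of I c1 V)"
        using that polymatroid_submod[OF pm0 UV] polymatroid_submod[OF pm1 UV]
        by (intro add_mono[of "(1 - s) * _" _ "s * _"] mult_left_mono) auto
      then show "rank_of I (cs s) (U \<union> V) + rank_of I (cs s) (U \<inter> V) \<le> rank_of I (cs s) U + rank_of I (cs s) V"
        unfolding conv by (simp add: algebra_simps)
    qed simp
  qed
  have upper: "\<exists>\<tau>. (\<forall>S\<in>P. 0 \<le> \<tau> S \<and> \<tau> S \<le> (s' - s) * d S) \<and> F s' \<le> F s + (s' - s) * (\<Sum>S\<in>P. d S * H S (s, \<tau> S))"
    if s: "0 \<le> s" "s \<le> s'" "s' \<le> 1" for s s'
  proof -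
    let ?g = "rank_of I (cs s)"
    let ?q = "\<lambda>S t. measure (leb S) (excess_region S ?g t)"
    have pms: "polymatroid I ?g" using pm s by simp
    have ex: "\<exists>\<tau>. 0 \<le> \<tau> \<and> \<tau> \<le> t \<and> ?q S t * marriage_poly (I - S) (cs s) = t * H S (s, \<tau>)"
      if S: "S \<in> P" and t: "0 \<le> t" for S t
    proof (cases "t = 0")
      case True
      have "excess_region S ?g 0 = {}" using S by (intro excess_region_zero) (auto simp: P_def)
      then show ?thesis using True by (intro exI[of _ 0]) simp
    next
      case False
      have SI: "S \<subset> I" "S \<noteq> {}" using S by (auto simp: P_def)
      have finS: "finite S" using SI I finite_subset by blast
      let ?c = "trace_coeffs I S (cs s)"
      have q: "?q S = (\<lambda>t. measure (leb S) (excess_region S (rank_of S ?c) t))"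
      proof
        fix t
        have "excess_region S ?g t = excess_region S (rank_of S ?c) t"
          using SI rank_of_trace[OF I(1), of S _ "cs s"] by (intro excess_region_cong) auto
        then show "?q S t = measure (leb S) (excess_region S (rank_of S ?c) t)" by simp
      qed
      have der: "(?q S has_real_derivative dragon_poly S (?c(S := ?c S + \<tau>))) (at \<tau> within {0..})" if "0 \<le> \<tau>" for \<tau>
        unfolding q
        using finS SI vf polymatroid_trace[OF I(1) _ pms, of S] that by (intro excess_volume_derivative) auto
      have "\<exists>\<tau>\<in>{0<..<t}. ?q S t - ?q S 0 = dragon_poly S (?c(S := ?c S + \<tau>)) * (t - 0)"
      proof (rule mvt_simple)
        show "0 < t" using t False by simp
        fix \<tau> assume "0 \<le> \<tau>" "\<tau> \<le> t"
        then show "(?q S has_derivative (*) (dragon_poly S (?c(S := ?c S + \<tau>)))) (at \<tau> within {0..t})"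
          using der[of \<tau>] unfolding has_field_derivative_def
          by (auto intro: has_derivative_subset simp del: fun_upd_apply)
      qed
      then obtain \<tau> where \<tau>: "0 < \<tau>" "\<tau> < t" "?q S t - ?q S 0 = dragon_poly S (?c(S := ?c S + \<tau>)) * t" by auto
      moreover have "excess_region S ?g 0 = {}" using SI by (intro excess_region_zero) auto
      ultimately show ?thesis by (intro exI[of _ \<tau>]) (simp add: H_def)
    qed
    let ?t = "\<lambda>S. (s' - s) * d S"
    have "\<forall>S\<in>P. \<exists>\<tau>. 0 \<le> \<tau> \<and> \<tau> \<le> ?t S \<and> ?q S (?t S) * marriage_poly (I - S) (cs s) = ?t S * H S (s, \<tau>)"
      using ex s d0 by (auto simp: P_def)
    then obtain \<tau> where \<tau>: "\<forall>S\<in>P. 0 \<le> \<tau> S \<and> \<tau> S \<le> ?t S \<and> ?q S (?t S) * marriage_poly (I - S) (cs s) = ?t S * H S (s, \<tau> S)"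
      by metis
    have gdiff: "rank_of I (cs s') S - ?g S = ?t S" for S by (simp add: rank_cs algebra_simps)
    have "F s' \<le> (\<Sum>S\<in>Pow I. ?q S (?t S) * measure (leb (I - S)) (indep_polytope (I - S) (contraction S ?g)))"
      using volume_upper_bound[OF I(1) pms, of "rank_of I (cs s')"] unfolding F_def gdiff .
    also have "Pow I = insert {} (insert I P)" using I by (auto simp: P_def)
    also have "(\<Sum>S\<in>insert {} (insert I P). ?q S (?t S) * measure (leb (I - S)) (indep_polytope (I - S) (contraction S ?g))) =
       ?q {} (?t {}) * measure (leb (I - {})) (indep_polytope (I - {}) (contraction {} ?g)) +
       (?q I (?t I) * measure (leb (I - I)) (indep_polytope (I - I) (contraction I ?g)) +
        (\<Sum>S\<in>P. ?q S (?t S) * measure (leb (I - S)) (indep_polytope (I - S) (contraction S ?g))))"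
      using finP I by (subst sum.insert, simp, force simp: P_def, subst sum.insert) (auto simp: P_def)
    also have "?q {} (?t {}) = 1" by (intro measure_excess_region_empty) (auto simp: d_def)
    also have "indep_polytope (I - {}) (contraction {} ?g) = indep_polytope I ?g"
      by (simp add: contraction_def[abs_def])
    also have "?q I (?t I) = 0"
      using excess_region_zero[of ?g I] I dI by simp
    also have "(\<Sum>S\<in>P. ?q S (?t S) * measure (leb (I - S)) (indep_polytope (I - S) (contraction S ?g))) =
       (\<Sum>S\<in>P. (s' - s) * (d S * H S (s, \<tau> S)))"
    proof (rule sum.cong)
      fix S assume S: "S \<in> P"
      then have "volume_formula (I - S)" "S \<subseteq> I" by (auto simp: P_def intro!: vf)
      then have "measure (leb (I - S)) (indep_polytope (I - S) (contraction S ?g)) = marriage_poly (I - S) (cs s)"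
        by (intro volume_contraction[OF I(1) _ pms]) auto
      then show "?q S (?t S) * measure (leb (I - S)) (indep_polytope (I - S) (contraction S ?g)) = (s' - s) * (d S * H S (s, \<tau> S))"
        using \<tau> S by simp
    qed simp
    finally have "F s' \<le> F s + (s' - s) * (\<Sum>S\<in>P. d S * H S (s, \<tau> S))"
      by (simp add: F_def sum_distrib_left)
    then show ?thesis using \<tau> by blast
  qed
  have R': "(R has_real_derivative (\<Sum>S\<in>P. d S * H S (x, 0))) (at x)" for x
  proof -
    have "(R has_real_derivative (\<Sum>S\<in>Pow I - {{}}. rank_of I (\<lambda>A. c1 A - c0 A) S * dragon_poly S (trace_coeffs I S (cs x)) * marriage_poly (I - S) (cs x))) (at x)"
      unfolding R_def by (rule marriage_poly_derivative[OF I]) (auto simp: cs_def[abs_def] intro!: derivative_eq_intros)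
    also have "(\<Sum>S\<in>Pow I - {{}}. rank_of I (\<lambda>A. c1 A - c0 A) S * dragon_poly S (trace_coeffs I S (cs x)) * marriage_poly (I - S) (cs x)) =
       (\<Sum>S\<in>insert I P. d S * H S (x, 0))"
      unfolding Pow_I(1) by (intro sum.cong) (auto simp: H_def d_def rank_of_def sum_subtractf)
    also have "\<dots> = (\<Sum>S\<in>P. d S * H S (x, 0))"
      using finP Pow_I(2) dI by simp
    finally show ?thesis .
  qed
  have contH: "continuous_on X (H S)" for X S
  proof -
    have "continuous_on X (\<lambda>x. cs (fst x) A)" for A
      unfolding cs_def by (intro continuous_intros)
    moreover from this have tr: "continuous_on X (\<lambda>x. trace_coeffs I S (cs (fst x)) A)" for A
      unfolding trace_coeffs_def by (intro continuous_on_sum)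
    moreover have "continuous_on X (\<lambda>x. ((trace_coeffs I S (cs (fst x)))(S := trace_coeffs I S (cs (fst x)) S + snd x)) A)" for A
      using tr by (cases "A = S") (auto intro!: continuous_intros)
    ultimately show ?thesis
      unfolding H_def[abs_def] dragon_poly_def marriage_poly_def
      by (intro continuous_on_mult continuous_on_divide continuous_on_hall_sum continuous_on_const)
        (simp_all del: fun_upd_apply)
  qed
  have "F 1 - R 1 \<le> F 0 - R 0"
  proof (rule nonincreasing_if_locally[of "\<lambda>s. F s - R s"])
    fix e :: real assume e: "0 < e"
    define e' where "e' = e / (1 + sum d P)"
    have sd: "0 \<le> sum d P" using d0 by (intro sum_nonneg) (auto simp: P_def)
    then have e': "0 < e'" "sum d P * e' \<le> e" using e by (auto simp: e'_def field_simps)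
    have "\<exists>h>0. \<forall>s \<xi> \<tau>. 0 \<le> s \<longrightarrow> s \<le> 1 \<longrightarrow> 0 \<le> \<xi> \<longrightarrow> \<xi> \<le> 1 \<longrightarrow> 0 \<le> \<tau> \<longrightarrow> \<tau> \<le> d S \<longrightarrow>
        \<bar>s - \<xi>\<bar> + \<tau> < h \<longrightarrow> H S (s, \<tau>) \<le> H S (\<xi>, 0) + e'" if S: "S \<in> P" for S
    proof -
      let ?X = "{0..1::real} \<times> {0..d S}"
      have "compact ?X" by (intro compact_Times compact_Icc)
      then have "uniformly_continuous_on ?X (H S)"
        by (intro compact_uniformly_continuous contH)
      then obtain h where h: "h > 0" "\<And>x x'. x \<in> ?X \<Longrightarrow> x' \<in> ?X \<Longrightarrow> dist x' x < h \<Longrightarrow> dist (H S x') (H S x) < e'"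
        using e'(1) unfolding uniformly_continuous_on_def by metis
      show ?thesis
      proof (intro exI[of _ h] conjI h(1) allI impI)
        fix s \<xi> \<tau> :: real
        assume a: "0 \<le> s" "s \<le> 1" "0 \<le> \<xi>" "\<xi> \<le> 1" "0 \<le> \<tau>" "\<tau> \<le> d S" "\<bar>s - \<xi>\<bar> + \<tau> < h"
        have "dist (s, \<tau>) (\<xi>, 0) \<le> \<bar>s - \<xi>\<bar> + \<bar>\<tau>\<bar>"
          unfolding dist_Pair_Pair by (metis dist_real_def diff_zero sqrt_sum_squares_le_sum_abs abs_idempotent)
        then have "dist (H S (s, \<tau>)) (H S (\<xi>, 0)) < e'" using a by (intro h(2)) auto
        then show "H S (s, \<tau>) \<le> H S (\<xi>, 0) + e'" by (simp add: dist_real_def)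
      qed
    qed
    then obtain h where h: "\<And>S. S \<in> P \<Longrightarrow> h S > 0"
      "\<And>S s \<xi> \<tau>. S \<in> P \<Longrightarrow> 0 \<le> s \<Longrightarrow> s \<le> 1 \<Longrightarrow> 0 \<le> \<xi> \<Longrightarrow> \<xi> \<le> 1 \<Longrightarrow> 0 \<le> \<tau> \<Longrightarrow> \<tau> \<le> d S \<Longrightarrow>
        \<bar>s - \<xi>\<bar> + \<tau> < h S \<Longrightarrow> H S (s, \<tau>) \<le> H S (\<xi>, 0) + e'"
      by metis
    define h0 where "h0 = Min (insert 1 ((\<lambda>S. h S / (1 + d S)) ` P))"
    have dP: "0 \<le> d S" if "S \<in> P" for S using that d0 by (auto simp: P_def)
    have h0: "h0 > 0" "\<And>S. S \<in> P \<Longrightarrow> h0 * (1 + d S) \<le> h S"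
    proof -
      show "h0 > 0" unfolding h0_def using finP h(1) dP by (subst Min_gr_iff) (auto intro!: divide_pos_pos add_pos_nonneg)
      fix S assume S: "S \<in> P"
      then have "h0 \<le> h S / (1 + d S)" unfolding h0_def using finP by (intro Min_le) auto
      then show "h0 * (1 + d S) \<le> h S" using dP[OF S] by (simp add: field_simps)
    qed
    show "\<exists>h>0. \<forall>s s'. 0 \<le> s \<longrightarrow> s \<le> s' \<longrightarrow> s' \<le> 1 \<longrightarrow> s' - s < h \<longrightarrow> F s' - R s' \<le> F s - R s + e * (s' - s)"
    proof (intro exI[of _ h0] conjI h0(1) allI impI)
      fix s s' assume s: "0 \<le> s" "s \<le> s'" "s' \<le> 1" "s' - s < h0"
      show "F s' - R s' \<le> F s - R s + e * (s' - s)"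
      proof (cases "s = s'")
        case False
        then have "s < s'" using s by simp
        then obtain \<xi> where \<xi>: "s < \<xi>" "\<xi> < s'" "R s' - R s = (s' - s) * (\<Sum>S\<in>P. d S * H S (\<xi>, 0))"
          using MVT2[of s s' R "\<lambda>x. \<Sum>S\<in>P. d S * H S (x, 0)"] R' by auto
        obtain \<tau> where \<tau>: "\<forall>S\<in>P. 0 \<le> \<tau> S \<and> \<tau> S \<le> (s' - s) * d S"
          and Fs: "F s' \<le> F s + (s' - s) * (\<Sum>S\<in>P. d S * H S (s, \<tau> S))"
          using upper[OF s(1,2,3)] by blast
        have "(\<Sum>S\<in>P. d S * H S (s, \<tau> S)) \<le> (\<Sum>S\<in>P. d S * (H S (\<xi>, 0) + e'))"
        proof (intro sum_mono mult_left_mono)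
          fix S assume S: "S \<in> P"
          show "0 \<le> d S" by (rule dP[OF S])
          have "\<tau> S \<le> 1 * d S" using \<tau> S s dP[OF S] by (meson mult_right_mono order_trans diff_le_eq add_increasing2 le_diff_eq diff_left_mono)
          moreover have "\<bar>s - \<xi>\<bar> + \<tau> S \<le> (s' - s) * (1 + d S)"
            using \<xi> \<tau> S by (simp add: algebra_simps) (smt (verit) \<tau> S left_diff_distrib)
          moreover have "(s' - s) * (1 + d S) < h0 * (1 + d S)"
            using s dP[OF S] by (intro mult_strict_right_mono) auto
          ultimately show "H S (s, \<tau> S) \<le> H S (\<xi>, 0) + e'"
            using h0(2)[OF S] \<tau> S s \<xi> by (intro h(2)[OF S]) auto
        qed
        also have "\<dots> = (\<Sum>S\<in>P. d S * H S (\<xi>, 0)) + sum d P * e'"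
          by (simp add: distrib_left sum.distrib sum_distrib_right)
        also have "\<dots> \<le> (\<Sum>S\<in>P. d S * H S (\<xi>, 0)) + e" using e' by simp
        finally have "(s' - s) * (\<Sum>S\<in>P. d S * H S (s, \<tau> S)) \<le> (s' - s) * ((\<Sum>S\<in>P. d S * H S (\<xi>, 0)) + e)"
          using s by (intro mult_left_mono) auto
        then show ?thesis using Fs \<xi>(3) by (simp add: algebra_simps)
      qed simp
    qed
  qed
  then show ?thesis by (simp add: F_def R_def cs01)
qed

text \<open>
  Every polymatroid lies between the box of a point of its base polytope and a simplex, all with
  the same total rank. The difference between volume and polynomial does not increase on the way
  from the box to the polymatroid and on to the simplex, and it vanishes at both ends.
\<close>
theorem polymatroid_volume:
  assumes "finite I"
  shows "volume_formula I"
  using assms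
proof (induction rule: finite_psubset_induct)
  case (psubset I)
  show ?case
  proof (cases "I = {}")
    case True
    have "measure (leb {}) (indep_polytope {} (rank_of {} c)) = 1" for c :: "'a set \<Rightarrow> real"
    proof -
      have "indep_polytope {} (rank_of {} c) = {\<lambda>_. undefined}" by (auto simp: indep_polytope_def)
      then show ?thesis by (simp add: PiM_empty)
    qed
    then show ?thesis unfolding True volume_formula_def by simp
  next
    case False
    note I = \<open>finite I\<close> False
    show ?thesis
      unfolding volume_formula_def
    proof (intro allI impI)
      fix c assume pm: "polymatroid I (rank_of I c)"
      let ?g = "rank_of I c"
      obtain p where p: "\<forall>i\<in>I. 0 \<le> p i" "\<forall>U\<subseteq>I. sum p U \<le> ?g U" "sum p I = ?g I"
        using polymatroid_base[OF I(1) pm] by blast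
      let ?c0 = "singleton_coeffs p" and ?c1 = "top_coeffs I (?g I)"
      have r0: "rank_of I ?c0 U = sum p U" if "U \<subseteq> I" for U by (rule rank_of_singleton_coeffs[OF I(1) that])
      have r1: "rank_of I ?c1 U = (if U = {} then 0 else ?g I)" if "U \<subseteq> I" for U by (rule rank_of_top_coeffs[OF I(1) that])
      have gI: "0 \<le> ?g I" using p by (metis sum_nonneg)
      have pm0: "polymatroid I (rank_of I ?c0)"
        using polymatroid_modular[of I p] p I polymatroid_cong[of I "rank_of I ?c0" "sum p"] r0 by simp
      have pm1: "polymatroid I (rank_of I ?c1)"
        unfolding polymatroid_def
      proof (intro conjI allI impI)
        fix U V assume "U \<subseteq> V" "V \<subseteq> I"
        then show "rank_of I ?c1 U \<le> rank_of I ?c1 V" using gI by (auto simp: r1)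
      next
        fix U V assume UV: "U \<subseteq> I" "V \<subseteq> I"
        then have "U \<union> V \<subseteq> I" "U \<inter> V \<subseteq> I" by auto
        then show "rank_of I ?c1 (U \<union> V) + rank_of I ?c1 (U \<inter> V) \<le> rank_of I ?c1 U + rank_of I ?c1 V"
          using UV gI by (simp add: r1)
      qed simp
      have "measure (leb I) (indep_polytope I ?g) - marriage_poly I c
         \<le> measure (leb I) (indep_polytope I (rank_of I ?c0)) - marriage_poly I ?c0"
        using p by (intro volume_difference_le[OF I psubset.IH pm0 pm]) (auto simp: r0)
      moreover have "measure (leb I) (indep_polytope I (rank_of I ?c0)) = prod p I"
        using volume_box[of I p] I p indep_polytope_cong[of I "rank_of I ?c0" "sum p"] r0 by simp
      moreover have "measure (leb I) (indep_polytope I (rank_of I ?c1)) - marriage_poly I ?c1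
         \<le> measure (leb I) (indep_polytope I ?g) - marriage_poly I c"
        using I polymatroid_mono[OF pm] by (intro volume_difference_le[OF I psubset.IH pm pm1]) (auto simp: r1)
      moreover have "measure (leb I) (indep_polytope I (rank_of I ?c1)) = ?g I ^ card I / fact (card I)"
        using volume_simplex[OF I gI, of "rank_of I ?c1"] r1 by simp
      ultimately show "measure (leb I) (indep_polytope I ?g) = marriage_poly I c"
        using marriage_poly_box[OF I(1), of p] marriage_poly_simplex[OF I, of "?g I"] by simp
    qed
  qed
qed

section \<open>From Hall sequences to draconian multiplicities\<close>

text \<open>
  The multinomial coefficient, in multiplied form.
\<close>
lemma card_maps_with_multiplicities:
  assumes "finite X" "finite K" "(\<Sum>A\<in>X. \<alpha> A) = card K"
  shows "card {f \<in> K \<rightarrow>\<^sub>E X. \<forall>A\<in>X. card {k \<in> K. f k = A} = \<alpha> A} * (\<Prod>A\<in>X. fact (\<alpha> A)) = (fact (card K) :: nat)"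
  using assms
proof (induction X arbitrary: K rule: finite_induct)
  case empty
  then have "K = {}" by simp
  then show ?case by simp
next
  case (insert A X)
  let ?Z = "Sigma {J. J \<subseteq> K \<and> card J = \<alpha> A}
     (\<lambda>J. {f \<in> (K - J) \<rightarrow>\<^sub>E X. \<forall>B\<in>X. card {k \<in> K - J. f k = B} = \<alpha> B})"
  let ?L = "{f \<in> K \<rightarrow>\<^sub>E insert A X. \<forall>B\<in>insert A X. card {k \<in> K. f k = B} = \<alpha> B}"
  have "bij_betw (\<lambda>f. ({k \<in> K. f k = A}, restrict f (K - {k \<in> K. f k = A}))) ?L ?Z"
  proof (rule bij_betwI[where g = "\<lambda>(J, f) k. if k \<in> J then A else f k"], goal_cases)
    case 1
    show ?case
    proof
      fix f assume f: "f \<in> ?L"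
      let ?J = "{k \<in> K. f k = A}"
      have "{k \<in> K - ?J. restrict f (K - ?J) k = B} = {k \<in> K. f k = B}" if "B \<in> X" for B
        using that insert.hyps by auto
      then have "\<forall>B\<in>X. card {k \<in> K - ?J. restrict f (K - ?J) k = B} = \<alpha> B"
        using f by auto
      moreover have "restrict f (K - ?J) \<in> (K - ?J) \<rightarrow>\<^sub>E X"
        using f by (auto simp: PiE_iff)
      moreover have "card ?J = \<alpha> A" using f by auto
      ultimately show "(?J, restrict f (K - ?J)) \<in> ?Z" by blast
    qed
  next
    case 2
    show ?case
    proof
      fix z assume z: "z \<in> ?Z"
      obtain J f where Jf: "z = (J, f)" by (cases z)
      let ?h = "\<lambda>k. if k \<in> J then A else f k"
      have J: "J \<subseteq> K" "card J = \<alpha> A" and f: "f \<in> (K - J) \<rightarrow>\<^sub>E X" "\<And>B. B \<in> X \<Longrightarrow> card {k \<in> K - J. f k = B} = \<alpha> B"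
        using z Jf by auto
      have "{k \<in> K. ?h k = A} = J" using J f(1) insert.hyps by (auto simp: PiE_iff)
      moreover have "{k \<in> K. ?h k = B} = {k \<in> K - J. f k = B}" if "B \<in> X" for B
        using that insert.hyps by auto
      moreover have "?h \<in> K \<rightarrow>\<^sub>E insert A X" using J f(1) by (auto simp: PiE_iff extensional_def)
      ultimately have "?h \<in> ?L" using J f(2) by simp
      then show "(\<lambda>(J, f) k. if k \<in> J then A else f k) z \<in> ?L" unfolding Jf by simp
    qed
  next
    case (3 f)
    then show ?case by (auto simp: PiE_iff extensional_def fun_eq_iff)
  next
    case (4 z)
    obtain J f where Jf: "z = (J, f)" by (cases z)
    have J: "J \<subseteq> K" and f: "f \<in> (K - J) \<rightarrow>\<^sub>E X" using 4 Jf by auto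
    have "{k \<in> K. (if k \<in> J then A else f k) = A} = J" using J f insert.hyps by (auto simp: PiE_iff)
    moreover have "restrict (\<lambda>k. if k \<in> J then A else f k) (K - J) = f"
      using f by (auto simp: PiE_iff extensional_def fun_eq_iff)
    ultimately show ?case unfolding Jf by simp
  qed
  then have "card ?L = card ?Z" by (rule bij_betw_same_card)
  also have "\<dots> = (\<Sum>J | J \<subseteq> K \<and> card J = \<alpha> A. card {f \<in> (K - J) \<rightarrow>\<^sub>E X. \<forall>B\<in>X. card {k \<in> K - J. f k = B} = \<alpha> B})"
  proof (rule card_SigmaI)
    show "finite {J. J \<subseteq> K \<and> card J = \<alpha> A}" using insert.prems by simp
    have "finite ((K - J) \<rightarrow>\<^sub>E X)" for J using insert by (intro finite_PiE) auto
    then show "\<forall>J\<in>{J. J \<subseteq> K \<and> card J = \<alpha> A}. finite {f \<in> (K - J) \<rightarrow>\<^sub>E X. \<forall>B\<in>X. card {k \<in> K - J. f k = B} = \<alpha> B}"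
      by (metis (no_types, lifting) finite_subset mem_Collect_eq subsetI)
  qed
  finally have "card ?L * (\<Prod>B\<in>X. fact (\<alpha> B)) =
     (\<Sum>J | J \<subseteq> K \<and> card J = \<alpha> A. card {f \<in> (K - J) \<rightarrow>\<^sub>E X. \<forall>B\<in>X. card {k \<in> K - J. f k = B} = \<alpha> B} * (\<Prod>B\<in>X. fact (\<alpha> B)))"
    by (simp only: sum_distrib_right)
  also have "\<dots> = (\<Sum>J | J \<subseteq> K \<and> card J = \<alpha> A. fact (card K - \<alpha> A))"
  proof (rule sum.cong)
    fix J assume "J \<in> {J. J \<subseteq> K \<and> card J = \<alpha> A}"
    then have J: "J \<subseteq> K" "card J = \<alpha> A" "finite J" using insert.prems finite_subset by auto
    then have "card (K - J) = card K - \<alpha> A" "finite (K - J)"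
      using insert.prems by (auto simp: card_Diff_subset)
    moreover have "(\<Sum>B\<in>X. \<alpha> B) = card K - \<alpha> A" using insert by simp
    ultimately show "card {f \<in> (K - J) \<rightarrow>\<^sub>E X. \<forall>B\<in>X. card {k \<in> K - J. f k = B} = \<alpha> B} * (\<Prod>B\<in>X. fact (\<alpha> B)) = fact (card K - \<alpha> A)"
      using insert.IH[of "K - J"] by simp
  qed simp
  also have "\<dots> = (card K choose \<alpha> A) * fact (card K - \<alpha> A)"
    using n_subsets[OF \<open>finite K\<close>] by simp
  finally have "card ?L * (\<Prod>B\<in>insert A X. fact (\<alpha> B)) = fact (\<alpha> A) * fact (card K - \<alpha> A) * (card K choose \<alpha> A)"
    using insert.hyps by (simp add: mult_ac)
  also have "\<dots> = fact (card K)"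
    using insert by (intro binomial_fact_lemma) simp
  finally show ?case .
qed

text \<open>
  For the multiplicities of a sequence, the draconian inequality for a collection E is Hall's
  condition for the indices whose sets lie in E.
\<close>
lemma marriage_poly_draconian:
  "marriage_poly {1..n} c =
     (\<Sum>\<alpha> | \<alpha> \<in> draconian n \<and> (\<Sum>A\<in>nonempty_subsets n. \<alpha> A) = n.
       \<Prod>A\<in>nonempty_subsets n. c A ^ \<alpha> A / fact (\<alpha> A))"
proof -
  let ?K = "{..<n}" and ?N = "nonempty_subsets n"
  let ?F = "{f. f \<in> families ?K {1..n} \<and> hall 0 ?K f}"
  let ?Y = "{\<alpha>. \<alpha> \<in> draconian n \<and> (\<Sum>A\<in>?N. \<alpha> A) = n}"
  let ?g = "\<lambda>f. \<lambda>A\<in>?N. card {k \<in> ?K. f k = A}"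
  have N: "Pow {1..n} - {{}} = ?N" by (auto simp: nonempty_subsets_def)
  have finN: "finite ?N" by (rule finite_nonempty_subsets)
  have finF: "finite ?F" by simp
  have finY: "finite ?Y" using finite_draconian by simp
  have F_iff: "f \<in> ?F \<longleftrightarrow> f \<in> ?K \<rightarrow>\<^sub>E ?N \<and> ?g f \<in> ?Y" for f
  proof -
    have "hall 0 ?K f \<longleftrightarrow> ?g f \<in> draconian n" and "(\<Sum>A\<in>?N. ?g f A) = n" if f: "f \<in> ?K \<rightarrow>\<^sub>E ?N"
    proof -
      have sumE: "(\<Sum>A\<in>E. ?g f A) = card {k \<in> ?K. f k \<in> E}" if E: "E \<subseteq> ?N" for E
      proof -
        have "(\<Sum>A\<in>E. ?g f A) = (\<Sum>A\<in>E. card {k \<in> {k \<in> ?K. f k \<in> E}. f k = A})"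
        proof (rule sum.cong)
          fix A assume A: "A \<in> E"
          have "{k \<in> ?K. f k = A} = {k \<in> {k \<in> ?K. f k \<in> E}. f k = A}" using A by auto
          then show "?g f A = card {k \<in> {k \<in> ?K. f k \<in> E}. f k = A}" using A E by auto
        qed simp
        also have "\<dots> = (\<Sum>A\<in>E. \<Sum>k\<in>{k \<in> {k \<in> ?K. f k \<in> E}. f k = A}. 1)" by simp
        also have "\<dots> = (\<Sum>k\<in>{k \<in> ?K. f k \<in> E}. 1)"
          using E finN finite_subset by (intro sum.group) auto
        finally show ?thesis by simp
      qed
      have "{k \<in> ?K. f k \<in> ?N} = ?K" using f by auto
      then show "(\<Sum>A\<in>?N. ?g f A) = n" using sumE[of ?N] by simp
      show "hall 0 ?K f \<longleftrightarrow> ?g f \<in> draconian n"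
      proof
        assume h: "hall 0 ?K f"
        have "(\<Sum>A\<in>E. ?g f A) \<le> card (\<Union>E)" if E: "E \<noteq> {}" "E \<subseteq> ?N" for E
        proof -
          let ?J = "{k \<in> ?K. f k \<in> E}"
          have "finite (\<Union>E)" using E by (intro finite_subset[of "\<Union>E" "{1..n}"]) (auto simp: nonempty_subsets_def)
          then have "card (\<Union>(f ` ?J)) \<le> card (\<Union>E)" by (intro card_mono) auto
          moreover have "card ?J \<le> card (\<Union>(f ` ?J))"
            using h[unfolded hall_def, rule_format, of ?J] by (cases "?J = {}") (simp_all only: card.empty, auto)
          ultimately show ?thesis using sumE[OF E(2)] by simp
        qed
        then show "?g f \<in> draconian n" unfolding draconian_def by auto
      next
        assume d: "?g f \<in> draconian n"
        show "hall 0 ?K f" unfolding hall_def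
        proof (intro allI impI)
          fix J assume J: "J \<subseteq> ?K" "J \<noteq> {}"
          have E: "f ` J \<subseteq> ?N" "f ` J \<noteq> {}" using f J by auto
          have "card J \<le> card {k \<in> ?K. f k \<in> f ` J}" using J by (intro card_mono) auto
          also have "\<dots> \<le> card (\<Union>(f ` J))"
          proof -
            have "(\<Sum>A\<in>f ` J. ?g f A) \<le> card (\<Union>(f ` J))"
              using d[unfolded draconian_def mem_Collect_eq, THEN conjunct2, rule_format, of "f ` J", OF conjI[OF E(2,1)]] .
            then show ?thesis unfolding sumE[OF E(1)] .
          qed
          finally show "card J + 0 \<le> card (\<Union>(f ` J))" by simp
        qed
      qed
    qed
    moreover have "f \<in> ?F \<longleftrightarrow> f \<in> ?K \<rightarrow>\<^sub>E ?N \<and> hall 0 ?K f"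
      by (simp only: families_def N mem_Collect_eq)
    ultimately show ?thesis by (simp only: mem_Collect_eq) blast
  qed
  have "hall_sum 0 ?K {1..n} c = (\<Sum>\<alpha>\<in>?Y. \<Sum>f\<in>{f \<in> ?F. ?g f = \<alpha>}. \<Prod>k\<in>?K. c (f k))"
    unfolding hall_sum_def using F_iff by (intro sum.group[symmetric] finF finY) blast
  also have "\<dots> = (\<Sum>\<alpha>\<in>?Y. fact n * (\<Prod>A\<in>?N. c A ^ \<alpha> A / fact (\<alpha> A)))"
  proof (rule sum.cong)
    fix \<alpha> assume \<alpha>: "\<alpha> \<in> ?Y"
    have ext: "\<alpha> \<in> extensional ?N" and sum: "(\<Sum>A\<in>?N. \<alpha> A) = n" using \<alpha> by (auto simp: draconian_def)
    let ?X = "{f \<in> ?K \<rightarrow>\<^sub>E ?N. \<forall>A\<in>?N. card {k \<in> ?K. f k = A} = \<alpha> A}"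
    have "(?g f = \<alpha>) = (\<forall>A\<in>?N. card {k \<in> ?K. f k = A} = \<alpha> A)" for f
      using ext by (auto simp: fun_eq_iff extensional_def)
    moreover have "f \<in> ?F \<and> ?g f = \<alpha> \<longleftrightarrow> f \<in> ?K \<rightarrow>\<^sub>E ?N \<and> ?g f = \<alpha>" for f
      using F_iff[of f] \<alpha> by metis
    ultimately have "f \<in> {f \<in> ?F. ?g f = \<alpha>} \<longleftrightarrow> f \<in> ?X" for f
      by (simp only: mem_Collect_eq)
    then have "{f \<in> ?F. ?g f = \<alpha>} = ?X" by (rule set_eqI)
    moreover have "(\<Prod>k\<in>?K. c (f k)) = (\<Prod>A\<in>?N. c A ^ \<alpha> A)" if f: "f \<in> ?X" for f
    proof -
      have "(\<Prod>k\<in>?K. c (f k)) = (\<Prod>A\<in>?N. \<Prod>k\<in>{k \<in> ?K. f k = A}. c (f k))"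
        using f finN by (intro prod.group[symmetric]) auto
      also have "\<dots> = (\<Prod>A\<in>?N. c A ^ \<alpha> A)"
        using f by (intro prod.cong) auto
      finally show ?thesis .
    qed
    ultimately have "(\<Sum>f\<in>{f \<in> ?F. ?g f = \<alpha>}. \<Prod>k\<in>?K. c (f k)) = real (card ?X) * (\<Prod>A\<in>?N. c A ^ \<alpha> A)"
      by simp
    moreover have "real (card ?X) * (\<Prod>A\<in>?N. fact (\<alpha> A)) = fact n"
    proof -
      have "card ?X * (\<Prod>A\<in>?N. fact (\<alpha> A)) = fact (card ?K)"
        by (rule card_maps_with_multiplicities) (use finN sum in auto)
      then have "real (card ?X * (\<Prod>A\<in>?N. fact (\<alpha> A))) = real (fact (card ?K))"
        by (simp only:)
      then show ?thesis by (simp only: of_nat_mult of_nat_prod of_nat_fact card_lessThan)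
    qed
    moreover have "(\<Prod>A\<in>?N. fact (\<alpha> A)) \<noteq> (0 :: real)" using finN by (simp add: prod_zero_iff)
    ultimately show "(\<Sum>f\<in>{f \<in> ?F. ?g f = \<alpha>}. \<Prod>k\<in>?K. c (f k)) = fact n * (\<Prod>A\<in>?N. c A ^ \<alpha> A / fact (\<alpha> A))"
      by (simp add: prod_dividef field_simps)
  qed simp
  finally show ?thesis by (simp add: marriage_poly_def sum_distrib_left[symmetric])
qed

lemma hall_image:
  assumes "inj_on p I" "\<And>k. k \<in> K \<Longrightarrow> f k \<subseteq> I"
  shows "hall e K (\<lambda>k. p ` f k) \<longleftrightarrow> hall e K f"
proof -
  have "card (\<Union>((\<lambda>k. p ` f k) ` J)) = card (\<Union>(f ` J))" if "J \<subseteq> K" for J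
  proof -
    have "\<Union>((\<lambda>k. p ` f k) ` J) = p ` \<Union>(f ` J)" by auto
    moreover have "inj_on p (\<Union>(f ` J))" using assms that by (intro inj_on_subset[OF assms(1)]) auto
    ultimately show ?thesis by (simp only: card_image)
  qed
  then show ?thesis unfolding hall_def by auto
qed

text \<open>
  Needed because the volume is computed with the standard basis as the set of coordinates, while
  the subsets in the final formula are sets of numbers.
\<close>
lemma marriage_poly_card_cong:
  assumes fin: "finite I" "finite I'" and eq: "card I = card I'"
  shows "marriage_poly I (\<lambda>A. v (card A)) = marriage_poly I' (\<lambda>A. v (card A))"
proof -
  obtain p where p: "bij_betw p I I'" using finite_same_card_bij[OF fin eq] by blast
  define q where "q = inv_into I p"
  have q: "bij_betw q I' I" unfolding q_def by (rule bij_betw_inv_into[OF p])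
  have inj: "inj_on p I" "inj_on q I'" and im: "p ` I = I'" "q ` I' = I" using p q by (auto simp: bij_betw_def)
  have qp: "q ` p ` A = A" if "A \<subseteq> I" for A
    using that inv_into_image_cancel[OF inj(1)] by (simp add: q_def)
  have pq: "p ` q ` A = A" if "A \<subseteq> I'" for A
    using that image_inv_into_cancel[OF im(1)] by (simp add: q_def)
  let ?K = "{..<card I}"
  have "hall_sum 0 ?K I (\<lambda>A. v (card A)) = hall_sum 0 ?K I' (\<lambda>A. v (card A))"
    unfolding hall_sum_def
  proof (rule sum.reindex_bij_witness[where i = "\<lambda>f. \<lambda>k\<in>?K. q ` f k" and j = "\<lambda>f. \<lambda>k\<in>?K. p ` f k"], goal_cases)
    case (1 f)
    then show ?case using qp by (auto simp: families_def PiE_iff fun_eq_iff extensional_def)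
  next
    case (2 f)
    then have f: "f \<in> families ?K I" "hall 0 ?K f" by auto
    then have "hall 0 ?K (\<lambda>k. p ` f k)"
      by (subst hall_image[OF inj(1)]) (auto simp: families_def PiE_iff)
    then have "hall 0 ?K (\<lambda>k\<in>?K. p ` f k)"
      by (subst hall_cong[where g = "\<lambda>k. p ` f k"]) auto
    moreover have "p ` f k \<subseteq> I'" "f k \<noteq> {}" if "k \<in> ?K" for k
      using f(1) im(1) that by (auto simp: families_def PiE_iff)
    then have "(\<lambda>k\<in>?K. p ` f k) \<in> families ?K I'"
      by (auto simp: families_def PiE_iff)
    ultimately show ?case by simp
  next
    case (3 f)
    then show ?case using pq by (auto simp: families_def PiE_iff fun_eq_iff extensional_def)
  next
    case (4 f)
    then have f: "f \<in> families ?K I'" "hall 0 ?K f" by auto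
    then have "hall 0 ?K (\<lambda>k. q ` f k)"
      by (subst hall_image[OF inj(2)]) (auto simp: families_def PiE_iff)
    then have "hall 0 ?K (\<lambda>k\<in>?K. q ` f k)"
      by (subst hall_cong[where g = "\<lambda>k. q ` f k"]) auto
    moreover have "q ` f k \<subseteq> I" "f k \<noteq> {}" if "k \<in> ?K" for k
      using f(1) im(2) that by (auto simp: families_def PiE_iff)
    then have "(\<lambda>k\<in>?K. q ` f k) \<in> families ?K I"
      by (auto simp: families_def PiE_iff)
    ultimately show ?case by simp
  next
    case (5 f)
    have "card (p ` f k) = card (f k)" if "k \<in> ?K" for k
      using 5 that by (intro card_image inj_on_subset[OF inj(1)]) (auto simp: families_def PiE_iff)
    then show ?case by simp
  qed
  then show ?thesis by (simp add: marriage_poly_def eq)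
qed

section \<open>The numbers w as coefficients of a rank function\<close>

definition binomial_transform :: "(nat \<Rightarrow> int) \<Rightarrow> nat \<Rightarrow> int" where
  "binomial_transform f m = (\<Sum>k\<le>m. int (m choose k) * f k)"

lemma binomial_transform_Suc:
  "binomial_transform f (Suc m) = binomial_transform f m + binomial_transform (\<lambda>k. f (Suc k)) m"
proof -
  have "binomial_transform f (Suc m) = f 0 + (\<Sum>k\<le>m. int (Suc m choose Suc k) * f (Suc k))"
    unfolding binomial_transform_def by (subst sum.atMost_Suc_shift) simp
  also have "\<dots> = (f 0 + (\<Sum>k\<le>m. int (m choose Suc k) * f (Suc k))) + binomial_transform (\<lambda>k. f (Suc k)) m"
    unfolding binomial_transform_def by (simp add: distrib_right sum.distrib)
  also have "f 0 + (\<Sum>k\<le>m. int (m choose Suc k) * f (Suc k)) = (\<Sum>k\<le>Suc m. int (m choose k) * f k)"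
    by (subst sum.atMost_Suc_shift) simp
  also have "\<dots> = binomial_transform f m"
    unfolding binomial_transform_def by (simp add: binomial_eq_0)
  finally show ?thesis .
qed

lemma binomial_transform_diff:
  "binomial_transform (\<lambda>k. f k - g k) m = binomial_transform f m - binomial_transform g m"
  unfolding binomial_transform_def by (simp add: right_diff_distrib sum_subtractf)

lemma binomial_transform_uminus:
  "binomial_transform (\<lambda>k. - f k) m = - binomial_transform f m"
  unfolding binomial_transform_def by (simp add: sum_negf)

definition forward_difference :: "(nat \<Rightarrow> int) \<Rightarrow> nat \<Rightarrow> nat \<Rightarrow> int" where
  "forward_difference f k x = binomial_transform (\<lambda>j. (- 1) ^ j * f (x + k - j)) k"

lemma forward_difference_Suc:
  "forward_difference f (Suc k) x = forward_difference f k (Suc x) - forward_difference f k x"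
  unfolding forward_difference_def binomial_transform_Suc
  by (simp add: binomial_transform_uminus)

lemma newton_forward_difference:
  "binomial_transform (\<lambda>k. forward_difference f k x) m = f (x + m)"
proof (induction m arbitrary: x)
  case 0
  then show ?case by (simp add: binomial_transform_def forward_difference_def)
next
  case (Suc m)
  have "binomial_transform (\<lambda>k. forward_difference f k x) (Suc m) = binomial_transform (\<lambda>k. forward_difference f k (Suc x)) m"
    unfolding binomial_transform_Suc forward_difference_Suc binomial_transform_diff by simp
  then show ?case using Suc by simp
qed

text \<open>
  For \<open>k \<ge> 2\<close> the number \<open>w(k)\<close> is the difference of order \<open>k - 2\<close> of b at 2. The next two lemmas
  sum Newton's formula twice, which brings in \<open>w(1)\<close> and then the (absent) coefficient of the empty
  set as initial values.
\<close>
lemma w_Suc_Suc: "w b (Suc (Suc k)) = forward_difference (\<lambda>i. int (b i)) k 2"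
  unfolding w_def forward_difference_def binomial_transform_def
  by (simp add: atLeast0AtMost mult_ac)

lemma binomial_transform_w_Suc:
  "binomial_transform (\<lambda>k. w b (Suc k)) m = (\<Sum>j=1..Suc m. int (b j)) - 1"
proof (induction m)
  case 0
  then show ?case by (simp add: binomial_transform_def w_def)
next
  case (Suc m)
  then show ?case
    unfolding binomial_transform_Suc w_Suc_Suc newton_forward_difference by simp
qed

lemma binomial_transform_w:
  "binomial_transform (\<lambda>k. if k = 0 then 0 else w b k) m = (\<Sum>i=1..m. (\<Sum>j=1..i. int (b j)) - 1)"
proof (induction m)
  case (Suc m)
  have "binomial_transform (\<lambda>k. if Suc k = 0 then 0 else w b (Suc k)) m = (\<Sum>j=1..Suc m. int (b j)) - 1"
    by (simp add: binomial_transform_w_Suc)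
  then show ?case using Suc by (simp add: binomial_transform_Suc)
qed (simp add: binomial_transform_def)

lemma sum_Pow_card:
  assumes "finite X"
  shows "(\<Sum>A\<in>Pow X. v (card A)) = (\<Sum>k\<le>card X. int (card X choose k) * v k)"
proof -
  have "(\<Sum>A\<in>Pow X. v (card A)) = (\<Sum>k\<le>card X. \<Sum>A\<in>{A \<in> Pow X. card A = k}. v (card A))"
    using assms by (intro sum.group[symmetric]) (auto intro: card_mono)
  also have "\<dots> = (\<Sum>k\<le>card X. int (card X choose k) * v k)"
  proof (rule sum.cong)
    fix k
    have "(\<Sum>A\<in>{A \<in> Pow X. card A = k}. v (card A)) = int (card {A \<in> Pow X. card A = k}) * v k"
      by simp
    also have "{A \<in> Pow X. card A = k} = {A. A \<subseteq> X \<and> card A = k}" by auto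
    finally show "(\<Sum>A\<in>{A \<in> Pow X. card A = k}. v (card A)) = int (card X choose k) * v k"
      using n_subsets[OF assms] by simp
  qed simp
  finally show ?thesis .
qed

text \<open>
  The bound on the i-th smallest entry, after the translation that makes 0 the smallest possible entry.
\<close>
definition parking_bound :: "(nat \<Rightarrow> nat) \<Rightarrow> nat \<Rightarrow> real" where
  "parking_bound b i = (\<Sum>j=1..i. real (b j)) - 1"

text \<open>
  The sets that meet U are the subsets of I that are not subsets of \<open>I - U\<close>, and the sum of the
  coefficients over all subsets of a k-element set is the binomial transform of w at k.
\<close>
lemma rank_of_w:
  assumes I: "finite I" and U: "U \<subseteq> I"
  shows "rank_of I (\<lambda>A. real_of_int (w b (card A))) U = (\<Sum>i = card I - card U + 1..card I. parking_bound b i)"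
proof -
  let ?v = "\<lambda>k. if k = 0 then 0 else w b k"
  have tot: "(\<Sum>A\<in>Pow X. real_of_int (?v (card A))) = (\<Sum>i=1..card X. parking_bound b i)" if X: "finite X" for X :: "'a set"
  proof -
    have "(\<Sum>A\<in>Pow X. ?v (card A)) = (\<Sum>i=1..card X. (\<Sum>j=1..i. int (b j)) - 1)"
      using sum_Pow_card[OF X, of ?v] binomial_transform_w[of b "card X"] by (simp add: binomial_transform_def)
    then have "real_of_int (\<Sum>A\<in>Pow X. ?v (card A)) = real_of_int (\<Sum>i=1..card X. (\<Sum>j=1..i. int (b j)) - 1)"
      by simp
    then show ?thesis by (simp add: parking_bound_def cong: if_cong)
  qed
  have "{A. A \<subseteq> I \<and> A \<inter> U \<noteq> {}} = Pow I - Pow (I - U)" using U by auto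
  then have "rank_of I (\<lambda>A. real_of_int (w b (card A))) U = (\<Sum>A\<in>Pow I - Pow (I - U). real_of_int (?v (card A)))"
    unfolding rank_of_def
  proof (intro sum.cong)
    fix A assume "A \<in> Pow I - Pow (I - U)"
    then have "A \<noteq> {}" "finite A" using I finite_subset by auto
    then show "real_of_int (w b (card A)) = real_of_int (?v (card A))" by simp
  qed
  also have "\<dots> = (\<Sum>A\<in>Pow I. real_of_int (?v (card A))) - (\<Sum>A\<in>Pow (I - U). real_of_int (?v (card A)))"
    by (rule sum_diff) (use I in auto)
  also have "\<dots> = (\<Sum>i=1..card I. parking_bound b i) - (\<Sum>i=1..card I - card U. parking_bound b i)"
    using I card_Diff_subset[OF finite_subset[OF U I] U] by (simp only: tot finite_Diff)
  also have "\<dots> = (\<Sum>i=card I - card U + 1..card I. parking_bound b i)"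
  proof -
    have "(\<Sum>i=1..card I - card U + card U. parking_bound b i) = (\<Sum>i=1..card I - card U. parking_bound b i) + (\<Sum>i=card I - card U + 1..card I - card U + card U. parking_bound b i)"
      by (rule sum.ub_add_nat) simp
    moreover have "card U \<le> card I" using I U by (rule card_mono)
    ultimately show ?thesis by simp
  qed
  finally show ?thesis .
qed

lemma parking_bound_mono:
  assumes "i \<le> j" shows "parking_bound b i \<le> parking_bound b j"
  unfolding parking_bound_def using assms by (intro diff_right_mono sum_mono2) auto

lemma parking_bound_nonneg:
  assumes "0 < b 1" "1 \<le> i" shows "0 \<le> parking_bound b i"
proof -
  have "real (b 1) \<le> (\<Sum>j=1..i. real (b j))" using assms by (intro member_le_sum) auto
  then show ?thesis using assms(1) by (simp add: parking_bound_def)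
qed

text \<open>
  Submodularity is concavity in \<open>|U|\<close>: the increment from \<open>|V|\<close> to \<open>|U \<union> V|\<close> uses smaller bounds
  than the equally long increment from \<open>|U \<inter> V|\<close> to \<open>|U|\<close>.
\<close>
lemma polymatroid_parking:
  assumes I: "finite I" and b: "0 < b 1"
  shows "polymatroid I (\<lambda>U. \<Sum>i = card I - card U + 1..card I. parking_bound b i)"
  unfolding polymatroid_def
proof (intro conjI allI impI)
  fix U V assume UV: "U \<subseteq> V" "V \<subseteq> I"
  then have "card U \<le> card V" using I finite_subset card_mono by metis
  then show "(\<Sum>i = card I - card U + 1..card I. parking_bound b i) \<le> (\<Sum>i = card I - card V + 1..card I. parking_bound b i)"
    using b by (intro sum_mono2) (auto intro!: parking_bound_nonneg)
next
  fix U V assume UV: "U \<subseteq> I" "V \<subseteq> I"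
  let ?n = "card I"
  let ?G = "\<lambda>m. \<Sum>i = ?n - m + 1..?n. parking_bound b i"
  define e where "e = parking_bound b"
  have fin: "finite U" "finite V" using UV I finite_subset by auto
  have 1: "card (U \<union> V) + card (U \<inter> V) = card U + card V" using card_Un_Int[OF fin] by simp
  have 2: "card (U \<inter> V) \<le> card U" "card (U \<inter> V) \<le> card V" using fin by (auto intro: card_mono)
  have 3: "card (U \<union> V) \<le> ?n" using I UV by (intro card_mono) auto
  define d where "d = card U - card (U \<inter> V)"
  have split: "?G (m + d) = ?G m + (\<Sum>i<d. e (?n - m - d + 1 + i))" if "m + d \<le> ?n" for m
  proof -
    have "{?n - (m + d) + 1..?n} = {?n - (m + d) + 1..<?n - (m + d) + 1 + d} \<union> {?n - m + 1..?n}" using that by auto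
    then have "?G (m + d) = (\<Sum>i\<in>{?n - (m + d) + 1..<?n - (m + d) + 1 + d}. e i) + ?G m"
      unfolding e_def by (simp only:) (rule sum.union_disjoint, use that in auto)
    also have "(\<Sum>i\<in>{?n - (m + d) + 1..<?n - (m + d) + 1 + d}. e i) = (\<Sum>i<d. e (?n - m - d + 1 + i))"
      using sum.shift_bounds_nat_ivl[of e 0 "?n - (m + d) + 1" d] by (simp add: lessThan_atLeast0 add.commute)
    finally show ?thesis by simp
  qed
  have a: "card U = card (U \<inter> V) + d" "card (U \<union> V) = card V + d" using 1 2 by (auto simp: d_def)
  have "(\<Sum>i<d. e (?n - card V - d + 1 + i)) \<le> (\<Sum>i<d. e (?n - card (U \<inter> V) - d + 1 + i))"
    using 2 unfolding e_def by (intro sum_mono parking_bound_mono) auto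
  then show "?G (card (U \<union> V)) + ?G (card (U \<inter> V)) \<le> ?G (card U) + ?G (card V)"
    unfolding a using split[of "card V"] split[of "card (U \<inter> V)"] 3 2 a by simp
qed simp

section \<open>The inequalities of the parking polytope\<close>

lemma exists_monotone_enumeration:
  fixes f :: "'n::finite \<Rightarrow> 'b::linorder"
  shows "\<exists>ks. distinct ks \<and> set ks = (UNIV :: 'n set) \<and> sorted (map f ks)"
proof -
  obtain ks0 where "set ks0 = (UNIV :: 'n set)" "distinct ks0"
    using finite_distinct_list[of "UNIV :: 'n set"] by auto
  then show ?thesis by (intro exI[of _ "sort_key f ks0"]) auto
qed

lemma enumeration_bij:
  assumes "distinct ks" "set ks = (UNIV :: 'n::finite set)"
  shows "length ks = CARD('n)" "bij_betw (\<lambda>i. ks ! (i - 1)) {1..CARD('n)} (UNIV :: 'n set)"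
proof -
  show len: "length ks = CARD('n)" using assms distinct_card by metis
  have "bij_betw (\<lambda>i. i - 1) {1..CARD('n)} {..<length ks}"
    by (rule bij_betwI[where g = Suc]) (auto simp: len)
  moreover have "bij_betw (\<lambda>i. ks ! i) {..<length ks} UNIV"
    using bij_betw_nth[OF assms(1), of "{..<length ks}" UNIV] assms(2) by simp
  ultimately show "bij_betw (\<lambda>i. ks ! (i - 1)) {1..CARD('n)} (UNIV :: 'n set)"
    using bij_betw_trans by (fastforce simp: o_def)
qed

lemma nondecreasing_rearrangement_enumeration:
  fixes \<beta> :: "nat ^ 'n::finite"
  assumes "distinct ks" "set ks = UNIV" "sorted (map (($) \<beta>) ks)"
  shows "nondecreasing_rearrangement \<beta> = map (($) \<beta>) ks"
proof -
  have "mset_set (UNIV :: 'n set) = mset ks" using assms by (metis mset_set_set)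
  then have "image_mset (\<lambda>k. \<beta> $ k) (mset_set UNIV) = mset (map (($) \<beta>) ks)" by simp
  then have "nondecreasing_rearrangement \<beta> = sort (map (($) \<beta>) ks)"
    unfolding nondecreasing_rearrangement_def by (simp only: sorted_list_of_multiset_mset)
  then show ?thesis using assms(3) by (simp add: sorted_sort_id)
qed

text \<open>
  An arbitrary enumeration may replace the sorted one: if the entries \<open>h(1), \<dots>, h(i)\<close> are at most
  the i-th bound, then so is the i-th smallest entry.
\<close>
lemma parking_function_iff:
  fixes \<beta> :: "nat ^ 'n::finite"
  shows "parking_function b \<beta> \<longleftrightarrow> (\<forall>k. 0 < \<beta> $ k) \<and>
    (\<exists>h. bij_betw h {1..CARD('n)} UNIV \<and> (\<forall>i\<in>{1..CARD('n)}. \<beta> $ h i \<le> (\<Sum>j=1..i. b j)))"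
proof -
  obtain ks :: "'n list" where ks: "distinct ks" "set ks = UNIV" "sorted (map (($) \<beta>) ks)"
    using exists_monotone_enumeration[of "($) \<beta>"] by blast
  note len = enumeration_bij(1)[OF ks(1,2)]
  have nr: "nondecreasing_rearrangement \<beta> ! (i - 1) = \<beta> $ (ks ! (i - 1))" if "i \<in> {1..CARD('n)}" for i
  proof -
    have "i - 1 < length ks" using that len by auto
    then show ?thesis by (simp add: nondecreasing_rearrangement_enumeration[OF ks])
  qed
  have "nondecreasing_rearrangement \<beta> ! (i - 1) \<le> (\<Sum>j=1..i. b j)"
    if h: "bij_betw h {1..CARD('n)} (UNIV :: 'n set)" "\<forall>i\<in>{1..CARD('n)}. \<beta> $ h i \<le> (\<Sum>j=1..i. b j)" and i: "i \<in> {1..CARD('n)}" for h i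
  proof (rule ccontr)
    assume "\<not> ?thesis"
    then have gt: "(\<Sum>j=1..i. b j) < \<beta> $ (ks ! (i - 1))" using nr[OF i] by simp
    have "h ` {1..i} \<subseteq> (\<lambda>j. ks ! j) ` {..<i - 1}"
    proof
      fix k assume "k \<in> h ` {1..i}"
      then obtain m where m: "k = h m" "1 \<le> m" "m \<le> i" by auto
      then have "\<beta> $ k \<le> (\<Sum>j=1..m. b j)" using h(2) i by auto
      also have "\<dots> \<le> (\<Sum>j=1..i. b j)" using m by (intro sum_mono2) auto
      finally have le: "\<beta> $ k < \<beta> $ (ks ! (i - 1))" using gt by simp
      obtain j where j: "j < length ks" "k = ks ! j" using ks(2) by (metis UNIV_I in_set_conv_nth)
      have "j < i - 1"
      proof (rule ccontr)
        assume "\<not> j < i - 1"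
        then have "map (($) \<beta>) ks ! (i - 1) \<le> map (($) \<beta>) ks ! j"
          using ks(3) j by (intro sorted_nth_mono) auto
        moreover have "i - 1 < length ks" using i len by auto
        ultimately show False using le j by simp
      qed
      then show "k \<in> (\<lambda>j. ks ! j) ` {..<i - 1}" using j by auto
    qed
    then have "card (h ` {1..i}) \<le> card {..<i - 1}"
      by (meson card_image_le card_mono finite_imageI finite_lessThan order_trans)
    moreover have "inj_on h {1..i}" using h(1) i by (auto simp: bij_betw_def intro: inj_on_subset)
    ultimately have "i \<le> i - 1" by (simp add: card_image)
    then show False using i by auto
  qed
  moreover have "\<exists>h. bij_betw h {1..CARD('n)} (UNIV :: 'n set) \<and> (\<forall>i\<in>{1..CARD('n)}. \<beta> $ h i \<le> (\<Sum>j=1..i. b j))"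
    if "\<forall>i\<in>{1..CARD('n)}. nondecreasing_rearrangement \<beta> ! (i - 1) \<le> (\<Sum>j=1..i. b j)"
    using that nr enumeration_bij(2)[OF ks(1,2)] by (intro exI[of _ "\<lambda>i. ks ! (i - 1)"]) simp
  ultimately show ?thesis unfolding parking_function_def by blast
qed

definition shifted_parking_polytope :: "(nat \<Rightarrow> nat) \<Rightarrow> (real ^ 'n) set" where
  "shifted_parking_polytope b = {y. (\<forall>k. 0 \<le> y $ k) \<and>
     (\<forall>U. (\<Sum>k\<in>U. y $ k) \<le> (\<Sum>i = CARD('n) - card U + 1..CARD('n). parking_bound b i))}"

lemma sum_le_sum_top:
  fixes e :: "nat \<Rightarrow> real"
  assumes "\<And>i j. i \<le> j \<Longrightarrow> e i \<le> e j" "J \<subseteq> {1..n}"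
  shows "sum e J \<le> (\<Sum>i = n - card J + 1..n. e i)"
  using assms(2)
proof (induction n arbitrary: J)
  case 0
  then show ?case by simp
next
  case (Suc n)
  have fin: "finite J" using Suc.prems finite_subset by blast
  show ?case
  proof (cases "Suc n \<in> J")
    case True
    let ?J = "J - {Suc n}"
    have J: "?J \<subseteq> {1..n}" using Suc.prems by auto
    have c: "card J = Suc (card ?J)" using card_Suc_Diff1[OF fin True] by simp
    have "card ?J \<le> n" using card_mono[OF _ J] by simp
    then have "(\<Sum>i = Suc n - card J + 1..Suc n. e i) = (\<Sum>i = n - card ?J + 1..n. e i) + e (Suc n)"
      unfolding c by simp
    moreover have "sum e J = sum e ?J + e (Suc n)" using sum.remove[OF fin True, of e] by simp
    ultimately show ?thesis using Suc.IH[OF J] by simp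
  next
    case False
    then have J: "J \<subseteq> {1..n}" using Suc.prems by (auto simp: le_Suc_eq)
    have c: "card J \<le> n" using card_mono[OF _ J] by simp
    have "sum e J \<le> (\<Sum>i = n - card J + 1..n. e i)" by (rule Suc.IH[OF J])
    also have "\<dots> \<le> (\<Sum>i = n - card J + 1..n. e (Suc i))" by (intro sum_mono assms(1)) simp
    also have "\<dots> = (\<Sum>i = Suc n - card J + 1..Suc n. e i)"
      using c by (simp add: sum.shift_bounds_cl_Suc_ivl[symmetric] Suc_diff_le)
    finally show ?thesis .
  qed
qed

lemma parking_function_in_polytope:
  fixes \<beta> :: "nat ^ 'n::finite"
  assumes "parking_function b \<beta>"
  shows "(\<chi> k. real (\<beta> $ k)) \<in> (+) 1 ` (shifted_parking_polytope b :: (real ^ 'n) set)"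
proof -
  obtain h where pos: "\<forall>k. 0 < \<beta> $ k" and h: "bij_betw h {1..CARD('n)} (UNIV :: 'n set)"
    "\<forall>i\<in>{1..CARD('n)}. \<beta> $ h i \<le> (\<Sum>j=1..i. b j)"
    using assms unfolding parking_function_iff by blast
  let ?y = "\<chi> k. real (\<beta> $ k) - 1 :: real ^ 'n"
  have "(\<Sum>k\<in>U. ?y $ k) \<le> (\<Sum>i = CARD('n) - card U + 1..CARD('n). parking_bound b i)" for U
  proof -
    define J where "J = {i \<in> {1..CARD('n)}. h i \<in> U}"
    have im: "h ` {1..CARD('n)} = UNIV" using h(1) by (simp add: bij_betw_def)
    have "U \<subseteq> h ` J"
    proof
      fix k assume k: "k \<in> U"
      have "k \<in> h ` {1..CARD('n)}" unfolding im by simp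
      then obtain i where "i \<in> {1..CARD('n)}" "k = h i" by (rule imageE)
      then show "k \<in> h ` J" using k by (simp add: J_def)
    qed
    moreover have "inj_on h J" using h(1) by (auto simp: bij_betw_def J_def intro: inj_on_subset)
    ultimately have hJ: "bij_betw h J U" by (auto simp: bij_betw_def J_def)
    have "(\<Sum>k\<in>U. ?y $ k) = (\<Sum>i\<in>J. ?y $ h i)"
      by (rule sum.reindex_bij_betw[OF hJ, symmetric])
    also have "\<dots> \<le> (\<Sum>i\<in>J. parking_bound b i)"
    proof (rule sum_mono)
      fix i assume "i \<in> J"
      then have "real (\<beta> $ h i) \<le> real (\<Sum>j=1..i. b j)" using h(2) by (auto simp: J_def simp del: of_nat_sum)
      then show "?y $ h i \<le> parking_bound b i" by (simp add: parking_bound_def)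
    qed
    also have "\<dots> \<le> (\<Sum>i = CARD('n) - card J + 1..CARD('n). parking_bound b i)"
      by (rule sum_le_sum_top[OF parking_bound_mono]) (auto simp: J_def)
    also have "card J = card U" by (rule bij_betw_same_card[OF hJ])
    finally show ?thesis .
  qed
  then have "?y \<in> shifted_parking_polytope b"
    using pos by (auto simp: shifted_parking_polytope_def Suc_le_eq)
  moreover have "(\<chi> k. real (\<beta> $ k)) = 1 + ?y" by (simp add: vec_eq_iff)
  ultimately show ?thesis by blast
qed

lemma convex_shifted_parking_polytope: "convex (shifted_parking_polytope b :: (real ^ 'n::finite) set)"
proof -
  have "convex {y :: real ^ 'n. 0 \<le> y $ k}" for k
  proof -
    have "{y :: real ^ 'n. 0 \<le> y $ k} = {y. axis k 1 \<bullet> y \<ge> 0}" by (simp add: inner_axis')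
    then show ?thesis by (simp only: convex_halfspace_ge)
  qed
  moreover have "convex {y :: real ^ 'n. (\<Sum>k\<in>U. y $ k) \<le> M}" for U M
  proof -
    have "{y :: real ^ 'n. (\<Sum>k\<in>U. y $ k) \<le> M} = {y. (\<Sum>k\<in>U. axis k 1) \<bullet> y \<le> M}"
      by (simp add: inner_axis' inner_sum_left)
    then show ?thesis by (simp only: convex_halfspace_le)
  qed
  moreover have "shifted_parking_polytope b = (\<Inter>k. {y :: real ^ 'n. 0 \<le> y $ k}) \<inter>
     (\<Inter>U. {y. (\<Sum>k\<in>U. y $ k) \<le> (\<Sum>i = CARD('n) - card U + 1..CARD('n). parking_bound b i)})"
    by (auto simp: shifted_parking_polytope_def)
  ultimately show ?thesis by (simp add: convex_INT convex_Int)
qed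

text \<open>
  Summation by parts, in the form of an inequality between tails proved from the right end.
\<close>
lemma abel_tail_sums:
  fixes \<alpha> z :: "nat \<Rightarrow> real"
  assumes mono: "\<And>i j. 1 \<le> i \<Longrightarrow> i \<le> j \<Longrightarrow> j \<le> n \<Longrightarrow> \<alpha> i \<le> \<alpha> j" and pos: "\<And>i. 1 \<le> i \<Longrightarrow> i \<le> n \<Longrightarrow> 0 \<le> \<alpha> i"
    and tail: "\<And>m. 1 \<le> m \<Longrightarrow> m \<le> n \<Longrightarrow> 0 \<le> (\<Sum>i=m..n. z i)"
  shows "0 \<le> (\<Sum>i=1..n. \<alpha> i * z i)"
proof (cases "n = 0")
  case False
  have "\<alpha> m * (\<Sum>i=m..n. z i) \<le> (\<Sum>i=m..n. \<alpha> i * z i)" if "m \<le> n" "1 \<le> m" for m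
    using that
  proof (induction m rule: inc_induct)
    case base
    then show ?case by simp
  next
    case (step m)
    have "\<alpha> m * (\<Sum>i=m..n. z i) = \<alpha> m * z m + \<alpha> m * (\<Sum>i=Suc m..n. z i)"
      using step by (simp add: sum.atLeast_Suc_atMost distrib_left)
    also have "\<dots> \<le> \<alpha> m * z m + \<alpha> (Suc m) * (\<Sum>i=Suc m..n. z i)"
      using step by (intro add_left_mono mult_right_mono mono tail) auto
    also have "\<dots> \<le> \<alpha> m * z m + (\<Sum>i=Suc m..n. \<alpha> i * z i)" using step by simp
    also have "\<dots> = (\<Sum>i=m..n. \<alpha> i * z i)" using step by (simp add: sum.atLeast_Suc_atMost)
    finally show ?case .
  qed
  from this[of 1] have "\<alpha> 1 * (\<Sum>i=1..n. z i) \<le> (\<Sum>i=1..n. \<alpha> i * z i)" using False by simp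
  moreover have "0 \<le> \<alpha> 1 * (\<Sum>i=1..n. z i)" using False by (intro mult_nonneg_nonneg pos tail) auto
  ultimately show ?thesis by linarith
qed simp

lemma finite_parking_functions: "finite {\<beta> :: nat ^ 'n::finite. parking_function b \<beta>}"
proof -
  let ?B = "{.. \<Sum>j=1..CARD('n). b j}"
  have "{\<beta> :: nat ^ 'n. parking_function b \<beta>} \<subseteq> vec_lambda ` (UNIV \<rightarrow>\<^sub>E ?B)"
  proof
    fix \<beta> :: "nat ^ 'n" assume "\<beta> \<in> {\<beta>. parking_function b \<beta>}"
    then obtain h where h: "bij_betw h {1..CARD('n)} (UNIV :: 'n set)" "\<forall>i\<in>{1..CARD('n)}. \<beta> $ h i \<le> (\<Sum>j=1..i. b j)"
      unfolding parking_function_iff by blast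
    have "\<beta> $ k \<le> (\<Sum>j=1..CARD('n). b j)" for k
    proof -
      obtain i where i: "i \<in> {1..CARD('n)}" "k = h i" using h(1) by (metis UNIV_I bij_betw_imp_surj_on imageE)
      then have "\<beta> $ k \<le> (\<Sum>j=1..i. b j)" using h(2) by blast
      also have "\<dots> \<le> (\<Sum>j=1..CARD('n). b j)" using i by (intro sum_mono2) auto
      finally show ?thesis .
    qed
    then have "vec_nth \<beta> \<in> UNIV \<rightarrow>\<^sub>E ?B" by auto
    moreover have "\<beta> = vec_lambda (vec_nth \<beta>)" by simp
    ultimately show "\<beta> \<in> vec_lambda ` (UNIV \<rightarrow>\<^sub>E ?B)" by blast
  qed
  then show ?thesis by (rule finite_subset) (intro finite_imageI finite_PiE; simp)
qed

text \<open>
  A linear functional a is maximized greedily: the largest positive coefficient of a receives the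
  largest bound, and so on, while coordinates with a nonpositive coefficient receive 1. Summation
  by parts along the increasing order of a compares this with any vector that satisfies the
  inequalities.
\<close>
lemma parking_polytope_support:
  fixes a y :: "real ^ 'n::finite"
  assumes b: "\<forall>i\<in>{1..CARD('n)}. 0 < b i" and y: "y \<in> shifted_parking_polytope b"
  shows "\<exists>\<beta> :: nat ^ 'n. parking_function b \<beta> \<and> a \<bullet> (1 + y) \<le> a \<bullet> (\<chi> k. real (\<beta> $ k))"
proof -
  let ?n = "CARD('n)"
  obtain ks :: "'n list" where ks: "distinct ks" "set ks = UNIV" "sorted (map (($) a) ks)"
    using exists_monotone_enumeration[of "($) a"] by blast
  note len = enumeration_bij(1)[OF ks(1,2)]
  define h where "h i = ks ! (i - 1)" for i
  have h: "bij_betw h {1..?n} UNIV" unfolding h_def by (rule enumeration_bij(2)[OF ks(1,2)])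
  have amono: "a $ h i \<le> a $ h j" if "1 \<le> i" "i \<le> j" "j \<le> ?n" for i j
    using sorted_nth_mono[OF ks(3), of "i - 1" "j - 1"] that len by (simp add: h_def)
  define r where "r = inv_into {1..?n} h"
  have r: "r k \<in> {1..?n}" "h (r k) = k" for k
    using h unfolding r_def by (metis UNIV_I bij_betw_def inv_into_into, metis UNIV_I bij_betw_inv_into_right)
  have rh: "r (h i) = i" if "i \<in> {1..?n}" for i
    using h that unfolding r_def by (metis bij_betw_inv_into_left)
  define \<beta> :: "nat ^ 'n" where "\<beta> = (\<chi> k. if 0 < a $ k then (\<Sum>j=1..r k. b j) else 1)"
  have b_ge: "1 \<le> (\<Sum>j=1..i. b j)" if "i \<in> {1..?n}" for i
  proof -
    have "b 1 \<le> (\<Sum>j=1..i. b j)" using that by (intro member_le_sum) auto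
    moreover have "1 \<le> b 1" using b that by (auto simp: Suc_le_eq)
    ultimately show ?thesis by simp
  qed
  have "parking_function b \<beta>"
    unfolding parking_function_iff
  proof (intro conjI exI[of _ h] allI ballI h)
    fix k show "0 < \<beta> $ k" using b_ge[OF r(1), of k] by (simp add: \<beta>_def)
  next
    fix i assume i: "i \<in> {1..?n}"
    then show "\<beta> $ h i \<le> (\<Sum>j=1..i. b j)" using b_ge[OF i] by (simp add: \<beta>_def rh)
  qed
  moreover have "a \<bullet> (1 + y) \<le> a \<bullet> (\<chi> k. real (\<beta> $ k))"
  proof -
    let ?\<alpha> = "\<lambda>i. max 0 (a $ h i)"
    let ?z = "\<lambda>i. parking_bound b i - y $ h i"
    have y0: "0 \<le> y $ k" and yU: "(\<Sum>k\<in>U. y $ k) \<le> (\<Sum>i = ?n - card U + 1..?n. parking_bound b i)" for k U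
      using y unfolding shifted_parking_polytope_def by auto
    have "0 \<le> (\<Sum>i=1..?n. ?\<alpha> i * ?z i)"
    proof (rule abel_tail_sums)
      fix m assume m: "1 \<le> m" "m \<le> ?n"
      have inj: "inj_on h {m..?n}" using h m by (auto simp: bij_betw_def intro: inj_on_subset)
      have "(\<Sum>k\<in>h ` {m..?n}. y $ k) \<le> (\<Sum>i = ?n - card (h ` {m..?n}) + 1..?n. parking_bound b i)" by (rule yU)
      also have "?n - card (h ` {m..?n}) + 1 = m" using m by (simp add: card_image[OF inj])
      finally show "0 \<le> (\<Sum>i=m..?n. ?z i)" by (simp add: sum.reindex[OF inj] sum_subtractf)
    next
      show "?\<alpha> i \<le> ?\<alpha> j" if "1 \<le> i" "i \<le> j" "j \<le> ?n" for i j
        using amono[OF that] by (rule max.mono[OF order_refl])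
    qed simp
    moreover have "a $ k * (1 + y $ k) + max 0 (a $ k) * (parking_bound b (r k) - y $ k) \<le> a $ k * real (\<beta> $ k)" for k
    proof (cases "0 < a $ k")
      case True
      then show ?thesis by (simp add: \<beta>_def parking_bound_def algebra_simps)
    next
      case False
      then have "a $ k * y $ k \<le> 0" using y0 by (simp add: mult_nonpos_nonneg)
      then show ?thesis using False by (simp add: \<beta>_def max_def algebra_simps)
    qed
    then have "(\<Sum>k\<in>UNIV. a $ k * (1 + y $ k) + max 0 (a $ k) * (parking_bound b (r k) - y $ k)) \<le> (\<Sum>k\<in>UNIV. a $ k * real (\<beta> $ k))"
      by (rule sum_mono)
    moreover have "(\<Sum>k\<in>UNIV. max 0 (a $ k) * (parking_bound b (r k) - y $ k)) = (\<Sum>i=1..?n. ?\<alpha> i * ?z i)"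
      by (subst sum.reindex_bij_betw[OF h, symmetric]) (simp add: rh)
    ultimately show ?thesis by (simp add: inner_vec_def sum.distrib)
  qed
  ultimately show ?thesis by blast
qed

text \<open>
  A point outside the convex hull could be separated from it, but by \<open>parking_polytope_support\<close> some
  parking function is at least as large as the point with respect to any functional.
\<close>
lemma parking_polytope_eq:
  assumes b: "\<forall>i\<in>{1..CARD('n)}. 0 < b i"
  shows "parking_polytope b = (+) 1 ` (shifted_parking_polytope b :: (real ^ 'n::finite) set)"
proof (intro equalityI)
  let ?V = "(\<lambda>\<beta>. \<chi> k. real (\<beta> $ k) :: real ^ 'n) ` {\<beta>. parking_function b \<beta>}"
  show "parking_polytope b \<subseteq> (+) 1 ` (shifted_parking_polytope b :: (real ^ 'n) set)"
    unfolding parking_polytope_def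
    by (intro hull_minimal convex_translation convex_shifted_parking_polytope) (auto intro: parking_function_in_polytope)
  show "(+) 1 ` (shifted_parking_polytope b :: (real ^ 'n) set) \<subseteq> parking_polytope b"
  proof (rule image_subsetI, rule ccontr)
    fix y :: "real ^ 'n" assume y: "y \<in> shifted_parking_polytope b" and no: "1 + y \<notin> parking_polytope b"
    have "compact (convex hull ?V)"
      by (intro compact_convex_hull finite_imp_compact finite_imageI finite_parking_functions)
    then have "closed (convex hull ?V)" by (rule compact_imp_closed)
    then obtain a \<beta>0 where sep: "a \<bullet> (1 + y) < \<beta>0" "\<forall>x\<in>convex hull ?V. \<beta>0 < a \<bullet> x"
      using separating_hyperplane_closed_point[of "convex hull ?V" "1 + y"] no
      unfolding parking_polytope_def by blast
    obtain \<beta> :: "nat ^ 'n" where \<beta>: "parking_function b \<beta>" "(- a) \<bullet> (1 + y) \<le> (- a) \<bullet> (\<chi> k. real (\<beta> $ k))"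
      using parking_polytope_support[OF b y, of "- a"] by blast
    have "(\<chi> k. real (\<beta> $ k)) \<in> convex hull ?V" using \<beta>(1) by (intro hull_inc) auto
    then have "\<beta>0 < a \<bullet> (\<chi> k. real (\<beta> $ k))" using sep(2) by blast
    then show False using \<beta>(2) sep(1) by simp
  qed
qed

section \<open>The volume of the parking polytope\<close>

lemma volume_shifted_parking_polytope:
  fixes b :: "nat \<Rightarrow> nat"
  defines "g \<equiv> (\<lambda>U :: (real ^ 'n::finite) set. \<Sum>i = CARD('n) - card U + 1..CARD('n). parking_bound b i)"
  shows "measure lebesgue (shifted_parking_polytope b :: (real ^ 'n) set) =
     measure (leb (Basis :: (real ^ 'n) set)) (indep_polytope Basis g)"
proof -
  let ?Y = "shifted_parking_polytope b :: (real ^ 'n) set"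
  let ?s = "\<lambda>f. \<Sum>v\<in>Basis. f v *\<^sub>R (v :: real ^ 'n)"
  have "closed ?Y"
  proof -
    have "?Y = (\<Inter>k. {y. 0 \<le> y $ k}) \<inter>
     (\<Inter>U. {y. (\<Sum>k\<in>U. y $ k) \<le> (\<Sum>i = CARD('n) - card U + 1..CARD('n). parking_bound b i)})"
      by (auto simp: shifted_parking_polytope_def)
    also have "closed \<dots>"
      by (intro closed_Int closed_INT ballI closed_Collect_le continuous_intros)
    finally show ?thesis .
  qed
  then have Y: "?Y \<in> sets borel" by (rule borel_closed)
  have inj: "inj (\<lambda>k :: 'n. axis k (1 :: real))" by (auto simp: inj_on_def axis_eq_axis)
  have B: "(Basis :: (real ^ 'n) set) = range (\<lambda>k. axis k 1)"
    by (auto simp: Basis_vec_def)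
  have comp: "?s f $ k = f (axis k 1)" for f k
  proof -
    have "?s f $ k = ?s f \<bullet> axis k 1" by (simp add: inner_axis)
    also have "\<dots> = f (axis k 1)" by (rule inner_sum_left_Basis) (simp add: B)
    finally show ?thesis .
  qed
  have mem: "?s f \<in> ?Y \<longleftrightarrow> (\<forall>v\<in>Basis. 0 \<le> f v) \<and> (\<forall>U\<subseteq>Basis. sum f U \<le> g U)" for f
  proof -
    have img: "sum f ((\<lambda>k. axis k 1) ` U) = (\<Sum>k\<in>U. f (axis k 1))" "card ((\<lambda>k. axis k (1 :: real)) ` U) = card U" for U :: "'n set"
      using inj by (auto simp: sum.reindex inj_on_subset card_image)
    have "(\<forall>U. (\<Sum>k\<in>U. ?s f $ k) \<le> (\<Sum>i = CARD('n) - card U + 1..CARD('n). parking_bound b i)) \<longleftrightarrow>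
       (\<forall>U :: 'n set. sum f ((\<lambda>k. axis k 1) ` U) \<le> g ((\<lambda>k. axis k 1) ` U))"
      by (simp only: comp img g_def)
    also have "\<dots> \<longleftrightarrow> (\<forall>U\<subseteq>Basis. sum f U \<le> g U)"
      unfolding B by (metis subset_image_iff subset_UNIV)
    finally have "(\<forall>U. (\<Sum>k\<in>U. ?s f $ k) \<le> (\<Sum>i = CARD('n) - card U + 1..CARD('n). parking_bound b i)) \<longleftrightarrow>
       (\<forall>U\<subseteq>Basis. sum f U \<le> g U)" .
    moreover have "(\<forall>k. 0 \<le> ?s f $ k) \<longleftrightarrow> (\<forall>v\<in>Basis. 0 \<le> f v)"
      by (simp only: comp) (simp add: B)
    ultimately show ?thesis by (simp only: shifted_parking_polytope_def mem_Collect_eq)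
  qed
  have "emeasure lborel ?Y = emeasure (distr (leb Basis) borel ?s) ?Y"
    by (subst lborel_eq) simp
  also have "\<dots> = emeasure (leb Basis) (?s -` ?Y \<inter> space (leb Basis))"
    by (rule emeasure_distr) (use Y in auto)
  also have "?s -` ?Y \<inter> space (leb Basis) = indep_polytope Basis g"
    using mem by (auto simp: indep_polytope_def space_PiM PiE_def)
  finally have "measure lborel ?Y = measure (leb Basis) (indep_polytope Basis g)"
    by (simp add: measure_def)
  moreover have "measure lebesgue ?Y = measure lborel ?Y"
    using Y by (intro measure_completion) simp
  ultimately show ?thesis by simp
qed

theorem corollary5p11:
  fixes b :: "nat \<Rightarrow> nat" and n :: nat
  assumes "n = CARD('n::finite)"
    and "\<forall>i\<in>{1..n}. 0 < b i"
    and "\<not> (n = 1 \<and> b 1 = 1)"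
  shows "measure lebesgue (parking_polytope b :: (real ^ 'n) set) =
    (\<Sum>\<alpha> | \<alpha> \<in> draconian n \<and> (\<Sum>A\<in>nonempty_subsets n. \<alpha> A) = n.
       \<Prod>A\<in>nonempty_subsets n. real_of_int (w b (card A)) ^ \<alpha> A / fact (\<alpha> A))"
proof -
  let ?B = "Basis :: (real ^ 'n) set"
  let ?c = "\<lambda>A :: (real ^ 'n) set. real_of_int (w b (card A))"
  have cB: "card ?B = n" using assms(1) by simp
  have n: "1 \<le> n" using assms(1) by (simp add: Suc_le_eq)
  then have b1: "0 < b 1" using assms(2) by simp
  have rank: "rank_of ?B ?c U = (\<Sum>i = CARD('n) - card U + 1..CARD('n). parking_bound b i)" if "U \<subseteq> ?B" for U
    using rank_of_w[OF finite_Basis that, of b] cB assms(1) by simp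
  have "polymatroid ?B (\<lambda>U. \<Sum>i = CARD('n) - card U + 1..CARD('n). parking_bound b i)"
    using polymatroid_parking[of ?B b] b1 cB assms(1) by simp
  then have pm: "polymatroid ?B (rank_of ?B ?c)"
    using polymatroid_cong[of ?B "rank_of ?B ?c", OF rank] by (simp only:)
  have "measure lebesgue (parking_polytope b :: (real ^ 'n) set) = measure lebesgue (shifted_parking_polytope b :: (real ^ 'n) set)"
    using assms(1,2) by (simp add: parking_polytope_eq measure_translation)
  also have "\<dots> = measure (leb ?B) (indep_polytope ?B (rank_of ?B ?c))"
    unfolding volume_shifted_parking_polytope using rank by (intro arg_cong[of _ _ "measure (leb ?B)"] indep_polytope_cong) simp
  also have "\<dots> = marriage_poly ?B ?c"
    using polymatroid_volume[of ?B] pm unfolding volume_formula_def by simp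
  also have "\<dots> = marriage_poly {1..n} (\<lambda>A. real_of_int (w b (card A)))"
    by (rule marriage_poly_card_cong) (use cB in auto)
  also have "\<dots> = (\<Sum>\<alpha> | \<alpha> \<in> draconian n \<and> (\<Sum>A\<in>nonempty_subsets n. \<alpha> A) = n.
       \<Prod>A\<in>nonempty_subsets n. real_of_int (w b (card A)) ^ \<alpha> A / fact (\<alpha> A))"
    by (rule marriage_poly_draconian)
  finally show ?thesis .
qed

end
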